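(* Let $0<q<1$, $N,n\ge1$ finite and $m\ge2N$. On $\mathcal M$, for $\sigma,\tau\in\{+,-\}$, $$(\mathbb H_i^\sigma)^2=0,\qquad[\mathbb H_i^\sigma,\mathbb H_j^\tau]=0\quad(i\ne j).$$ Consequently $\mathbb U_q^\pm=\prod_{i=1}^N(I+\mathbb H_i^\pm)$, and $\mathbb R_q:=\mathbb U_q^+(\mathbb U_q^-)^{-1}$ factorizes as $$\mathbb R_q=\prod_{i=1}^N\mathbb R_i,\qquad\mathbb R_i:=(I+\mathbb H_i^+)(I-\mathbb H_i^-),$$ with mutually commuting $\mathbb R_i$ and $\mathbb R_i^{-1}=(I+\mathbb H_i^-)(I-\mathbb H_i^+)$.
   Context: **Coordinates.** $[r]_q=\frac{1-q^r}{1-q}$, $c_r=\frac12[2r]_q$. For $1\le k\le N$, $1\le a\le m$ let $z_{ka},\bar z_{ka}$ be independent commuting variables; $f_a,f_a^\dagger$ is a Witt basis of the complex Clifford algebra $\mathrm{Cl}_{2m}$: $\{f_a,f_b\}=\{f_a^\dagger,f_b^\dagger\}=0$, $\{f_a,f_b^\dagger\}=\delta_{ab}$. $\mathscr P^{\rm Cl}_{m,N}=\mathbb C[z_{ka},\bar z_{ka}]\otimes\mathrm{Cl}_{2m}$ ($\mathbb Z_2$-graded by Clifford parity). $\ddagger$ is the order-preserving antilinear involution $z\leftrightarrow\bar z$, $f_a\leftrightarrow f_a^\dagger$, $\vartheta\leftrightarrow\bar\vartheta$, $a\leftrightarrow b$ (fermionic symbols below), and $X^\ddagger=\ddagger X\ddagger$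 on operators. **Capelli contractions.** $\delta_a$ is the odd antiderivation of Clifford coefficients with $\delta_a(f_b)=\delta_{ab}$, $\delta_a(f_b^\dagger)=0$. $\mathfrak s_i=\sum_a\delta_a\partial_{z_{ia}}$, $\mathcal E^z_{ji}=\sum_az_{ja}\partial_{z_{ia}}$, $(\mathcal C_z)_{ij}=m\delta_{ij}+\mathcal E^z_{ji}$ (an $N\times N$ matrix of operators, invertible on columns of polynomials in each homogeneous degree for $m\ge2N$). $\mathfrak n_i^+=\sum_\ell(\mathcal C_z^{-1})_{i\ell}\mathfrak s_\ell$, $\mathfrak n_i^-=(\mathfrak n_i^+)^\ddagger$. **Fermionic data.** One pair: Grassmann generators $\vartheta,\bar\vartheta$ (odd), Weyl generators $a,b$ (even), $ab-ba=-2i$, $B=ba-i$. Put $s=\frac1nq^{2m-2n}[2n]_q$, $\sigma R(B)=R(B+2i)$; $\mathcal A_s^{\min}$ is the localization of $\mathbb C[B]$ at the multiplicative set generated by $\sigma^k(B-i),\sigma^k(s-2iB),\sigma^k(s+2iB)$, $k\in\mathbb Z$. $x_j=a^j$ ($j\ge0$), $x_j=b^{-j}$ ($j<0$); $\beta_j(B)=B+(2j-1)i$ for $j\ge1$ and $1$ for $j\le0$; $\alpha_j(B)=1$ for $j\ge0$ and $B+(2j+1)i$ for $j\le-1$. The charge-$c$ module ($c\in\mathbb Z$) is the free right $\mathcal A_s^{\min}$-module on $e_{0,c}=x_c$, $e_{\vartheta,c}=\vartheta x_{c+1}$, $e_{\bar\vartheta,c}=\bar\vartheta x_{c-1}$,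 $e_{2,c}=\vartheta\bar\vartheta x_c$. $\Phi_s(B)=\frac{4-s+2iB}{B-i}$, $\Psi_s(B)=\frac{-s-2iB}{B-i}$, $\sigma_c^+(B)=\beta_{c+1}(B)\Phi_s(B+2i(c+1))$, $\sigma_c^-(B)=\alpha_{c-1}(B)\Psi_s(B+2ic)$, $\pi_c^\pm=-\frac14\sigma_c^\pm$. Right-linear maps (zero on unlisted basis vectors): $\mathbb h_c^+:e_{0,c}\mapsto e_{\vartheta,c}(\pi_c^+)^{-1},\ e_{\bar\vartheta,c}\mapsto2i\,e_{2,c}\beta_c^{-1}$; its $\ddagger$-conjugate ($c\leftrightarrow-c$) is $\mathbb h_c^-:e_{0,c}\mapsto e_{\bar\vartheta,c}(\pi_c^-)^{-1},\ e_{\vartheta,c}\mapsto2i\,e_{2,c}\alpha_c^{-1}$. For $n$ pairs and $\mathbf c\in\mathbb Z^n$ take the graded tensor product of the one-pair modules; $\mathbb h^\pm=\frac1n\sum_j\widehat{\mathbb h}_j^\pm$ (hats: graded embeddings in factor $j$). Let $\widehat{\mathsf P}_j^+$ be the projector on the span of $e_{\bar\vartheta,c_j},e_{2,c_j}$ in factor $j$ (killing $e_{0,c_j},e_{\vartheta,c_j}$), $\mathsf P_S^+=\prod_{j\in S}\widehat{\mathsf P}_j^+\prod_{j\notin S}(I-\widehat{\mathsf P}_j^+)$; $\kappa_c^+=-\frac14\sigma_c^+\alpha_c$, $K_c=\frac1{2i}\alpha_{c-1}\beta_c$, $\delta_m(q)=\frac{2m-[2m]_q}4$, and $$\mathbb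 M^+=\delta_m(q)I+\sum_{\varnothing\ne S}\mathsf P_S^+\Big(\sum_{j\in S}\kappa_{c_j}^+-|S|-B_q^{(|S|)}(E_{\bar z})\sum_{j\in S}K_{c_j}\Big),\qquad \mathbb N^+=-\mathbb h^+\mathbb M^+,$$ where $B_q^{(k)}(E_{\bar z})$ is the scalar $\frac{c_{r+k}}{r+k}$ on bosonic elements of antiholomorphic Euler degree $r$. $\mathbb M^-,\mathbb N^-$ are the $\ddagger$-conjugates (depending on the holomorphic Euler degree). $\mathscr F_k$ ($1\le k\le N$) is a copy, for label $k$, of the direct sum over $\mathbf c\in\mathbb Z^n$ of these modules, graded by Grassmann parity; $\mathbb N_k^\pm$ are the corresponding (odd) operators, the Euler degree in $\mathbb N_k^+$ (resp. $\mathbb N_k^-$) being that in the variables $\bar z_k$ (resp. $z_k$), its coefficient acting on the bosonic factor. **Transport.** $\mathcal M=\mathscr P^{\rm Cl}_{m,N}\widehat\otimes\mathscr F_1\widehat\otimes\cdots\widehat\otimes\mathscr F_N$ (graded tensor product), $(X\widehat\otimes Y)(F\otimes e)=(-1)^{|Y||F|}XF\otimes Ye$; $\mathbb H_i^\pm=\mathfrak n_i^\pm\widehat\otimes\mathbb N_i^\pm$, $\mathbb U_q^\pm=\exp(\sum_{i=1}^N\mathbb H_i^\pm)$. *)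

theory Defs
  imports
    Complex_Main
    "HOL-Library.Poly_Mapping"
    "HOL-Library.FuncSet"
    "HOL-Library.Product_Lexorder"
    "HOL-Computational_Algebra.Fraction_Field"
begin

text \<open>
  Labels \<open>k\<close> of copies, \<open>a\<close> of coordinates and \<open>j\<close> of fermionic pairs are numbered from \<open>0\<close>,
  i.e. \<open>k < N\<close>, \<open>a < m\<close>, \<open>j < n\<close>.  A free module with a given basis is the type of finitely
  supported coefficient functions on the basis; the parameters \<open>m\<close>, \<open>n\<close>, \<open>N\<close>, \<open>q\<close> enter through
  carrier sets.
\<close>

datatype pm = Plus | Minus

definition scale :: "'r \<Rightarrow> ('i \<Rightarrow>\<^sub>0 'r) \<Rightarrow> ('i \<Rightarrow>\<^sub>0 'r::comm_semiring_1)" where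
  "scale c u = Poly_Mapping.map ((*) c) u"

definition lin_ext :: "('i \<Rightarrow> ('j \<Rightarrow>\<^sub>0 'r)) \<Rightarrow> ('i \<Rightarrow>\<^sub>0 'r) \<Rightarrow> ('j \<Rightarrow>\<^sub>0 'r::comm_semiring_1)" where
  "lin_ext f u = (\<Sum>i\<in>Poly_Mapping.keys u. scale (Poly_Mapping.lookup u i) (f i))"

lemma sum_singles: "u = (\<Sum>i\<in>Poly_Mapping.keys u. Poly_Mapping.single i (Poly_Mapping.lookup u i))"
  by (rule poly_mapping_eqI)
     (simp add: lookup_sum lookup_single when_def sum.delta in_keys_iff)

lemma single_add_induct [case_names zero single add]:
  assumes "P 0"
    and single: "\<And>i c. i \<in> Poly_Mapping.keys u \<Longrightarrow> P (Poly_Mapping.single i c)"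
    and add: "\<And>v w. P v \<Longrightarrow> P w \<Longrightarrow> P (v + w)"
  shows "P (u :: 'i \<Rightarrow>\<^sub>0 'r::comm_monoid_add)"
proof -
  have "finite K \<Longrightarrow> K \<subseteq> Poly_Mapping.keys u \<Longrightarrow>
      P (\<Sum>i\<in>K. Poly_Mapping.single i (Poly_Mapping.lookup u i))" for K
    by (induction K rule: finite_induct) (auto intro: assms)
  from this[of "Poly_Mapping.keys u"] show ?thesis
    by (simp flip: sum_singles)
qed

lemma lookup_scale: "Poly_Mapping.lookup (scale c u) i = c * Poly_Mapping.lookup u i"
  by (simp add: scale_def map.rep_eq when_def)

lemma scale_0 [simp]: "scale c 0 = 0"
  by (rule poly_mapping_eqI) (simp add: lookup_scale)

lemma scale_0_left [simp]: "scale 0 u = 0"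
  by (rule poly_mapping_eqI) (simp add: lookup_scale)

lemma scale_1 [simp]: "scale 1 u = u"
  by (rule poly_mapping_eqI) (simp add: lookup_scale)

lemma scale_scale: "scale c (scale d u) = scale (c * d) u"
  by (rule poly_mapping_eqI) (simp add: lookup_scale mult.assoc)

lemma scale_add: "scale c (u + v) = scale c u + scale c v"
  by (rule poly_mapping_eqI) (simp add: lookup_scale lookup_add distrib_left)

lemma scale_sum: "scale c (\<Sum>i\<in>K. g i) = (\<Sum>i\<in>K. scale c (g i))"
  by (induction K rule: infinite_finite_induct) (simp_all add: scale_add)

lemma scale_add_left: "scale (c + d) u = scale c u + scale d u"
  by (rule poly_mapping_eqI) (simp add: lookup_scale lookup_add distrib_right)

lemma scale_single: "scale c (Poly_Mapping.single i d) = Poly_Mapping.single i (c * d)"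
  by (rule poly_mapping_eqI) (simp add: lookup_scale lookup_single when_def)

lemma lin_ext_superset:
  "finite K \<Longrightarrow> Poly_Mapping.keys u \<subseteq> K \<Longrightarrow>
     lin_ext f u = (\<Sum>i\<in>K. scale (Poly_Mapping.lookup u i) (f i))"
  unfolding lin_ext_def by (rule sum.mono_neutral_left) (auto simp: in_keys_iff)

lemma lin_ext_0 [simp]: "lin_ext f 0 = 0"
  by (simp add: lin_ext_def)

lemma lin_ext_add: "lin_ext f (u + v) = lin_ext f u + lin_ext f v"
proof -
  let ?K = "Poly_Mapping.keys u \<union> Poly_Mapping.keys v"
  have "Poly_Mapping.keys (u + v) \<subseteq> ?K"
    by (rule Poly_Mapping.keys_add)
  then show ?thesis
    by (simp add: lin_ext_superset[of ?K] lookup_add scale_add_left sum.distrib)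
qed

lemma lin_ext_scale: "lin_ext f (scale c u) = scale c (lin_ext f u)"
proof -
  have "Poly_Mapping.keys (scale c u) \<subseteq> Poly_Mapping.keys u"
    by (auto simp: in_keys_iff lookup_scale)
  then show ?thesis
    by (simp add: lin_ext_superset[of "Poly_Mapping.keys u"] lookup_scale scale_scale scale_sum)
qed

lemma lin_ext_single: "lin_ext f (Poly_Mapping.single i c) = scale c (f i)"
  by (subst lin_ext_superset[of "{i}"]) (auto simp: lookup_single)


section \<open>Clifford-valued polynomials\<close>

text \<open>
  The index \<open>(\<mu>, \<nu>, A)\<close> stands for
  \<open>\<Prod> z\<^sub>k\<^sub>a ^ \<mu> (k,a) \<cdot> \<Prod> zbar\<^sub>k\<^sub>a ^ \<nu> (k,a) \<cdot> e\<^sub>A\<close>, where \<open>e\<^sub>0, \<dots>, e\<^sub>2\<^sub>m\<^sub>-\<^sub>1\<close> are anticommuting generators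
  of square \<open>1\<close> and \<open>e\<^sub>A\<close> is their product over \<open>A\<close> in increasing order.
\<close>

type_synonym expo = "(nat \<times> nat) \<Rightarrow>\<^sub>0 nat"
type_synonym pidx = "expo \<times> expo \<times> nat set"
type_synonym pcl = "pidx \<Rightarrow>\<^sub>0 complex"

definition PCl_basis :: "nat \<Rightarrow> nat \<Rightarrow> pidx set" where
  "PCl_basis m N = {(\<mu>, \<nu>, A).
     Poly_Mapping.keys \<mu> \<subseteq> {..<N} \<times> {..<m} \<and> Poly_Mapping.keys \<nu> \<subseteq> {..<N} \<times> {..<m} \<and> A \<subseteq> {..<2*m}}"

definition PCl :: "nat \<Rightarrow> nat \<Rightarrow> pcl set" where
  "PCl m N = {F. Poly_Mapping.keys F \<subseteq> PCl_basis m N}"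

definition cl_sign :: "nat set \<Rightarrow> nat set \<Rightarrow> complex" where
  "cl_sign A B = (-1) ^ card {(x, y). x \<in> A \<and> y \<in> B \<and> y < x}"

definition ptimes :: "pcl \<Rightarrow> pcl \<Rightarrow> pcl" where
  "ptimes F G = lin_ext (\<lambda>(\<mu>, \<nu>, A). lin_ext (\<lambda>(\<mu>', \<nu>', A').
      Poly_Mapping.single (\<mu> + \<mu>', \<nu> + \<nu>', (A - A') \<union> (A' - A)) (cl_sign A A')) G) F"

definition pone :: pcl where
  "pone = Poly_Mapping.single (0, 0, {}) 1"

definition pgen :: "nat \<Rightarrow> pcl" where
  "pgen j = Poly_Mapping.single (0, 0, {j}) 1"

definition witt_f :: "nat \<Rightarrow> pcl" where
  "witt_f a = scale (1/2) (pgen (2*a)) + scale (\<i>/2) (pgen (2*a+1))"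

definition witt_fd :: "nat \<Rightarrow> pcl" where
  "witt_fd a = scale (1/2) (pgen (2*a)) + scale (-\<i>/2) (pgen (2*a+1))"

definition pgrade :: "pcl \<Rightarrow> pcl" where
  "pgrade = lin_ext (\<lambda>(\<mu>, \<nu>, A). Poly_Mapping.single (\<mu>, \<nu>, A) ((-1) ^ card A))"

definition contract :: "nat \<Rightarrow> pcl \<Rightarrow> pcl" where
  "contract j = lin_ext (\<lambda>(\<mu>, \<nu>, A).
     if j \<in> A then Poly_Mapping.single (\<mu>, \<nu>, A - {j}) ((-1) ^ card {x \<in> A. x < j}) else 0)"

text \<open>
  \<open>contract j\<close> is the odd antiderivation with \<open>e\<^sub>i \<mapsto> \<delta>\<^sub>i\<^sub>j\<close>, so \<open>delta a\<close> is the one with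
  \<open>f\<^sub>b \<mapsto> \<delta>\<^sub>a\<^sub>b\<close> and \<open>f\<^sub>b\<^sup>\<dagger> \<mapsto> 0\<close>; see \<open>delta_witt_f\<close>, \<open>delta_witt_fd\<close> and \<open>delta_antiderivation\<close> below.
\<close>

definition delta :: "nat \<Rightarrow> pcl \<Rightarrow> pcl" where
  "delta a F = contract (2*a) F + scale (-\<i>) (contract (2*a+1) F)"

text \<open>
  The order-preserving antilinear involution exchanging \<open>f\<^sub>a\<close> and \<open>f\<^sub>a\<^sup>\<dagger>\<close> fixes every \<open>e\<^sub>j\<close>.
\<close>

definition pdag :: "pcl \<Rightarrow> pcl" where
  "pdag F = (\<Sum>b\<in>Poly_Mapping.keys F. case b of (\<mu>, \<nu>, A) \<Rightarrow>
      Poly_Mapping.single (\<nu>, \<mu>, A) (cnj (Poly_Mapping.lookup F b)))"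

lemma ptimes_single: "ptimes (Poly_Mapping.single (\<mu>, \<nu>, A) c) (Poly_Mapping.single (\<mu>', \<nu>', A') d)
    = Poly_Mapping.single (\<mu> + \<mu>', \<nu> + \<nu>', (A - A') \<union> (A' - A)) (c * d * cl_sign A A')"
  by (simp add: ptimes_def lin_ext_single scale_single mult.assoc)

lemma ptimes_add_left: "ptimes (F + G) K = ptimes F K + ptimes G K"
  by (simp add: ptimes_def lin_ext_add)

lemma ptimes_add_right: "ptimes F (G + K) = ptimes F G + ptimes F K"
proof -
  have "lin_ext (\<lambda>x. f x + g x) u = lin_ext f u + lin_ext g u" for f g :: "pidx \<Rightarrow> pcl" and u
    by (simp add: lin_ext_def scale_add sum.distrib)
  then show ?thesis
    by (simp add: ptimes_def lin_ext_add case_prod_unfold)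
qed

lemma ptimes_0 [simp]: "ptimes 0 F = 0" "ptimes F 0 = 0"
  by (simp_all add: ptimes_def lin_ext_def case_prod_unfold)

lemma cl_sign_singletons: "cl_sign {i} {j} = (if j < i then -1 else 1)"
proof -
  have "{(x, y). x \<in> {i} \<and> y \<in> {j} \<and> y < x} = (if j < i then {(i, j)} else {})"
    by auto
  then show ?thesis by (simp add: cl_sign_def)
qed

lemma witt_f_alt: "witt_f a = Poly_Mapping.single (0, 0, {2*a}) (1/2) + Poly_Mapping.single (0, 0, {2*a+1}) (\<i>/2)"
  by (simp add: witt_f_def pgen_def scale_single)

lemma witt_fd_alt: "witt_fd a = Poly_Mapping.single (0, 0, {2*a}) (1/2) + Poly_Mapping.single (0, 0, {2*a+1}) (-\<i>/2)"
  by (simp add: witt_fd_def pgen_def scale_single)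

lemma single_neg_add:
  "c + d = 0 \<Longrightarrow> Poly_Mapping.single x c + Poly_Mapping.single x d = (0 :: 'x \<Rightarrow>\<^sub>0 complex)"
  by (simp flip: single_add)

lemma pgen_scaled_anticomm:
  "ptimes (Poly_Mapping.single (0, 0, {i}) c) (Poly_Mapping.single (0, 0, {j}) d)
   + ptimes (Poly_Mapping.single (0, 0, {j}) d) (Poly_Mapping.single (0, 0, {i}) c)
   = (if i = j then scale (2 * c * d) pone else 0)"
proof (cases "i = j")
  case True
  then show ?thesis
    by (simp add: ptimes_single cl_sign_singletons pone_def scale_single mult.assoc flip: single_add)
next
  case False
  have "({j} - {i}) \<union> ({i} - {j}) = ({i} - {j}) \<union> ({j} - {i})" by auto
  with False show ?thesis
    by (auto simp: ptimes_single cl_sign_singletons simp flip: single_add)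
qed

lemma two_term_anticomm:
  fixes x y x' y' :: pcl
  shows "ptimes (x + y) (x' + y') + ptimes (x' + y') (x + y) =
    (ptimes x x' + ptimes x' x) + (ptimes x y' + ptimes y' x)
    + (ptimes y x' + ptimes x' y) + (ptimes y y' + ptimes y' y)"
  by (simp add: ptimes_add_left ptimes_add_right algebra_simps)

lemma odd_even_neq: "2 * a \<noteq> 2 * b + 1" "2 * a + 1 \<noteq> 2 * b" for a b :: nat
  by presburger+

lemma witt_relations:
  "ptimes (witt_f a) (witt_f b) + ptimes (witt_f b) (witt_f a) = 0"
  "ptimes (witt_fd a) (witt_fd b) + ptimes (witt_fd b) (witt_fd a) = 0"
  "ptimes (witt_f a) (witt_fd b) + ptimes (witt_fd b) (witt_f a) = (if a = b then pone else 0)"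
  using odd_even_neq[of a b]
  unfolding witt_f_alt witt_fd_alt two_term_anticomm pgen_scaled_anticomm
  by (auto simp flip: scale_add_left)

lemma delta_add: "delta a (F + G) = delta a F + delta a G"
  by (simp add: delta_def contract_def lin_ext_add scale_add)

lemma delta_0 [simp]: "delta a 0 = 0"
  by (simp add: delta_def contract_def)

lemma contract_single: "contract j (Poly_Mapping.single (\<mu>, \<nu>, A) c) =
    (if j \<in> A then Poly_Mapping.single (\<mu>, \<nu>, A - {j}) (c * (-1) ^ card {x \<in> A. x < j}) else 0)"
  by (simp add: contract_def lin_ext_single scale_single)

lemma contract_gen: "contract j (Poly_Mapping.single (0, 0, {i}) c) = (if i = j then scale c pone else 0)"
  using card.empty by (auto simp: contract_single pone_def scale_single Collect_conv_if)

lemma contract_add: "contract j (F + G) = contract j F + contract j G"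
  by (simp add: contract_def lin_ext_add)

lemma delta_witt_f: "delta a (witt_f b) = (if a = b then pone else 0)"
  using odd_even_neq[of a b] odd_even_neq[of b a]
  by (auto simp: delta_def witt_f_alt contract_add contract_gen scale_scale simp flip: scale_add_left)

lemma delta_witt_fd: "delta a (witt_fd b) = 0"
  using odd_even_neq[of a b] odd_even_neq[of b a]
  by (auto simp: delta_def witt_fd_alt contract_add contract_gen scale_scale simp flip: scale_add_left)

lemma card_inversions:
  assumes "finite A" "finite B"
  shows "card {(x, y). x \<in> A \<and> y \<in> B \<and> y < x} = (\<Sum>x\<in>A. card {y \<in> B. y < (x :: nat)})"
proof -
  have "{(x, y). x \<in> A \<and> y \<in> B \<and> y < x} = Sigma A (\<lambda>x. {y \<in> B. y < x})" by auto
  with assms show ?thesis by simp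
qed

lemma cl_sign_remove_left:
  assumes "finite A" "finite B" "j \<in> A"
  shows "cl_sign A B = (-1) ^ card {y \<in> B. y < j} * cl_sign (A - {j}) B"
  unfolding cl_sign_def card_inversions[OF assms(1,2)]
    card_inversions[OF finite_Diff[OF assms(1)] assms(2)]
  by (simp add: sum.remove[OF assms(1,3)] power_add)

lemma cl_sign_remove_right:
  assumes "finite A" "finite B" "j \<in> B"
  shows "cl_sign A B = (-1) ^ card {x \<in> A. j < x} * cl_sign A (B - {j})"
proof -
  have "{(x, y). x \<in> A \<and> y \<in> B \<and> y < x} =
      (\<lambda>x. (x, j)) ` {x \<in> A. j < x} \<union> {(x, y). x \<in> A \<and> y \<in> B - {j} \<and> y < x}"
    using assms by auto
  moreover have "card \<dots> = card ((\<lambda>x. (x, j)) ` {x \<in> A. j < x}) + card {(x, y). x \<in> A \<and> y \<in> B - {j} \<and> y < x}"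
    by (rule card_Un_disjoint)
       (use assms in \<open>auto intro: finite_subset[of _ "A \<times> B"]\<close>)
  ultimately show ?thesis
    by (simp add: cl_sign_def power_add card_image inj_on_def)
qed

lemma minus_one_power_sym_diff:
  assumes "finite A" "finite B"
  shows "(-1 :: complex) ^ card ((A - B) \<union> (B - A)) = (-1) ^ card A * (-1) ^ card B"
proof -
  have "card ((A - B) \<union> (B - A)) = card (A - B) + card (B - A)"
    by (rule card_Un_disjoint) (use assms in auto)
  moreover have "card A = card (A - B) + card (A \<inter> B)"
    using card_Int_Diff[OF assms(1), of B] by linarith
  moreover have "card B = card (B - A) + card (A \<inter> B)"
    using card_Int_Diff[OF assms(2), of A] by (simp add: Int_commute)
  ultimately have "card A + card B = card ((A - B) \<union> (B - A)) + 2 * card (A \<inter> B)"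
    by linarith
  then have "(-1 :: complex) ^ (card A + card B) = (-1) ^ (card ((A - B) \<union> (B - A)) + 2 * card (A \<inter> B))"
    by (rule arg_cong)
  then show ?thesis
    by (simp add: power_add)
qed

lemma card_below_sym_diff:
  assumes "finite A" "finite B"
  shows "(-1 :: complex) ^ card {x \<in> (A - B) \<union> (B - A). x < (j :: nat)}
    = (-1) ^ card {x \<in> A. x < j} * (-1) ^ card {x \<in> B. x < j}"
proof -
  let ?A = "{x \<in> A. x < j}" and ?B = "{x \<in> B. x < j}"
  have "{x \<in> (A - B) \<union> (B - A). x < j} = (?A - ?B) \<union> (?B - ?A)"
    by blast
  then show ?thesis
    using minus_one_power_sym_diff[of ?A ?B] assms by simp
qed

lemma card_split_at:
  assumes "finite A"
  shows "card A = card {x \<in> A. x < j} + (if j \<in> A then 1 else 0) + card {x \<in> A. (j :: nat) < x}"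
proof -
  have "A = {x \<in> A. x < j} \<union> (A \<inter> {j}) \<union> {x \<in> A. j < x}"
    by (rule set_eqI) (auto simp: not_less_iff_gr_or_eq)
  then have "card A = card ({x \<in> A. x < j} \<union> (A \<inter> {j}) \<union> {x \<in> A. j < x})"
    by (rule arg_cong)
  also have "\<dots> = card ({x \<in> A. x < j} \<union> (A \<inter> {j})) + card {x \<in> A. j < x}"
    by (rule card_Un_disjoint) (use assms in auto)
  also have "card ({x \<in> A. x < j} \<union> (A \<inter> {j})) = card {x \<in> A. x < j} + card (A \<inter> {j})"
    by (rule card_Un_disjoint) (use assms in auto)
  finally show ?thesis by simp
qed

lemma contract_antiderivation_single:
  assumes fin: "finite A" "finite B"
    and F_def: "F = Poly_Mapping.single (\<mu>, \<nu>, A) c" and G_def: "G = Poly_Mapping.single (\<mu>', \<nu>', B) d"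
  shows "contract j (ptimes F G) = ptimes (contract j F) G + ptimes (pgrade F) (contract j G)"
proof -
  let ?A = "{x \<in> A. x < j}" and ?B = "{x \<in> B. x < j}"
  have pg: "pgrade (Poly_Mapping.single (\<mu>, \<nu>, A) c) = Poly_Mapping.single (\<mu>, \<nu>, A) (c * (-1) ^ card A)"
    by (simp add: pgrade_def lin_ext_single scale_single)
  note rules = F_def G_def pg ptimes_single contract_single card_below_sym_diff[OF fin]
  have sq: "(-1 :: complex) ^ k * (-1) ^ k = 1" for k
    by (simp flip: power_add mult_2)
  consider "j \<notin> A" "j \<notin> B" | "j \<in> A" "j \<notin> B" | "j \<notin> A" "j \<in> B" | "j \<in> A" "j \<in> B" by blast
  then show ?thesis
  proof cases
    case 1
    then show ?thesis by (simp add: rules)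
  next
    case 2
    then have e: "(A - B \<union> (B - A)) - {j} = (A - {j} - B) \<union> (B - (A - {j}))" by auto
    have "c * d * cl_sign A B * ((-1) ^ card ?A * (-1) ^ card ?B)
        = c * (-1) ^ card ?A * d * cl_sign (A - {j}) B * ((-1) ^ card ?B * (-1) ^ card ?B)"
      unfolding cl_sign_remove_left[OF fin 2(1)] by (simp only: mult_ac)
    then have z: "c * d * cl_sign A B * ((-1) ^ card ?A * (-1) ^ card ?B)
        = c * (-1) ^ card ?A * d * cl_sign (A - {j}) B"
      by (simp only: sq mult_1_right)
    have n: "j \<in> (A - B) \<union> (B - A)" using 2 by auto
    show ?thesis
      unfolding rules using 2 n by (simp only: if_True if_False e z ptimes_0 ptimes_single add_0_right)
  next
    case 3
    then have e: "(A - B \<union> (B - A)) - {j} = (A - (B - {j})) \<union> (B - {j} - A)" by auto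
    have "card A = card ?A + card {x \<in> A. j < x}"
      using card_split_at[OF fin(1), of j] 3 by simp
    then have "c * d * cl_sign A B * ((-1) ^ card ?A * (-1) ^ card ?B)
        = c * (-1) ^ card A * (d * (-1) ^ card ?B) * cl_sign A (B - {j})
          * ((-1) ^ card {x \<in> A. j < x} * (-1) ^ card {x \<in> A. j < x}
             * ((-1) ^ card {x \<in> A. j < x} * (-1) ^ card {x \<in> A. j < x}))"
      unfolding cl_sign_remove_right[OF fin 3(2)] sq
      by (simp add: power_add)
    then have z: "c * d * cl_sign A B * ((-1) ^ card ?A * (-1) ^ card ?B)
        = c * (-1) ^ card A * (d * (-1) ^ card ?B) * cl_sign A (B - {j})"
      by (simp only: sq mult_1_right)
    have n: "j \<in> (A - B) \<union> (B - A)" using 3 by auto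
    show ?thesis
      unfolding rules using 3 n by (simp only: if_True if_False e z ptimes_0 ptimes_single add_0_left)
  next
    case 4
    have e: "(A - {j} - B) \<union> (B - (A - {j})) = (A - (B - {j})) \<union> (B - {j} - A)"
      using 4 by auto
    have s: "cl_sign (A - {j}) B = (-1) ^ card ?B * cl_sign A B"
      using cl_sign_remove_left[OF fin 4(1)] sq[of "card ?B"] by (simp add: mult.assoc[symmetric])
    have t: "cl_sign A (B - {j}) = (-1) ^ card {x \<in> A. j < x} * cl_sign A B"
      using cl_sign_remove_right[OF fin 4(2)] sq[of "card {x \<in> A. j < x}"] by (simp add: mult.assoc[symmetric])
    have cA: "(-1 :: complex) ^ card A = - ((-1) ^ card ?A * (-1) ^ card {x \<in> A. j < x})"
      using 4 by (subst card_split_at[OF fin(1), of j]) (simp add: power_add)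
    have z: "c * (-1) ^ card ?A * d * cl_sign (A - {j}) B
        + c * (-1) ^ card A * (d * (-1) ^ card ?B) * cl_sign A (B - {j}) = 0"
      using sq[of "card {x \<in> A. j < x}"] unfolding s t cA by (simp add: algebra_simps)
    have n: "j \<notin> (A - B) \<union> (B - A)" using 4 by auto
    show ?thesis
      unfolding rules using 4 n
      by (simp only: if_True if_False e ptimes_single single_neg_add[OF z])
  qed
qed

lemma delta_antiderivation:
  assumes "F \<in> PCl m N" "G \<in> PCl m N"
  shows "delta a (ptimes F G) = ptimes (delta a F) G + ptimes (pgrade F) (delta a G)"
proof -
  have c: "contract j (ptimes F G) = ptimes (contract j F) G + ptimes (pgrade F) (contract j G)" for j
  proof (induction F rule: single_add_induct)
    case zero
    show ?case by (simp add: contract_def pgrade_def)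
  next
    case (single b c)
    obtain \<mu> \<nu> A where b: "b = (\<mu>, \<nu>, A)" by (cases b)
    have A: "finite A"
      using single assms(1) b by (auto simp: PCl_def PCl_basis_def intro: finite_subset)
    show ?case
    proof (induction G rule: single_add_induct)
      case zero
      show ?case by (simp add: contract_def)
    next
      case (single b' c')
      obtain \<mu>' \<nu>' B where b': "b' = (\<mu>', \<nu>', B)" by (cases b')
      have "finite B"
        using single assms(2) b' by (auto simp: PCl_def PCl_basis_def intro: finite_subset)
      with A show ?case using contract_antiderivation_single[OF _ _ refl refl] unfolding b b' by blast
    next
      case (add v w)
      then show ?case by (simp add: ptimes_add_right contract_add algebra_simps)
    qed
  next
    case (add v w)
    have "pgrade (v + w) = pgrade v + pgrade w" by (simp add: pgrade_def lin_ext_add)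
    with add show ?case by (simp add: ptimes_add_left contract_add algebra_simps)
  qed
  have l: "ptimes (scale k x) y = scale k (ptimes x y)" for k x y
    by (simp add: ptimes_def lin_ext_scale)
  have r: "ptimes x (scale k y) = scale k (ptimes x y)" for k x y
  proof (induction x rule: single_add_induct)
    case (single b c)
    obtain \<mu> \<nu> A where "b = (\<mu>, \<nu>, A)" by (cases b)
    then show ?case
      by (simp add: ptimes_def lin_ext_single lin_ext_scale scale_scale mult.commute)
  qed (simp_all add: ptimes_add_left scale_add)
  show ?thesis
    by (simp add: delta_def c l r ptimes_add_left ptimes_add_right scale_add algebra_simps)
qed

lemma lookup_pdag: "Poly_Mapping.lookup (pdag F) (\<mu>, \<nu>, A) = cnj (Poly_Mapping.lookup F (\<nu>, \<mu>, A))"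
proof -
  have "Poly_Mapping.lookup (pdag F) (\<mu>, \<nu>, A) =
      (\<Sum>b\<in>Poly_Mapping.keys F. if b = (\<nu>, \<mu>, A) then cnj (Poly_Mapping.lookup F b) else 0)"
    unfolding pdag_def lookup_sum
    by (rule sum.cong) (auto simp: lookup_single when_def split: prod.splits)
  then show ?thesis
    by (simp add: sum.delta in_keys_iff)
qed

lemma pdag_add: "pdag (F + G) = pdag F + pdag G"
  by (rule poly_mapping_eqI) (auto simp: lookup_add lookup_pdag)

lemma pdag_single: "pdag (Poly_Mapping.single (\<mu>, \<nu>, A) c) = Poly_Mapping.single (\<nu>, \<mu>, A) (cnj c)"
  by (rule poly_mapping_eqI) (auto simp: lookup_pdag lookup_single when_def split: if_splits)

lemma pdag_pdag: "pdag (pdag F) = F"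
  by (rule poly_mapping_eqI) (auto simp: lookup_pdag)

lemma pdag_0 [simp]: "pdag 0 = 0"
  by (simp add: pdag_def)

lemma pdag_witt_f: "pdag (witt_f a) = witt_fd a"
  by (simp add: witt_f_alt witt_fd_alt pdag_add pdag_single)

lemma pdag_ptimes: "pdag (ptimes F G) = ptimes (pdag F) (pdag G)"
proof (induction F rule: single_add_induct)
  case (single b c)
  obtain \<mu> \<nu> A where b: "b = (\<mu>, \<nu>, A)" by (cases b)
  show ?case
  proof (induction G rule: single_add_induct)
    case (single b' c')
    obtain \<mu>' \<nu>' B where b': "b' = (\<mu>', \<nu>', B)" by (cases b')
    show ?case by (simp add: b b' ptimes_single pdag_single cl_sign_def)
  qed (simp_all add: ptimes_add_right pdag_add)
qed (simp_all add: ptimes_add_left pdag_add)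

definition zmult :: "nat \<Rightarrow> nat \<Rightarrow> pcl \<Rightarrow> pcl" where
  "zmult k a = lin_ext (\<lambda>(\<mu>, \<nu>, A). Poly_Mapping.single (\<mu> + Poly_Mapping.single (k, a) 1, \<nu>, A) 1)"

definition dz :: "nat \<Rightarrow> nat \<Rightarrow> pcl \<Rightarrow> pcl" where
  "dz k a = lin_ext (\<lambda>(\<mu>, \<nu>, A). Poly_Mapping.single (\<mu> - Poly_Mapping.single (k, a) 1, \<nu>, A)
      (of_nat (Poly_Mapping.lookup \<mu> (k, a))))"


subsection \<open>Capelli contractions\<close>

definition s_op :: "nat \<Rightarrow> nat \<Rightarrow> pcl \<Rightarrow> pcl" where
  "s_op m i F = (\<Sum>a<m. delta a (dz i a F))"

definition Ez :: "nat \<Rightarrow> nat \<Rightarrow> nat \<Rightarrow> pcl \<Rightarrow> pcl" where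
  "Ez m j i F = (\<Sum>a<m. zmult j a (dz i a F))"

definition Cz_entry :: "nat \<Rightarrow> nat \<Rightarrow> nat \<Rightarrow> pcl \<Rightarrow> pcl" where
  "Cz_entry m i j F = (if i = j then scale (of_nat m) F else 0) + Ez m j i F"

definition cols :: "nat \<Rightarrow> nat \<Rightarrow> (nat \<Rightarrow> pcl) set" where
  "cols m N = {u. (\<forall>i<N. u i \<in> PCl m N) \<and> (\<forall>i\<ge>N. u i = 0)}"

definition Cz :: "nat \<Rightarrow> nat \<Rightarrow> (nat \<Rightarrow> pcl) \<Rightarrow> (nat \<Rightarrow> pcl)" where
  "Cz m N u = (\<lambda>i. if i < N then (\<Sum>j<N. Cz_entry m i j (u j)) else 0)"

definition Cz_inv_entry :: "nat \<Rightarrow> nat \<Rightarrow> nat \<Rightarrow> nat \<Rightarrow> pcl \<Rightarrow> pcl" where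
  "Cz_inv_entry m N i l F = inv_into (cols m N) (Cz m N) (\<lambda>k. if k = l then F else 0) i"

definition n_plus :: "nat \<Rightarrow> nat \<Rightarrow> nat \<Rightarrow> pcl \<Rightarrow> pcl" where
  "n_plus m N i F = (\<Sum>l<N. Cz_inv_entry m N i l (s_op m l F))"

fun n_op :: "nat \<Rightarrow> nat \<Rightarrow> pm \<Rightarrow> nat \<Rightarrow> pcl \<Rightarrow> pcl" where
  "n_op m N Plus i F = n_plus m N i F"
| "n_op m N Minus i F = pdag (n_plus m N i (pdag F))"


section \<open>Coefficients of the fermionic modules\<close>

text \<open>
  \<open>kvar (k, j)\<close> is the element \<open>B\<close> of pair \<open>j\<close> in the copy with label \<open>k\<close>.
\<close>

type_synonym bpoly = "((nat \<times> nat) \<Rightarrow>\<^sub>0 nat) \<Rightarrow>\<^sub>0 complex"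
type_synonym kfld = "bpoly fract"

definition kconst :: "complex \<Rightarrow> kfld" where
  "kconst c = Fract (Poly_Mapping.single 0 c) 1"

definition kvar :: "nat \<times> nat \<Rightarrow> kfld" where
  "kvar v = Fract (Poly_Mapping.single (Poly_Mapping.single v 1) 1) 1"

definition qnum :: "real \<Rightarrow> nat \<Rightarrow> real" where
  "qnum q r = (1 - q ^ r) / (1 - q)"

definition c_num :: "real \<Rightarrow> nat \<Rightarrow> real" where
  "c_num q r = qnum q (2 * r) / 2"

definition s_par :: "real \<Rightarrow> nat \<Rightarrow> nat \<Rightarrow> real" where
  "s_par q m n = 1 / real n * q powi (2 * int m - 2 * int n) * qnum q (2 * n)"

inductive_set A_denoms :: "real \<Rightarrow> (nat \<times> nat) set \<Rightarrow> kfld set" for s :: real and V where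
  one: "1 \<in> A_denoms s V"
| gen1: "v \<in> V \<Longrightarrow> d \<in> A_denoms s V \<Longrightarrow>
    d * ((kvar v + kconst (2 * of_int k * \<i>)) - kconst \<i>) \<in> A_denoms s V" for k :: int
| gen2: "v \<in> V \<Longrightarrow> d \<in> A_denoms s V \<Longrightarrow>
    d * (kconst (of_real s) - kconst (2 * \<i>) * (kvar v + kconst (2 * of_int k * \<i>))) \<in> A_denoms s V" for k :: int
| gen3: "v \<in> V \<Longrightarrow> d \<in> A_denoms s V \<Longrightarrow>
    d * (kconst (of_real s) + kconst (2 * \<i>) * (kvar v + kconst (2 * of_int k * \<i>))) \<in> A_denoms s V" for k :: int

text \<open>
  The generators are the shifts by \<open>\<sigma>\<^sup>k\<close>, i.e. \<open>B \<mapsto> B + 2ki\<close>, of \<open>B - i\<close>, \<open>s - 2iB\<close> and \<open>s + 2iB\<close>.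
  For \<open>V = {v}\<close> the set \<open>A_min s V\<close> is \<open>\<A>\<^sub>s\<^sup>m\<^sup>i\<^sup>n\<close> in the variable \<open>B\<^sub>v\<close>; for finite \<open>V\<close> it is the tensor
  product over the complex numbers of the algebras for the single \<open>v \<in> V\<close>.
\<close>

definition A_min :: "real \<Rightarrow> (nat \<times> nat) set \<Rightarrow> kfld set" where
  "A_min s V = {Fract p 1 / d | p d.
     (\<forall>\<mu>\<in>Poly_Mapping.keys p. Poly_Mapping.keys \<mu> \<subseteq> V) \<and> d \<in> A_denoms s V}"

text \<open>\<open>\<ddagger>\<close> on coefficients: the antilinear ring involution with \<open>B = ba - i \<mapsto> ab + i = B\<close>.\<close>

definition bcnj :: "bpoly \<Rightarrow> bpoly" where
  "bcnj p = Poly_Mapping.map cnj p"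

lemma lookup_bcnj: "Poly_Mapping.lookup (bcnj p) \<mu> = cnj (Poly_Mapping.lookup p \<mu>)"
  by (simp add: bcnj_def map.rep_eq when_def)

lemma bcnj_0 [simp]: "bcnj 0 = 0"
  by (rule poly_mapping_eqI) (simp add: lookup_bcnj)

lemma bcnj_add: "bcnj (x + y) = bcnj x + bcnj y"
  by (rule poly_mapping_eqI) (simp add: lookup_bcnj lookup_add)

lemma bcnj_single: "bcnj (Poly_Mapping.single \<mu> c) = Poly_Mapping.single \<mu> (cnj c)"
  by (rule poly_mapping_eqI) (simp add: lookup_bcnj lookup_single when_def)

lemma bcnj_eq_0_iff: "bcnj x = 0 \<longleftrightarrow> x = 0"
  by (simp add: poly_mapping_eq_iff fun_eq_iff lookup_bcnj)

lemma bcnj_mult: "bcnj (x * y) = bcnj x * bcnj y"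
proof (induction x rule: single_add_induct)
  case (single k c)
  show ?case
  proof (induction y rule: single_add_induct)
    case (single k' c')
    show ?case by (simp add: bcnj_single mult_single)
  qed (simp_all add: bcnj_add distrib_left)
qed (simp_all add: bcnj_add distrib_right)

lift_definition kcnj :: "kfld \<Rightarrow> kfld" is "\<lambda>x. (bcnj (fst x), bcnj (snd x))"
  by (auto simp: bcnj_eq_0_iff simp flip: bcnj_mult)


section \<open>One fermionic pair\<close>

definition alpha :: "int \<Rightarrow> kfld \<Rightarrow> kfld" where
  "alpha j B = (if j \<ge> 0 then 1 else B + kconst (of_int (2*j+1) * \<i>))"

definition beta :: "int \<Rightarrow> kfld \<Rightarrow> kfld" where
  "beta j B = (if j \<ge> 1 then B + kconst (of_int (2*j-1) * \<i>) else 1)"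

definition Phi :: "real \<Rightarrow> kfld \<Rightarrow> kfld" where
  "Phi s B = (kconst (4 - of_real s) + kconst (2*\<i>) * B) / (B - kconst \<i>)"

definition Psi :: "real \<Rightarrow> kfld \<Rightarrow> kfld" where
  "Psi s B = (kconst (- of_real s) - kconst (2*\<i>) * B) / (B - kconst \<i>)"

definition sigma_plus :: "real \<Rightarrow> int \<Rightarrow> kfld \<Rightarrow> kfld" where
  "sigma_plus s c B = beta (c+1) B * Phi s (B + kconst (2 * \<i> * of_int (c+1)))"

definition sigma_minus :: "real \<Rightarrow> int \<Rightarrow> kfld \<Rightarrow> kfld" where
  "sigma_minus s c B = alpha (c-1) B * Psi s (B + kconst (2 * \<i> * of_int c))"

definition pi_plus :: "real \<Rightarrow> int \<Rightarrow> kfld \<Rightarrow> kfld" where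
  "pi_plus s c B = kconst (-1/4) * sigma_plus s c B"

definition pi_minus :: "real \<Rightarrow> int \<Rightarrow> kfld \<Rightarrow> kfld" where
  "pi_minus s c B = kconst (-1/4) * sigma_minus s c B"

definition kappa_plus :: "real \<Rightarrow> int \<Rightarrow> kfld \<Rightarrow> kfld" where
  "kappa_plus s c B = kconst (-1/4) * sigma_plus s c B * alpha c B"

definition Kc :: "int \<Rightarrow> kfld \<Rightarrow> kfld" where
  "Kc c B = kconst (1 / (2*\<i>)) * alpha (c-1) B * beta c B"

text \<open>
  \<open>(c, E0)\<close>, \<open>(c, Eth)\<close>, \<open>(c, Ethb)\<close>, \<open>(c, E2)\<close> are the basis vectors \<open>x\<^sub>c\<close>, \<open>\<vartheta> x\<^sub>c\<^sub>+\<^sub>1\<close>,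
  \<open>\<vartheta>bar x\<^sub>c\<^sub>-\<^sub>1\<close>, \<open>\<vartheta> \<vartheta>bar x\<^sub>c\<close> of the charge-\<open>c\<close> module.  Coefficients stand on the right of
  basis vectors; they commute with one another.
\<close>

datatype lab = E0 | Eth | Ethb | E2

type_synonym pair_idx = "int \<times> lab"

definition pair_par :: "pair_idx \<Rightarrow> nat" where
  "pair_par x = (if snd x \<in> {Eth, Ethb} then 1 else 0)"

text \<open>
  \<open>\<ddagger>\<close> sends \<open>x\<^sub>c\<close> to \<open>x\<^sub>-\<^sub>c\<close>; being order-preserving it sends \<open>\<vartheta> \<vartheta>bar\<close> to
  \<open>\<vartheta>bar \<vartheta> = - \<vartheta> \<vartheta>bar\<close>.
\<close>

fun lab_dag :: "lab \<Rightarrow> lab" where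
  "lab_dag E0 = E0" | "lab_dag Eth = Ethb" | "lab_dag Ethb = Eth" | "lab_dag E2 = E2"

definition pair_dag :: "pair_idx \<Rightarrow> pair_idx" where
  "pair_dag x = (- fst x, lab_dag (snd x))"

definition pair_dag_sign :: "pair_idx \<Rightarrow> kfld" where
  "pair_dag_sign x = (if snd x = E2 then -1 else 1)"

definition conj_ext :: "('x \<Rightarrow> 'x) \<Rightarrow> ('x \<Rightarrow> kfld) \<Rightarrow> ('x \<Rightarrow>\<^sub>0 kfld) \<Rightarrow> ('x \<Rightarrow>\<^sub>0 kfld)" where
  "conj_ext d \<epsilon> u = (\<Sum>x\<in>Poly_Mapping.keys u.
     Poly_Mapping.single (d x) (\<epsilon> x * kcnj (Poly_Mapping.lookup u x)))"

definition h1 :: "real \<Rightarrow> kfld \<Rightarrow> pm \<Rightarrow> (pair_idx \<Rightarrow>\<^sub>0 kfld) \<Rightarrow> (pair_idx \<Rightarrow>\<^sub>0 kfld)" where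
  "h1 s B pm = lin_ext (\<lambda>(c, l). case (pm, l) of
      (Plus, E0) \<Rightarrow> Poly_Mapping.single (c, Eth) (inverse (pi_plus s c B))
    | (Plus, Ethb) \<Rightarrow> Poly_Mapping.single (c, E2) (kconst (2*\<i>) * inverse (beta c B))
    | (Minus, E0) \<Rightarrow> Poly_Mapping.single (c, Ethb) (inverse (pi_minus s c B))
    | (Minus, Eth) \<Rightarrow> Poly_Mapping.single (c, E2) (kconst (2*\<i>) * inverse (alpha c B))
    | _ \<Rightarrow> 0)"

lemma bcnj_1: "bcnj 1 = 1"
  using bcnj_single[of 0 1] by simp

lemma kcnj_Fract: "kcnj (Fract x y) = Fract (bcnj x) (bcnj y)"
  by transfer (simp add: bcnj_eq_0_iff bcnj_1)

lemma kcnj_add: "kcnj (x + y) = kcnj x + kcnj y"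
  by transfer (simp add: bcnj_mult bcnj_add bcnj_eq_0_iff)

lemma kcnj_mult: "kcnj (x * y) = kcnj x * kcnj y"
  by transfer (simp add: bcnj_mult bcnj_eq_0_iff)

lemma kcnj_inverse: "kcnj (inverse x) = inverse (kcnj x)"
  by (cases x) (simp add: kcnj_Fract)

lemma kcnj_kconst: "kcnj (kconst c) = kconst (cnj c)"
  by (simp add: kconst_def kcnj_Fract bcnj_single flip: single_one)

lemma kcnj_kvar: "kcnj (kvar v) = kvar v"
  by (simp add: kvar_def kcnj_Fract bcnj_single flip: single_one)

lemma kconst_add: "kconst (x + y) = kconst x + kconst y"
  by (simp add: kconst_def single_add)

lemma kconst_mult: "kconst (x * y) = kconst x * kconst y"
  by (simp add: kconst_def mult_single)

lemma kconst_1 [simp]: "kconst 1 = 1"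
  by (simp add: kconst_def One_fract_def)

lemma kconst_0 [simp]: "kconst 0 = 0"
  by (simp add: kconst_def Zero_fract_def)

lemma kconst_minus: "kconst (- x) = - kconst x"
  by (simp add: kconst_def single_uminus)

lemma kconst_diff: "kconst (x - y) = kconst x - kconst y"
  by (simp add: kconst_def single_diff)

lemma conj_ext_single:
  "conj_ext d \<epsilon> (Poly_Mapping.single x c) = Poly_Mapping.single (d x) (\<epsilon> x * kcnj c)"
proof (cases "c = 0")
  case True
  have "kcnj 0 = 0" using kcnj_kconst[of 0] by simp
  with True show ?thesis by (simp add: conj_ext_def)
qed (simp add: conj_ext_def)

lemma kcnj_beta: "kcnj (beta (- c) (kvar v)) = alpha c (kvar v)"
proof -
  have "of_int (2 * c + 1) * \<i> = cnj (of_int (2 * (- c) - 1) * \<i>)"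
    by (simp add: algebra_simps)
  then show ?thesis
    using kcnj_kconst[of 1] by (simp add: beta_def alpha_def kcnj_add kcnj_kvar kcnj_kconst)
qed

lemma kcnj_Phi:
  "kcnj (Phi s (kvar v + kconst (2 * \<i> * of_int (1 - c)))) = Psi s (kvar v + kconst (2 * \<i> * of_int c))"
proof -
  have num: "kconst (4 - of_real s) + kconst (- (2 * \<i>)) * (kvar v + kconst (- (2 * \<i> * of_int (1 - c))))
      = kconst (- of_real s) - kconst (2 * \<i>) * (kvar v + kconst (2 * \<i> * of_int c))"
  proof -
    have "kconst (4 - of_real s) + kconst (- (2 * \<i>)) * kconst (- (2 * \<i> * of_int (1 - c)))
       = kconst (- of_real s) - kconst (2 * \<i>) * kconst (2 * \<i> * of_int c)"
      unfolding kconst_mult[symmetric] kconst_add[symmetric] kconst_diff[symmetric]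
      by (rule arg_cong[of _ _ kconst]) (simp add: algebra_simps)
    then show ?thesis by (simp add: kconst_minus algebra_simps)
  qed
  have den: "kvar v + kconst (- (2 * \<i> * of_int (1 - c))) - kconst (- \<i>)
      = kvar v + kconst (2 * \<i> * of_int c) - kconst \<i>"
  proof -
    have "kconst (- (2 * \<i> * of_int (1 - c))) - kconst (- \<i>) = kconst (2 * \<i> * of_int c) - kconst \<i>"
      unfolding kconst_diff[symmetric]
      by (rule arg_cong[of _ _ kconst]) (simp add: algebra_simps)
    then show ?thesis by (simp add: algebra_simps)
  qed
  have d: "kcnj (x - y) = kcnj x - kcnj y" for x y
  proof -
    have "kcnj ((x - y) + y) = kcnj (x - y) + kcnj y" by (rule kcnj_add)
    then show ?thesis by simp
  qed
  show ?thesis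
    unfolding Phi_def Psi_def num[symmetric] den[symmetric]
    by (simp add: divide_inverse kcnj_mult kcnj_inverse kcnj_add d kcnj_kconst kcnj_kvar)
qed

lemma kcnj_pi_plus: "kcnj (pi_plus s (- c) (kvar v)) = pi_minus s c (kvar v)"
  using kcnj_beta[of "c - 1" v] kcnj_Phi[of s v c]
  by (simp add: pi_plus_def pi_minus_def sigma_plus_def sigma_minus_def kcnj_mult kcnj_kconst)

text \<open>The two cases of \<open>h1\<close> are \<open>\<ddagger>\<close>-conjugate.\<close>

lemma h1_conjugate:
  "conj_ext pair_dag pair_dag_sign (h1 s (kvar v) Plus (conj_ext pair_dag pair_dag_sign (Poly_Mapping.single x 1)))
   = h1 s (kvar v) Minus (Poly_Mapping.single x 1)"
proof -
  obtain c l where x: "x = (c, l)" by (cases x)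
  have one: "kcnj 1 = 1" using kcnj_kconst[of 1] by simp
  have zero: "conj_ext pair_dag pair_dag_sign 0 = 0" by (simp add: conj_ext_def)
  show ?thesis
    by (cases l)
       (simp_all add: x h1_def conj_ext_single lin_ext_single scale_single zero one pair_dag_def
         pair_dag_sign_def kcnj_mult kcnj_inverse kcnj_pi_plus kcnj_beta kcnj_kconst kconst_minus)
qed


section \<open>Several pairs\<close>

text \<open>
  Basis vectors of a tensor product are lists of basis vectors of the factors.
  \<open>hat par j Y\<close> is the graded embedding of the odd right-linear operator \<open>Y\<close> in factor \<open>j\<close>.
\<close>

definition hat :: "('x \<Rightarrow> nat) \<Rightarrow> nat \<Rightarrow> (('x \<Rightarrow>\<^sub>0 kfld) \<Rightarrow> ('x \<Rightarrow>\<^sub>0 kfld))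
    \<Rightarrow> ('x list \<Rightarrow>\<^sub>0 kfld) \<Rightarrow> ('x list \<Rightarrow>\<^sub>0 kfld)" where
  "hat par j Y = lin_ext (\<lambda>w. let y = Y (Poly_Mapping.single (w ! j) 1) in
     \<Sum>x\<in>Poly_Mapping.keys y. Poly_Mapping.single (w[j := x])
        ((-1) ^ (\<Sum>i<j. par (w ! i)) * Poly_Mapping.lookup y x))"

type_synonym fk_idx = "pair_idx list"

definition fk_par :: "fk_idx \<Rightarrow> nat" where
  "fk_par w = sum_list (map pair_par w)"

definition fk_dag :: "(fk_idx \<Rightarrow>\<^sub>0 kfld) \<Rightarrow> (fk_idx \<Rightarrow>\<^sub>0 kfld)" where
  "fk_dag = conj_ext (map pair_dag) (\<lambda>w. prod_list (map pair_dag_sign w))"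

definition h_plus :: "real \<Rightarrow> nat \<Rightarrow> nat \<Rightarrow> nat \<Rightarrow> (fk_idx \<Rightarrow>\<^sub>0 kfld) \<Rightarrow> (fk_idx \<Rightarrow>\<^sub>0 kfld)" where
  "h_plus q m n k u = scale (kconst (1 / of_nat n))
     (\<Sum>j<n. hat pair_par j (h1 (s_par q m n) (kvar (k, j)) Plus) u)"

definition diag :: "('x \<Rightarrow> kfld) \<Rightarrow> ('x \<Rightarrow>\<^sub>0 kfld) \<Rightarrow> ('x \<Rightarrow>\<^sub>0 kfld)" where
  "diag g = lin_ext (\<lambda>w. Poly_Mapping.single w (g w))"

text \<open>The eigenvalues of the commuting projectors \<open>P\<^sub>j\<^sup>+\<close> and \<open>P\<^sub>S\<^sup>+\<close> on the basis vector \<open>w\<close>.\<close>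

definition P_plus :: "nat \<Rightarrow> fk_idx \<Rightarrow> kfld" where
  "P_plus j w = (if snd (w ! j) \<in> {Ethb, E2} then 1 else 0)"

definition PS_plus :: "nat \<Rightarrow> nat set \<Rightarrow> fk_idx \<Rightarrow> kfld" where
  "PS_plus n S w = (\<Prod>j\<in>S. P_plus j w) * (\<Prod>j\<in>{..<n} - S. 1 - P_plus j w)"

definition delta_m :: "real \<Rightarrow> nat \<Rightarrow> real" where
  "delta_m q m = (2 * real m - qnum q (2 * m)) / 4"

definition Bq :: "real \<Rightarrow> nat \<Rightarrow> nat \<Rightarrow> real" where
  "Bq q k r = c_num q (r + k) / real (r + k)"

text \<open>
  In \<open>M_plus\<close>, \<open>N_plus\<close>, \<open>N_op\<close> the argument \<open>r\<close> is the Euler degree of the bosonic factor.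
\<close>

definition M_plus :: "real \<Rightarrow> nat \<Rightarrow> nat \<Rightarrow> nat \<Rightarrow> nat \<Rightarrow> (fk_idx \<Rightarrow>\<^sub>0 kfld) \<Rightarrow> (fk_idx \<Rightarrow>\<^sub>0 kfld)" where
  "M_plus q m n k r = diag (\<lambda>w. kconst (of_real (delta_m q m)) +
     (\<Sum>S\<in>Pow {..<n} - {{}}. PS_plus n S w *
        ((\<Sum>j\<in>S. kappa_plus (s_par q m n) (fst (w ! j)) (kvar (k, j)))
         - of_nat (card S)
         - kconst (of_real (Bq q (card S) r)) * (\<Sum>j\<in>S. Kc (fst (w ! j)) (kvar (k, j))))))"

definition N_plus :: "real \<Rightarrow> nat \<Rightarrow> nat \<Rightarrow> nat \<Rightarrow> nat \<Rightarrow> (fk_idx \<Rightarrow>\<^sub>0 kfld) \<Rightarrow> (fk_idx \<Rightarrow>\<^sub>0 kfld)" where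
  "N_plus q m n k r u = - h_plus q m n k (M_plus q m n k r u)"

fun N_op :: "real \<Rightarrow> nat \<Rightarrow> nat \<Rightarrow> nat \<Rightarrow> pm \<Rightarrow> nat \<Rightarrow> (fk_idx \<Rightarrow>\<^sub>0 kfld) \<Rightarrow> (fk_idx \<Rightarrow>\<^sub>0 kfld)" where
  "N_op q m n k Plus r u = N_plus q m n k r u"
| "N_op q m n k Minus r u = fk_dag (N_plus q m n k r (fk_dag u))"


section \<open>Transport\<close>

text \<open>
  \<open>\<M>\<close> is the space of finitely supported functions from the basis of Clifford-valued
  polynomials to the tensor product of the fermionic spaces of the \<open>N\<close> copies.
\<close>

type_synonym f_idx = "fk_idx list"
type_synonym ftot = "f_idx \<Rightarrow>\<^sub>0 kfld"
type_synonym mspace = "pidx \<Rightarrow>\<^sub>0 ftot"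

definition F_basis :: "nat \<Rightarrow> nat \<Rightarrow> f_idx set" where
  "F_basis n N = {w. length w = N \<and> (\<forall>x\<in>set w. length x = n)}"

definition F_tot :: "real \<Rightarrow> nat \<Rightarrow> nat \<Rightarrow> nat \<Rightarrow> ftot set" where
  "F_tot q m n N = {e. Poly_Mapping.keys e \<subseteq> F_basis n N \<and>
     (\<forall>w. Poly_Mapping.lookup e w \<in> A_min (s_par q m n) ({..<N} \<times> {..<n}))}"

definition MM :: "real \<Rightarrow> nat \<Rightarrow> nat \<Rightarrow> nat \<Rightarrow> mspace set" where
  "MM q m n N = {u. Poly_Mapping.keys u \<subseteq> PCl_basis m N \<and>
     (\<forall>b. Poly_Mapping.lookup u b \<in> F_tot q m n N)}"

definition mscale :: "complex \<Rightarrow> mspace \<Rightarrow> mspace" where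
  "mscale c u = Poly_Mapping.map (scale (kconst c)) u"

definition tensor :: "pcl \<Rightarrow> ftot \<Rightarrow> mspace" where
  "tensor F e = (\<Sum>b\<in>Poly_Mapping.keys F. Poly_Mapping.single b (scale (kconst (Poly_Mapping.lookup F b)) e))"

text \<open>
  \<open>X \<otimes> Y\<close> for odd \<open>Y\<close>, with sign \<open>(-1) ^ |F|\<close> on \<open>F \<otimes> e\<close>.  The operator \<open>Y\<close> may depend on the
  monomial \<open>F\<close>; this is how its Euler degree acts on the bosonic factor.
\<close>

definition tensor_odd :: "(pcl \<Rightarrow> pcl) \<Rightarrow> (pidx \<Rightarrow> ftot \<Rightarrow> ftot) \<Rightarrow> mspace \<Rightarrow> mspace" where
  "tensor_odd X Y u = (\<Sum>b\<in>Poly_Mapping.keys u. case b of (\<mu>, \<nu>, A) \<Rightarrow>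
     mscale ((-1) ^ card A)
       (tensor (X (Poly_Mapping.single b 1)) (Y b (Poly_Mapping.lookup u b))))"

fun euler_deg :: "nat \<Rightarrow> pm \<Rightarrow> nat \<Rightarrow> pidx \<Rightarrow> nat" where
  "euler_deg m Plus k (\<mu>, \<nu>, A) = (\<Sum>a<m. Poly_Mapping.lookup \<nu> (k, a))"
| "euler_deg m Minus k (\<mu>, \<nu>, A) = (\<Sum>a<m. Poly_Mapping.lookup \<mu> (k, a))"

definition HH :: "real \<Rightarrow> nat \<Rightarrow> nat \<Rightarrow> nat \<Rightarrow> pm \<Rightarrow> nat \<Rightarrow> mspace \<Rightarrow> mspace" where
  "HH q m n N pm i = tensor_odd (n_op m N pm i)
     (\<lambda>b. hat fk_par i (N_op q m n i pm (euler_deg m pm i b)))"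

definition commutator :: "(mspace \<Rightarrow> mspace) \<Rightarrow> (mspace \<Rightarrow> mspace) \<Rightarrow> mspace \<Rightarrow> mspace" where
  "commutator X Y u = X (Y u) - Y (X u)"

text \<open>
  The exponential series of a locally nilpotent operator: the sum runs over its finitely many
  nonzero terms at \<open>u\<close>.  (If there were infinitely many, the value would be \<open>0\<close>.)
\<close>

definition op_exp :: "(mspace \<Rightarrow> mspace) \<Rightarrow> mspace \<Rightarrow> mspace" where
  "op_exp X u = (\<Sum>k | (X ^^ k) u \<noteq> 0. mscale (1 / fact k) ((X ^^ k) u))"

definition UU :: "real \<Rightarrow> nat \<Rightarrow> nat \<Rightarrow> nat \<Rightarrow> pm \<Rightarrow> mspace \<Rightarrow> mspace" where
  "UU q m n N pm = op_exp (\<lambda>u. \<Sum>i<N. HH q m n N pm i u)"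

text \<open>The product \<open>X\<^sub>0 X\<^sub>1 \<dots> X\<^bsub>N-1\<^esub>\<close>.\<close>

definition op_prod :: "nat \<Rightarrow> (nat \<Rightarrow> mspace \<Rightarrow> mspace) \<Rightarrow> mspace \<Rightarrow> mspace" where
  "op_prod N X = foldr (\<circ>) (map X [0..<N]) id"

definition RR :: "real \<Rightarrow> nat \<Rightarrow> nat \<Rightarrow> nat \<Rightarrow> mspace \<Rightarrow> mspace" where
  "RR q m n N = UU q m n N Plus \<circ> inv_into (MM q m n N) (UU q m n N Minus)"

definition I_plus :: "(mspace \<Rightarrow> mspace) \<Rightarrow> mspace \<Rightarrow> mspace" where
  "I_plus X u = u + X u"

definition I_minus :: "(mspace \<Rightarrow> mspace) \<Rightarrow> mspace \<Rightarrow> mspace" where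
  "I_minus X u = u - X u"

definition RRi :: "real \<Rightarrow> nat \<Rightarrow> nat \<Rightarrow> nat \<Rightarrow> nat \<Rightarrow> mspace \<Rightarrow> mspace" where
  "RRi q m n N i = I_plus (HH q m n N Plus i) \<circ> I_minus (HH q m n N Minus i)"

end

theory Submission
  imports Defs "HOL-Library.Function_Algebras"
begin

text \<open>
  Up to sign, \<open>H\<^sub>i H\<^sub>j\<close> is \<open>\<n>\<^sub>i \<n>\<^sub>j \<otimes> N\<^sub>i N\<^sub>j\<close>, so \<open>H\<^sub>i\<close> and \<open>H\<^sub>j\<close> commute because the Capelli
  contractions with distinct labels anticommute and so do the odd fermionic operators of distinct copies.
  Squares vanish already on the fermionic side: \<open>\<h>\<^sup>+\<close> squares to zero, and it preserves the charges and
  the ranges of the projectors \<open>P\<^sub>S\<^sup>+\<close>, hence commutes with the diagonal operator \<open>M\<^sup>+\<close>.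

  For the Fischer product, \<open>\<C>\<^sub>z = \<Sum>\<^sub>a P\<^sub>a\<^sup>* P\<^sub>a\<close> with \<open>P\<^sub>a u = \<Sum>\<^sub>i z\<^sub>i\<^sub>a u\<^sub>i\<close>; thus \<open>\<C>\<^sub>z\<close> and \<open>\<C>\<^sub>z + 1\<close>
  are injective and \<open>\<n>\<^sup>+\<close> is the unique solution of \<open>\<C>\<^sub>z \<n>\<^sup>+ = \<s>\<close>.  The commutation relations of the
  entries of \<open>\<C>\<^sub>z\<close> with \<open>\<s>\<close> give \<open>(\<C>\<^sub>z + 1) {\<n>\<^sub>k, \<n>\<^sub>l} = 0\<close> for the column indexed by \<open>k\<close>, so the
  anticommutator is zero.  The holomorphic and the antiholomorphic contractions anticommute because all
  ingredients do, again by uniqueness of the solution.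
\<close>

section \<open>Additive maps on free modules\<close>

text \<open>Two features shape the argument. The fermionic operator \<open>N_op\<close> reads an
  Euler degree of the bosonic factor, so \<open>HH\<close> is a tensor product only on parts of
  fixed degree. In a product of two such operators the degree read by the left one must therefore
  survive the right contraction. A contraction lowers only the degree in its own variables, those of
  its type and label, whereas \<open>N_op\<close> of the same type reads the degree in the conjugate
  variables. Trouble is possible only in a mixed product with equal labels, and such a product is
  never reordered: \<open>RRi\<close> keeps its two factors in place.

  Moreover, the contractions are given through preimages under the Capelli matrix and are controlled
  only on \<open>PCl m N\<close>. Existence of preimages is not automatic on an infinite-dimensional
  space; it comes from finite-dimensional invariant subspaces, where injectivity suffices.
  Afterwards every property of the contractions is obtained by exhibiting a solution of the defining
  linear system.\<close>

lemma additiveD: "additive f \<Longrightarrow> f (u + v) = f u + f v"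
  by (rule additive.add)

lemma additive_comp: "additive f \<Longrightarrow> additive g \<Longrightarrow> additive (\<lambda>u. f (g u))"
  by (simp add: additive_def)

lemma additive_plus: "additive f \<Longrightarrow> additive g \<Longrightarrow> additive (\<lambda>u. f u + g u)"
  by (simp add: additive_def)

lemma additive_diff: "additive f \<Longrightarrow> additive g \<Longrightarrow> additive (\<lambda>u. f u - g u)"
  by (simp add: additive_def)

lemma additive_uminus: "additive f \<Longrightarrow> additive (\<lambda>u. - f u)"
  by (simp add: additive_def)

lemma additive_sum_fun: "(\<And>i. i \<in> I \<Longrightarrow> additive (f i)) \<Longrightarrow> additive (\<lambda>u. \<Sum>i\<in>I. f i u)"
  by (simp add: additive_def sum.distrib)

lemma additive_id: "additive (\<lambda>u. u)"
  by (simp add: additive_def)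

lemma additive_zero: "additive (\<lambda>u. 0)"
  by (simp add: additive_def)

lemma additive_if: "additive f \<Longrightarrow> additive g \<Longrightarrow> additive (\<lambda>u. if P then f u else g u)"
  by (simp add: additive_def)

lemma additive_scale: "additive (scale c :: ('i \<Rightarrow>\<^sub>0 'r::comm_ring_1) \<Rightarrow> _)"
  by (simp add: additive_def scale_add)

lemma additive_lin_ext: "additive (lin_ext f :: _ \<Rightarrow> ('i \<Rightarrow>\<^sub>0 'r::comm_ring_1))"
  by (simp add: additive_def lin_ext_add)

lemma scale_minus: "scale c (- u) = - scale c (u :: 'i \<Rightarrow>\<^sub>0 'r::comm_ring_1)"
  by (rule poly_mapping_eqI) (simp add: lookup_scale)

lemma scale_minus_left: "scale (- c) u = - scale c (u :: 'i \<Rightarrow>\<^sub>0 'r::comm_ring_1)"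
  by (rule poly_mapping_eqI) (simp only: lookup_scale lookup_uminus mult_minus_left)

lemma scale_diff: "scale c (u - v) = scale c u - scale c (v :: 'i \<Rightarrow>\<^sub>0 'r::comm_ring_1)"
  by (rule poly_mapping_eqI) (simp add: lookup_scale lookup_minus right_diff_distrib)

text \<open>Only basis vectors in the support of \<open>u\<close> are tested, so what is known about
  that support, such as finite Clifford index sets or words of the right length, is available at
  every test vector.\<close>

lemma additive_eqI:
  fixes f g :: "('i \<Rightarrow>\<^sub>0 'r::ab_group_add) \<Rightarrow> 'b::ab_group_add"
  assumes "additive f" "additive g"
    and "\<And>i c. i \<in> Poly_Mapping.keys u \<Longrightarrow> f (Poly_Mapping.single i c) = g (Poly_Mapping.single i c)"
  shows "f u = g u"
proof (induction u rule: single_add_induct)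
  case zero
  show ?case using assms(1,2) by (simp add: additive.zero)
qed (use assms in \<open>simp_all add: additiveD\<close>)

lemma keys_sum_subset: "(\<And>i. i \<in> I \<Longrightarrow> Poly_Mapping.keys (f i) \<subseteq> K) \<Longrightarrow> Poly_Mapping.keys (\<Sum>i\<in>I. f i) \<subseteq> K"
  using keys_sum[of f I] by blast

lemma keys_scale_subset: "Poly_Mapping.keys (scale c u) \<subseteq> Poly_Mapping.keys u"
  by (auto simp: in_keys_iff lookup_scale)

lemma keys_lin_ext_subset:
  assumes "\<And>i. i \<in> Poly_Mapping.keys u \<Longrightarrow> Poly_Mapping.keys (f i) \<subseteq> K"
  shows "Poly_Mapping.keys (lin_ext f u) \<subseteq> K"
  unfolding lin_ext_def
  by (rule keys_sum_subset) (rule order_trans[OF keys_scale_subset assms])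

section \<open>Elementary operators on Clifford-valued polynomials\<close>

abbreviation unit_expo :: "nat \<Rightarrow> nat \<Rightarrow> expo" where
  "unit_expo k a \<equiv> Poly_Mapping.single (k, a) 1"

lemma dz_single: "dz k a (Poly_Mapping.single (\<mu>, \<nu>, A) c) =
    Poly_Mapping.single (\<mu> - unit_expo k a, \<nu>, A) (c * of_nat (Poly_Mapping.lookup \<mu> (k, a)))"
  by (simp add: dz_def lin_ext_single scale_single)

lemma zmult_single: "zmult k a (Poly_Mapping.single (\<mu>, \<nu>, A) c) =
    Poly_Mapping.single (\<mu> + unit_expo k a, \<nu>, A) c"
  by (simp add: zmult_def lin_ext_single scale_single)

lemma pgrade_single: "pgrade (Poly_Mapping.single (\<mu>, \<nu>, A) c) =
    Poly_Mapping.single (\<mu>, \<nu>, A) (c * (-1) ^ card A)"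
  by (simp add: pgrade_def lin_ext_single scale_single)

lemma additive_basic:
  "additive (dz k a)" "additive (zmult k a)" "additive (contract j)" "additive (delta a)" "additive pgrade"
  "additive pdag"
  by (simp_all add: dz_def zmult_def contract_def pgrade_def additive_lin_ext additive_def delta_add pdag_add lin_ext_add)

lemma basic_0 [simp]: "dz k a 0 = 0" "zmult k a 0 = 0" "contract j 0 = 0" "pgrade 0 = 0"
  by (simp_all add: additive.zero additive_basic)

lemmas additive_intros = additive_basic additive_id additive_zero additive_scale
  additive_comp[OF additive_basic(1)] additive_comp[OF additive_basic(2)]
  additive_comp[OF additive_basic(3)] additive_comp[OF additive_basic(4)] additive_comp[OF additive_basic(5)]
  additive_comp[OF additive_basic(6)]
  additive_comp[OF additive_scale] additive_plus additive_diff additive_uminus additive_sum_fun additive_if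

lemma pcl_eqI:
  fixes f g :: "pcl \<Rightarrow> pcl"
  assumes "additive f" "additive g"
    and "\<And>\<mu> \<nu> A c. (\<mu>, \<nu>, A) \<in> Poly_Mapping.keys F \<Longrightarrow>
      f (Poly_Mapping.single (\<mu>, \<nu>, A) c) = g (Poly_Mapping.single (\<mu>, \<nu>, A) c)"
  shows "f F = g F"
proof (rule additive_eqI[OF assms(1,2)])
  fix i :: pidx and c :: complex
  assume "i \<in> Poly_Mapping.keys F"
  then show "f (Poly_Mapping.single i c) = g (Poly_Mapping.single i c)"
    using assms(3) by (cases i) auto
qed

lemma dz_dz: "dz k a (dz l b F) = dz l b (dz k a F)"
proof (rule pcl_eqI[where F = F])
  fix \<mu> \<nu> A c
  have "\<mu> - unit_expo l b - unit_expo k a = \<mu> - unit_expo k a - unit_expo l b"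
    by (rule diff_right_commute)
  then show "dz k a (dz l b (Poly_Mapping.single (\<mu>, \<nu>, A) c)) = dz l b (dz k a (Poly_Mapping.single (\<mu>, \<nu>, A) c))"
    by (cases "k = l \<and> a = b") (auto simp: dz_single lookup_minus lookup_single mult_ac)
qed (intro additive_intros)+

lemma zmult_zmult: "zmult k a (zmult l b F) = zmult l b (zmult k a F)"
  by (rule pcl_eqI[where F = F]) (intro additive_intros | simp add: zmult_single add.commute add.left_commute)+

text \<open>The Weyl relation. Exponents are subtracted with truncation, so a vanishing exponent is
  a separate case; there \<open>dz\<close> produces the coefficient 0 and the truncated exponent
  does no harm.\<close>

lemma dz_zmult: "dz k a (zmult l b F) = zmult l b (dz k a F) + (if k = l \<and> a = b then F else 0)"
proof (rule pcl_eqI[where F = F])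
  fix \<mu> \<nu> A c
  show "dz k a (zmult l b (Poly_Mapping.single (\<mu>, \<nu>, A) c)) =
    zmult l b (dz k a (Poly_Mapping.single (\<mu>, \<nu>, A) c)) +
    (if k = l \<and> a = b then Poly_Mapping.single (\<mu>, \<nu>, A) c else 0)"
  proof (cases "k = l \<and> a = b")
    case True
    show ?thesis
    proof (cases "Poly_Mapping.lookup \<mu> (l, b)")
      case 0
      with True show ?thesis by (simp add: dz_single zmult_single lookup_add)
    next
      case (Suc r)
      have "\<mu> - unit_expo l b + unit_expo l b = \<mu>"
        using Suc by (intro poly_mapping_eqI) (auto simp: lookup_add lookup_minus lookup_single when_def)
      with True Suc show ?thesis
        by (simp add: dz_single zmult_single lookup_add algebra_simps flip: single_add)
    qed
  next
    case False
    then have "Poly_Mapping.lookup \<mu> (k, a) \<noteq> 0 \<Longrightarrow> \<mu> + unit_expo l b - unit_expo k a = \<mu> - unit_expo k a + unit_expo l b"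
      by (intro poly_mapping_eqI) (auto simp: lookup_add lookup_minus lookup_single when_def)
    with False show ?thesis
      by (cases "Poly_Mapping.lookup \<mu> (k, a) = 0") (auto simp: dz_single zmult_single lookup_add lookup_single)
  qed
qed (intro additive_intros)+

lemma contract_dz: "contract j (dz k a F) = dz k a (contract j F)"
  by (rule pcl_eqI[where F = F])
    (intro additive_intros | simp add: dz_single contract_single mult_ac)+

lemma contract_zmult: "contract j (zmult k a F) = zmult k a (contract j F)"
  by (rule pcl_eqI[where F = F])
    (intro additive_intros | simp add: zmult_single contract_single)+

lemma contract_contract: "contract j (contract k F) = - contract k (contract j F)"
proof (rule pcl_eqI[where F = F])
  fix \<mu> \<nu> A c
  have c0: "contract j 0 = 0" for j
    by (rule additive.zero) (rule additive_basic)
  show "contract j (contract k (Poly_Mapping.single (\<mu>, \<nu>, A) c)) = - contract k (contract j (Poly_Mapping.single (\<mu>, \<nu>, A) c))"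
  proof (cases "j \<in> A \<and> k \<in> A \<and> j \<noteq> k")
    case True
    \<comment> \<open>Deleting \<open>p\<close> lowers the number of elements below \<open>r\<close>
      exactly when \<open>p < r\<close>. For distinct labels this happens in exactly one of the two
      orders of contraction, which is the source of the sign.\<close>
    have *: "(-1 :: complex) ^ card {x \<in> A - {p}. x < r} = (if p < r then -1 else 1) * (-1) ^ card {x \<in> A. x < r}"
      if "p \<in> A" for p r :: nat
    proof (cases "p < r")
      case True
      have "{x \<in> A - {p}. x < r} = {x \<in> A. x < r} - {p}" by auto
      moreover have "card {x \<in> A. x < r} = Suc (card ({x \<in> A. x < r} - {p}))"
        using that True by (intro card.remove) auto
      ultimately show ?thesis using True by simp
    next
      case False
      then have "{x \<in> A - {p}. x < r} = {x \<in> A. x < r}" by auto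
      with False show ?thesis by simp
    qed
    have kj: "j \<in> A" "k \<in> A" "j \<in> A - {k}" "k \<in> A - {j}" "j < k \<or> k < j"
      using True by auto
    have sets: "A - {k} - {j} = A - {j} - {k}" by auto
    have "c * (-1) ^ card {x \<in> A. x < k} * (-1) ^ card {x \<in> A - {k}. x < j}
        = - (c * (-1) ^ card {x \<in> A. x < j} * (-1) ^ card {x \<in> A - {j}. x < k})"
      using kj(5) unfolding *[OF kj(1)] *[OF kj(2)] by auto
    then show ?thesis
      by (simp only: contract_single kj if_True sets single_uminus)
  qed (auto simp: contract_single c0)
qed (intro additive_intros)+

lemma dz_scale: "dz k a (scale c F) = scale c (dz k a F)"
  by (simp add: dz_def lin_ext_scale)

lemma zmult_scale: "zmult k a (scale c F) = scale c (zmult k a F)"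
  by (simp add: zmult_def lin_ext_scale)

lemma contract_scale: "contract j (scale c F) = scale c (contract j F)"
  by (simp add: contract_def lin_ext_scale)

lemma pgrade_scale: "pgrade (scale c F) = scale c (pgrade F)"
  by (simp add: pgrade_def lin_ext_scale)

lemma delta_scale: "delta a (scale c F) = scale c (delta a F)"
  by (simp add: delta_def contract_scale scale_add scale_scale mult.commute)

lemma pdag_scale: "pdag (scale c F) = scale (cnj c) (pdag F)"
  by (rule poly_mapping_eqI) (auto simp: lookup_pdag lookup_scale)

lemma delta_dz: "delta b (dz k a F) = dz k a (delta b F)"
  by (simp add: delta_def contract_dz dz_scale additiveD[OF additive_basic(1)])

lemma delta_zmult: "delta b (zmult k a F) = zmult k a (delta b F)"
  by (simp add: delta_def contract_zmult zmult_scale additiveD[OF additive_basic(2)])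

lemma delta_delta: "delta a (delta b F) = - delta b (delta a F)"
  unfolding delta_def contract_add contract_scale
    contract_contract[of "2*a" "2*b" F] contract_contract[of "2*a" "2*b+1" F]
    contract_contract[of "2*a+1" "2*b" F] contract_contract[of "2*a+1" "2*b+1" F]
  by (simp add: scale_add scale_diff scale_minus scale_minus_left scale_scale)

section \<open>Conjugated operators\<close>

definition dagop :: "(pcl \<Rightarrow> pcl) \<Rightarrow> pcl \<Rightarrow> pcl" where
  "dagop X F = pdag (X (pdag F))"

lemma additive_dagop: "additive X \<Longrightarrow> additive (dagop X)"
  by (simp add: additive_def dagop_def pdag_add)

lemma dagop_scale: "(\<And>c F. X (scale c F) = scale c (X F)) \<Longrightarrow> dagop X (scale c F) = scale c (dagop X F)"
  by (simp add: dagop_def pdag_scale)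

lemma contract_pdag: "contract j (pdag F) = pdag (contract j F)"
  by (rule pcl_eqI[where F = F]) (intro additive_intros | simp add: contract_single pdag_single)+

lemma pgrade_pdag: "pgrade (pdag F) = pdag (pgrade F)"
  by (rule pcl_eqI[where F = F]) (intro additive_intros | simp add: pgrade_single pdag_single)+

lemma dagop_delta: "dagop (delta a) F = contract (2*a) F + scale \<i> (contract (2*a+1) F)"
  by (simp add: dagop_def delta_def contract_pdag pdag_add pdag_pdag pdag_scale)

text \<open>Conjugation transfers the derivative from the first exponent of a basis index to the
  second, so the operators act on separate components of the index.\<close>

lemma dagop_dz_commute:
  "dagop (dz k a) (dz l b F) = dz l b (dagop (dz k a) F)"
  "dagop (dz k a) (zmult l b F) = zmult l b (dagop (dz k a) F)"
  "dagop (dz k a) (contract j F) = contract j (dagop (dz k a) F)"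
  unfolding dagop_def
  by (rule pcl_eqI[where F = F], (intro additive_intros)+,
      simp add: dz_single zmult_single contract_single pdag_single mult_ac)+

lemma dagop_zmult_commute:
  "dagop (zmult k a) (dz l b F) = dz l b (dagop (zmult k a) F)"
  "dagop (zmult k a) (zmult l b F) = zmult l b (dagop (zmult k a) F)"
  "dagop (zmult k a) (contract j F) = contract j (dagop (zmult k a) F)"
  unfolding dagop_def
  by (rule pcl_eqI[where F = F], (intro additive_intros)+,
      simp add: dz_single zmult_single contract_single pdag_single mult_ac)+

text \<open>A conjugated \<open>delta\<close> is again a combination of
  \<open>contract (2*a)\<close> and \<open>contract (2*a+1)\<close>. Contractions anticommute among
  themselves without a constant term, so equal labels are no exception.\<close>

lemma dagop_delta_commute:
  "dagop (delta a) (dz l b F) = dz l b (dagop (delta a) F)"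
  "dagop (delta a) (zmult l b F) = zmult l b (dagop (delta a) F)"
  "dagop (delta a) (delta b F) = - delta b (dagop (delta a) F)"
  subgoal by (simp add: dagop_delta contract_dz dz_scale additiveD[OF additive_basic(1)])
  subgoal by (simp add: dagop_delta contract_zmult zmult_scale additiveD[OF additive_basic(2)])
  subgoal
    unfolding dagop_delta delta_def contract_add contract_scale
      contract_contract[of "2*a" "2*b" F] contract_contract[of "2*a" "2*b+1" F]
      contract_contract[of "2*a+1" "2*b" F] contract_contract[of "2*a+1" "2*b+1" F]
    by (simp add: scale_add scale_diff scale_minus scale_minus_left scale_scale)
  done

lemma pgrade_commute:
  "pgrade (dz l b F) = dz l b (pgrade F)"
  "pgrade (zmult l b F) = zmult l b (pgrade F)"
  by (rule pcl_eqI[where F = F], (intro additive_intros)+, simp add: dz_single zmult_single pgrade_single mult_ac)+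

text \<open>Membership in \<open>PCl m N\<close> makes the Clifford index sets finite. On an
  infinite set \<open>card\<close> is 0, and removing an element would not change the sign.\<close>

lemma pgrade_contract:
  assumes "F \<in> PCl m N"
  shows "pgrade (contract j F) = - contract j (pgrade F)"
proof (rule pcl_eqI[where F = F])
  fix \<mu> \<nu> A c
  assume "(\<mu>, \<nu>, A) \<in> Poly_Mapping.keys F"
  with assms have fin: "finite A"
    by (auto simp: PCl_def PCl_basis_def intro: finite_subset)
  have "(-1 :: complex) ^ card A = - ((-1) ^ card (A - {j}))" if "j \<in> A"
    by (subst card.remove[of A j]) (use fin that in simp_all)
  then show "pgrade (contract j (Poly_Mapping.single (\<mu>, \<nu>, A) c)) = - contract j (pgrade (Poly_Mapping.single (\<mu>, \<nu>, A) c))"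
    by (auto simp: pgrade_single contract_single single_uminus[symmetric] mult_ac simp del: card_Diff_insert)
qed (intro additive_intros)+

section \<open>Commutation relations of the Capelli operators\<close>

lemma additive_capelli:
  "additive (s_op m i)" "additive (Ez m j i)" "additive (Cz_entry m i j)"
  unfolding s_op_def Ez_def Cz_entry_def by (intro additive_intros)+

lemmas capelli_add = additive_capelli[THEN additiveD]
lemmas capelli_0 [simp] = additive_capelli[THEN additive.zero]
lemmas capelli_minus = additive_capelli[THEN additive.minus]
lemmas capelli_diff = additive_capelli[THEN additive.diff]
lemmas capelli_sum = additive_capelli[THEN additive.sum]
lemmas basic_sum = additive_basic[THEN additive.sum]
lemmas basic_add = additive_basic[THEN additiveD]
lemma s_op_scale: "s_op m i (scale c F) = scale c (s_op m i F)"
  by (simp add: s_op_def dz_scale delta_scale scale_sum)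

lemma Ez_scale: "Ez m j i (scale c F) = scale c (Ez m j i F)"
  by (simp add: Ez_def dz_scale zmult_scale scale_sum)

lemma Cz_entry_scale: "Cz_entry m i j (scale c F) = scale c (Cz_entry m i j F)"
  by (simp add: Cz_entry_def Ez_scale scale_scale scale_add mult.commute)

lemma s_s: "s_op m k (s_op m l F) = - s_op m l (s_op m k F)"
proof -
  have "s_op m k (s_op m l F) = (\<Sum>a<m. \<Sum>b<m. delta a (delta b (dz k a (dz l b F))))"
    by (simp add: s_op_def basic_sum delta_dz)
  also have "\<dots> = (\<Sum>b<m. \<Sum>a<m. - delta b (delta a (dz l b (dz k a F))))"
    by (subst sum.swap, subst delta_delta, subst dz_dz) (rule refl)
  also have "\<dots> = - s_op m l (s_op m k F)"
    by (simp add: s_op_def basic_sum delta_dz sum_negf)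
  finally show ?thesis .
qed

lemma s_E: "s_op m l (Ez m j i F) = Ez m j i (s_op m l F) + (if j = l then s_op m i F else 0)"
proof -
  have "s_op m l (Ez m j i F) = (\<Sum>a<m. \<Sum>b<m. delta a (dz l a (zmult j b (dz i b F))))"
    by (simp add: s_op_def Ez_def basic_sum)
  also have "\<dots> = (\<Sum>a<m. \<Sum>b<m. zmult j b (dz i b (delta a (dz l a F))) + (if j = l \<and> a = b then delta a (dz i b F) else 0))"
    by (intro sum.cong refl) (auto simp: dz_zmult basic_add delta_zmult delta_dz dz_dz)
  also have "\<dots> = (\<Sum>a<m. \<Sum>b<m. zmult j b (dz i b (delta a (dz l a F))))
      + (if j = l then \<Sum>a<m. delta a (dz i a F) else 0)"
    by (simp add: sum.distrib)
  also have "(\<Sum>a<m. \<Sum>b<m. zmult j b (dz i b (delta a (dz l a F)))) = Ez m j i (s_op m l F)"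
    unfolding s_op_def Ez_def basic_sum by (rule sum.swap)
  finally show ?thesis by (simp add: s_op_def)
qed

lemma s_C: "s_op m l (Cz_entry m i j F) = Cz_entry m i j (s_op m l F) + (if j = l then s_op m i F else 0)"
  by (simp add: Cz_entry_def capelli_add s_E s_op_scale)

text \<open>The relations of gl_N. The normally ordered double sum is symmetric in the two
  operators, so the commutator consists of the terms in which a derivative meets a variable.\<close>

lemma E_E: "Ez m p q (Ez m j i F) = Ez m j i (Ez m p q F)
    + (if q = j then Ez m p i F else 0) - (if i = p then Ez m j q F else 0)"
proof -
  have E: "Ez m p q (Ez m j i F) = (\<Sum>a<m. \<Sum>b<m. zmult p a (zmult j b (dz q a (dz i b F))))
      + (if q = j then Ez m p i F else 0)" for p q j i
  proof -
    have "Ez m p q (Ez m j i F) = (\<Sum>a<m. \<Sum>b<m. zmult p a (zmult j b (dz q a (dz i b F)))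
        + (if q = j \<and> a = b then zmult p a (dz i b F) else 0))"
      by (auto simp: Ez_def basic_sum dz_zmult basic_add intro!: sum.cong)
    also have "\<dots> = (\<Sum>a<m. \<Sum>b<m. zmult p a (zmult j b (dz q a (dz i b F))))
      + (if q = j then Ez m p i F else 0)"
      by (simp add: sum.distrib Ez_def)
    finally show ?thesis .
  qed
  have "(\<Sum>a<m. \<Sum>b<m. zmult p a (zmult j b (dz q a (dz i b F))))
      = (\<Sum>a<m. \<Sum>b<m. zmult j a (zmult p b (dz i a (dz q b F))))"
    by (subst sum.swap, subst zmult_zmult, subst dz_dz) (rule refl)
  then show ?thesis
    unfolding E[of p q j i] E[of j i p q] by simp
qed

lemma E_C: "Ez m p q (Cz_entry m i j F) = Cz_entry m i j (Ez m p q F)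
    + (if q = j then Ez m p i F else 0) - (if i = p then Ez m j q F else 0)"
  unfolding Cz_entry_def capelli_add E_E[of m p q j i F] by (simp add: Ez_scale)

text \<open>
  Moving the derivatives to the left absorbs the constant \<open>m\<close>; this exhibits \<open>\<C>\<^sub>z\<close> as a sum of
  operators of the form \<open>P\<^sup>* P\<close>.
\<close>

lemma Cz_entry_normal: "Cz_entry m i j F = (\<Sum>a<m. dz i a (zmult j a F))"
proof -
  have const: "(\<Sum>a<m. F) = scale (of_nat m) F"
  proof (induction m)
    case (Suc m)
    then show ?case
      by (simp only: sum.lessThan_Suc of_nat_Suc scale_add_left scale_1 add.commute)
  qed simp
  have "(\<Sum>a<m. dz i a (zmult j a F)) = Ez m j i F + (\<Sum>a<m. if i = j then F else 0)"
    unfolding dz_zmult sum.distrib Ez_def by simp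
  then show ?thesis
    unfolding Cz_entry_def using const by (cases "i = j") (simp_all only: refl if_True if_False sum.neutral_const add_0_left add_0_right add.commute)
qed

section \<open>Invariance of the Clifford-valued polynomials, and operators commuting with the
  Capelli matrix\<close>

lemma PCl_closed:
  "F \<in> PCl m N \<Longrightarrow> G \<in> PCl m N \<Longrightarrow> F + G \<in> PCl m N"
  "F \<in> PCl m N \<Longrightarrow> - F \<in> PCl m N"
  "F \<in> PCl m N \<Longrightarrow> G \<in> PCl m N \<Longrightarrow> F - G \<in> PCl m N"
  "F \<in> PCl m N \<Longrightarrow> scale c F \<in> PCl m N"
  "0 \<in> PCl m N"
  "(\<And>i. i \<in> I \<Longrightarrow> f i \<in> PCl m N) \<Longrightarrow> (\<Sum>i\<in>I. f i) \<in> PCl m N"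
  unfolding PCl_def using keys_add[of F G] keys_diff[of F G] keys_scale_subset[of c F]
  by (auto intro: keys_sum_subset[THEN subsetD])

lemma single_in_PCl: "b \<in> PCl_basis m N \<Longrightarrow> Poly_Mapping.single b c \<in> PCl m N"
  by (simp add: PCl_def)

lemma lin_ext_in_PCl:
  "F \<in> PCl m N \<Longrightarrow> (\<And>b. b \<in> PCl_basis m N \<Longrightarrow> f b \<in> PCl m N) \<Longrightarrow> lin_ext f F \<in> PCl m N"
  unfolding PCl_def mem_Collect_eq by (rule keys_lin_ext_subset) blast

lemma keys_minus_nat_subset: "Poly_Mapping.keys (\<mu> - \<kappa> :: 'x \<Rightarrow>\<^sub>0 nat) \<subseteq> Poly_Mapping.keys \<mu>"
  by (auto simp: in_keys_iff lookup_minus)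

lemma basic_in_PCl:
  assumes "F \<in> PCl m N"
  shows "dz k a F \<in> PCl m N" "k < N \<Longrightarrow> a < m \<Longrightarrow> zmult k a F \<in> PCl m N" "contract j F \<in> PCl m N"
    "delta a F \<in> PCl m N" "pgrade F \<in> PCl m N" "pdag F \<in> PCl m N"
proof -
  show "dz k a F \<in> PCl m N"
    unfolding dz_def
    by (rule lin_ext_in_PCl[OF assms])
      (use keys_minus_nat_subset in \<open>fastforce simp: PCl_basis_def intro!: single_in_PCl\<close>)
  show "k < N \<Longrightarrow> a < m \<Longrightarrow> zmult k a F \<in> PCl m N"
    unfolding zmult_def
    by (rule lin_ext_in_PCl[OF assms])
      (use keys_add in \<open>fastforce simp: PCl_basis_def intro!: single_in_PCl\<close>)
  show c: "contract j F \<in> PCl m N" for j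
    unfolding contract_def
    by (rule lin_ext_in_PCl[OF assms])
      (auto simp: PCl_basis_def subset_iff intro!: single_in_PCl PCl_closed(5))
  show "delta a F \<in> PCl m N"
    unfolding delta_def by (intro PCl_closed c)
  show "pgrade F \<in> PCl m N"
    unfolding pgrade_def
    by (rule lin_ext_in_PCl[OF assms]) (auto simp: PCl_basis_def intro!: single_in_PCl)
  show "pdag F \<in> PCl m N"
    unfolding pdag_def
  proof (rule PCl_closed(6))
    fix b
    assume "b \<in> Poly_Mapping.keys F"
    with assms have "b \<in> PCl_basis m N" by (auto simp: PCl_def)
    then show "(case b of (\<mu>, \<nu>, A) \<Rightarrow> Poly_Mapping.single (\<nu>, \<mu>, A) (cnj (Poly_Mapping.lookup F b))) \<in> PCl m N"
      by (cases b) (simp add: PCl_basis_def single_in_PCl)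
  qed
qed

lemma capelli_in_PCl:
  assumes "F \<in> PCl m N"
  shows "s_op m i F \<in> PCl m N" "j < N \<Longrightarrow> Ez m j i F \<in> PCl m N" "j < N \<Longrightarrow> Cz_entry m i j F \<in> PCl m N"
  unfolding Cz_entry_def s_op_def Ez_def using assms by (auto intro!: PCl_closed basic_in_PCl)

lemma dagop_in_PCl: "(\<And>F. F \<in> PCl m N \<Longrightarrow> X F \<in> PCl m N) \<Longrightarrow> F \<in> PCl m N \<Longrightarrow> dagop X F \<in> PCl m N"
  by (simp add: dagop_def basic_in_PCl)

text \<open>The Capelli operators are built from \<open>dz\<close>, \<open>zmult\<close> and
  \<open>delta\<close>, so relations with these generators suffice. The two variants for
  \<open>delta\<close> cover operators \<open>X\<close> that are even or odd in the Clifford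
  grading.\<close>

lemma commute_s_C:
  assumes "additive X" "\<And>c F. X (scale c F) = scale c (X F)"
    and "\<And>k a F. X (dz k a F) = dz k a (X F)" "\<And>k a F. X (zmult k a F) = zmult k a (X F)"
  shows "X (Ez m j i F) = Ez m j i (X F)" "X (Cz_entry m i j F) = Cz_entry m i j (X F)"
    "(\<And>a F. X (delta a F) = delta a (X F)) \<Longrightarrow> X (s_op m i F) = s_op m i (X F)"
    "(\<And>a F. X (delta a F) = - delta a (X F)) \<Longrightarrow> X (s_op m i F) = - s_op m i (X F)"
  by (simp_all add: Ez_def Cz_entry_def s_op_def assms additive.sum[OF assms(1)] additiveD[OF assms(1)]
      additive.zero[OF assms(1)] sum_negf)

lemma dagop_capelli:
  "dagop (Ez m j i) F = (\<Sum>a<m. dagop (zmult j a) (dagop (dz i a) F))"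
  "dagop (s_op m i) F = (\<Sum>a<m. dagop (delta a) (dagop (dz i a) F))"
  "dagop (Cz_entry m i j) F = (if i = j then scale (of_nat m) F else 0) + dagop (Ez m j i) F"
  by (simp_all add: dagop_def Ez_def s_op_def Cz_entry_def basic_sum pdag_pdag pdag_add pdag_scale)

lemma dagop_capelli_commute_basic:
  "dagop (Ez m j i) (dz k a F) = dz k a (dagop (Ez m j i) F)"
  "dagop (Ez m j i) (zmult k a F) = zmult k a (dagop (Ez m j i) F)"
  "dagop (Ez m j i) (delta a F) = delta a (dagop (Ez m j i) F)"
  "dagop (Cz_entry m i j) (dz k a F) = dz k a (dagop (Cz_entry m i j) F)"
  "dagop (Cz_entry m i j) (zmult k a F) = zmult k a (dagop (Cz_entry m i j) F)"
  "dagop (Cz_entry m i j) (delta a F) = delta a (dagop (Cz_entry m i j) F)"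
  "dagop (s_op m i) (dz k a F) = dz k a (dagop (s_op m i) F)"
  "dagop (s_op m i) (zmult k a F) = zmult k a (dagop (s_op m i) F)"
  "dagop (s_op m i) (delta a F) = - delta a (dagop (s_op m i) F)"
proof -
  have d: "dagop (dz k a) (delta b F) = delta b (dagop (dz k a) F)" for k a b F
    by (simp add: delta_def dagop_dz_commute additiveD[OF additive_dagop[OF additive_basic(1)]] dagop_scale[OF dz_scale])
  have z: "dagop (zmult k a) (delta b F) = delta b (dagop (zmult k a) F)" for k a b F
    by (simp add: delta_def dagop_zmult_commute additiveD[OF additive_dagop[OF additive_basic(2)]] dagop_scale[OF zmult_scale])
  note rules = dagop_capelli basic_sum basic_add dagop_dz_commute dagop_zmult_commute dagop_delta_commute d z
    dz_scale zmult_scale delta_scale sum_negf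
  show
    "dagop (Ez m j i) (dz k a F) = dz k a (dagop (Ez m j i) F)"
    "dagop (Ez m j i) (zmult k a F) = zmult k a (dagop (Ez m j i) F)"
    "dagop (Ez m j i) (delta a F) = delta a (dagop (Ez m j i) F)"
    "dagop (Cz_entry m i j) (dz k a F) = dz k a (dagop (Cz_entry m i j) F)"
    "dagop (Cz_entry m i j) (zmult k a F) = zmult k a (dagop (Cz_entry m i j) F)"
    "dagop (Cz_entry m i j) (delta a F) = delta a (dagop (Cz_entry m i j) F)"
    "dagop (s_op m i) (dz k a F) = dz k a (dagop (s_op m i) F)"
    "dagop (s_op m i) (zmult k a F) = zmult k a (dagop (s_op m i) F)"
    "dagop (s_op m i) (delta a F) = - delta a (dagop (s_op m i) F)"
    by (simp_all add: rules)
qed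

lemmas dagop_Ez_commute = commute_s_C[OF additive_dagop[OF additive_capelli(2)] dagop_scale[OF Ez_scale]
    dagop_capelli_commute_basic(1,2)]
lemmas dagop_Cz_commute = commute_s_C[OF additive_dagop[OF additive_capelli(3)] dagop_scale[OF Cz_entry_scale]
    dagop_capelli_commute_basic(4,5)]
lemmas dagop_s_commute = commute_s_C[OF additive_dagop[OF additive_capelli(1)] dagop_scale[OF s_op_scale]
    dagop_capelli_commute_basic(7,8)]

lemma pgrade_C: "pgrade (Cz_entry m i j F) = Cz_entry m i j (pgrade F)"
  by (rule commute_s_C) (simp_all add: additive_basic pgrade_scale pgrade_commute)

lemma pgrade_s:
  assumes "F \<in> PCl m N"
  shows "pgrade (s_op m i F) = - s_op m i (pgrade F)"
  by (simp add: s_op_def delta_def basic_sum basic_add pgrade_scale pgrade_commute scale_minus sum_negf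
      pgrade_contract[OF basic_in_PCl(1)[OF assms]] sum.distrib)

section \<open>The Fischer product and invertibility of the Capelli matrix\<close>

definition expo_fact :: "expo \<Rightarrow> real" where
  "expo_fact \<mu> = (\<Prod>v\<in>Poly_Mapping.keys \<mu>. fact (Poly_Mapping.lookup \<mu> v))"

text \<open>The weight involves only the holomorphic exponent, because the Capelli matrix acts in
  the holomorphic variables alone; antiholomorphic monomials and Clifford words count as
  orthonormal.\<close>

definition fischer :: "pcl \<Rightarrow> pcl \<Rightarrow> complex" where
  "fischer F G = (\<Sum>b\<in>Poly_Mapping.keys F.
     cnj (Poly_Mapping.lookup F b) * Poly_Mapping.lookup G b * of_real (expo_fact (fst b)))"

lemma expo_fact_pos: "0 < expo_fact \<mu>"
  unfolding expo_fact_def by (rule prod_pos) simp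

lemma expo_fact_add_unit:
  "expo_fact (\<mu> + unit_expo k a) = of_nat (Poly_Mapping.lookup \<mu> (k, a) + 1) * expo_fact \<mu>"
proof -
  let ?v = "(k, a)" and ?K = "insert (k, a) (Poly_Mapping.keys \<mu>)"
  have sup: "expo_fact \<kappa> = (\<Prod>v\<in>?K. fact (Poly_Mapping.lookup \<kappa> v))" if "Poly_Mapping.keys \<kappa> \<subseteq> ?K" for \<kappa>
    unfolding expo_fact_def
    by (rule prod.mono_neutral_left) (use that in \<open>auto simp: in_keys_iff\<close>)
  have "Poly_Mapping.keys (\<mu> + unit_expo k a) \<subseteq> ?K"
    using keys_add[of \<mu> "unit_expo k a"] by auto
  then have "expo_fact (\<mu> + unit_expo k a) = (\<Prod>v\<in>?K. fact (Poly_Mapping.lookup (\<mu> + unit_expo k a) v))"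
    by (rule sup)
  also have "\<dots> = fact (Poly_Mapping.lookup \<mu> ?v + 1) * (\<Prod>v\<in>?K - {?v}. fact (Poly_Mapping.lookup (\<mu> + unit_expo k a) v))"
    by (subst prod.remove[of ?K ?v]) (simp_all add: lookup_add)
  also have "(\<Prod>v\<in>?K - {?v}. fact (Poly_Mapping.lookup (\<mu> + unit_expo k a) v)) = (\<Prod>v\<in>?K - {?v}. fact (Poly_Mapping.lookup \<mu> v) :: real)"
    by (rule prod.cong) (auto simp: lookup_add lookup_single when_def)
  also have "fact (Poly_Mapping.lookup \<mu> ?v + 1) * \<dots>
      = of_nat (Poly_Mapping.lookup \<mu> ?v + 1) * (fact (Poly_Mapping.lookup \<mu> ?v) * (\<Prod>v\<in>?K - {?v}. fact (Poly_Mapping.lookup \<mu> v)))"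
    by simp
  also have "fact (Poly_Mapping.lookup \<mu> ?v) * (\<Prod>v\<in>?K - {?v}. fact (Poly_Mapping.lookup \<mu> v)) = expo_fact \<mu>"
    by (subst sup) (auto simp: prod.remove[of ?K ?v])
  finally show ?thesis .
qed

lemma fischer_superset:
  "finite K \<Longrightarrow> Poly_Mapping.keys F \<subseteq> K \<Longrightarrow> fischer F G =
    (\<Sum>b\<in>K. cnj (Poly_Mapping.lookup F b) * Poly_Mapping.lookup G b * of_real (expo_fact (fst b)))"
  unfolding fischer_def by (rule sum.mono_neutral_left) (auto simp: in_keys_iff)

lemma fischer_additive_left: "additive (\<lambda>F. fischer F G)"
proof
  fix F F' :: pcl
  let ?K = "Poly_Mapping.keys F \<union> Poly_Mapping.keys F'"
  show "fischer (F + F') G = fischer F G + fischer F' G"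
    using keys_add[of F F']
    by (simp add: fischer_superset[of ?K] lookup_add distrib_right sum.distrib)
qed

lemma fischer_additive_right: "additive (fischer F)"
  by (simp add: additive_def fischer_def lookup_add distrib_left distrib_right sum.distrib)

lemma fischer_scale_right: "fischer F (scale c G) = c * fischer F G"
  by (simp add: fischer_def lookup_scale sum_distrib_left mult_ac)

lemma expo_diff_unit_eq_iff:
  assumes "Poly_Mapping.lookup \<kappa> (k, a) \<noteq> 0"
  shows "\<kappa> - unit_expo k a = \<mu> \<longleftrightarrow> \<kappa> = \<mu> + unit_expo k a"
proof -
  have "\<kappa> - unit_expo k a + unit_expo k a = \<kappa>"
    using assms by (intro poly_mapping_eqI) (auto simp: lookup_add lookup_minus lookup_single when_def)
  then show ?thesis by (metis add_diff_cancel_right')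
qed

lemma lookup_dz: "Poly_Mapping.lookup (dz k a F) (\<mu>, \<nu>, A) =
    of_nat (Poly_Mapping.lookup \<mu> (k, a) + 1) * Poly_Mapping.lookup F (\<mu> + unit_expo k a, \<nu>, A)"
proof (rule additive_eqI[where u = F])
  fix b :: pidx and c :: complex
  obtain \<mu>' \<nu>' A' where b: "b = (\<mu>', \<nu>', A')" by (cases b)
  show "Poly_Mapping.lookup (dz k a (Poly_Mapping.single b c)) (\<mu>, \<nu>, A) =
    of_nat (Poly_Mapping.lookup \<mu> (k, a) + 1) * Poly_Mapping.lookup (Poly_Mapping.single b c) (\<mu> + unit_expo k a, \<nu>, A)"
  proof (cases "Poly_Mapping.lookup \<mu>' (k, a) = 0")
    case True
    then have "\<mu>' \<noteq> \<mu> + unit_expo k a" by (auto simp: lookup_add)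
    with True show ?thesis by (simp add: b dz_single lookup_single when_def)
  next
    case False
    then have "\<mu>' - unit_expo k a = \<mu> \<longleftrightarrow> \<mu>' = \<mu> + unit_expo k a"
      by (rule expo_diff_unit_eq_iff)
    then show ?thesis by (auto simp: b dz_single lookup_single when_def lookup_add mult_ac)
  qed
qed (simp_all add: additive_def basic_add lookup_add distrib_left)

lemma lookup_zmult: "Poly_Mapping.lookup (zmult k a F) (\<mu>, \<nu>, A) =
    (if Poly_Mapping.lookup \<mu> (k, a) = 0 then 0 else Poly_Mapping.lookup F (\<mu> - unit_expo k a, \<nu>, A))"
proof (rule additive_eqI[where u = F])
  fix b :: pidx and c :: complex
  obtain \<mu>' \<nu>' A' where b: "b = (\<mu>', \<nu>', A')" by (cases b)
  show "Poly_Mapping.lookup (zmult k a (Poly_Mapping.single b c)) (\<mu>, \<nu>, A) =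
    (if Poly_Mapping.lookup \<mu> (k, a) = 0 then 0 else Poly_Mapping.lookup (Poly_Mapping.single b c) (\<mu> - unit_expo k a, \<nu>, A))"
  proof (cases "Poly_Mapping.lookup \<mu> (k, a) = 0")
    case True
    then have "\<mu>' + unit_expo k a \<noteq> \<mu>" by (auto simp: lookup_add)
    with True show ?thesis by (simp add: b zmult_single lookup_single when_def)
  next
    case False
    then have "\<mu>' + unit_expo k a = \<mu> \<longleftrightarrow> \<mu>' = \<mu> - unit_expo k a"
      using expo_diff_unit_eq_iff by metis
    with False show ?thesis by (auto simp: b zmult_single lookup_single when_def)
  qed
qed (simp_all add: additive_def basic_add lookup_add distrib_left)

text \<open>Raising one exponent multiplies the factorial weight by the new exponent, and this is
  exactly the factor that the derivative produces.\<close>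

lemma fischer_adjoint: "fischer (zmult k a F) G = fischer F (dz k a G)"
proof (rule additive_eqI[where u = F])
  fix b :: pidx and c :: complex
  obtain \<mu> \<nu> A where b: "b = (\<mu>, \<nu>, A)" by (cases b)
  show "fischer (zmult k a (Poly_Mapping.single b c)) G = fischer (Poly_Mapping.single b c) (dz k a G)"
    by (simp add: b zmult_single fischer_def lookup_dz expo_fact_add_unit[simplified] mult_ac)
qed (simp_all add: fischer_additive_left additive_comp[OF fischer_additive_left additive_basic(2)])

lemma fischer_norm: "fischer F F = of_real (\<Sum>b\<in>Poly_Mapping.keys F. (cmod (Poly_Mapping.lookup F b))\<^sup>2 * expo_fact (fst b))"
  unfolding fischer_def of_real_sum of_real_mult complex_norm_square
  by (simp add: mult_ac)

lemma fischer_nonneg: "0 \<le> Re (fischer F F)"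
  unfolding fischer_norm by (auto intro!: sum_nonneg mult_nonneg_nonneg simp: expo_fact_pos less_imp_le)

lemma fischer_eq_0: "Re (fischer F F) = 0 \<Longrightarrow> F = 0"
proof (rule ccontr)
  assume "Re (fischer F F) = 0" "F \<noteq> 0"
  then obtain b where b: "b \<in> Poly_Mapping.keys F" by (meson ex_in_conv keys_eq_empty)
  have "0 < (\<Sum>b\<in>Poly_Mapping.keys F. (cmod (Poly_Mapping.lookup F b))\<^sup>2 * expo_fact (fst b))"
    by (rule sum_pos2[OF _ b])
      (use b in \<open>auto intro!: mult_nonneg_nonneg mult_pos_pos simp: expo_fact_pos less_imp_le in_keys_iff\<close>)
  with \<open>Re (fischer F F) = 0\<close> show False by (simp add: fischer_norm)
qed

text \<open>
  The matrix \<open>(z\<^sub>i\<^sub>a)\<close> has trivial kernel: in the part of highest degree in the diagonal variables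
  the equation reduces to \<open>z\<^sub>a\<^sub>a u\<^sub>a = 0\<close>.
\<close>

lemma zmult_matrix_injective:
  assumes ker: "\<And>a. a < N \<Longrightarrow> (\<Sum>i<N. zmult i a (u i)) = 0" and "i < N"
  shows "u i = 0"
proof (rule ccontr)
  assume "u i \<noteq> 0"
  define T where "T = (\<Union>i<N. Pair i ` Poly_Mapping.keys (u i))"
  define d where "d = (\<lambda>x :: nat \<times> pidx. \<Sum>k<N. Poly_Mapping.lookup (fst (snd x)) (k, k))"
  have "finite T" by (simp add: T_def)
  moreover have "T \<noteq> {}"
    using \<open>u i \<noteq> 0\<close> \<open>i < N\<close> by (auto simp: T_def)
  ultimately have "Max (d ` T) \<in> d ` T" by (intro Max_in) auto
  then obtain x where "x \<in> T" and "d x = Max (d ` T)" by auto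
  then have max: "d y \<le> d x" if "y \<in> T" for y
    using that \<open>finite T\<close> by simp
  obtain p \<mu> \<nu> A where x: "x = (p, \<mu>, \<nu>, A)" by (cases x)
  have p: "p < N" and nz: "Poly_Mapping.lookup (u p) (\<mu>, \<nu>, A) \<noteq> 0"
    using \<open>x \<in> T\<close> by (auto simp: T_def x in_keys_iff)
  \<comment> \<open>A contribution of \<open>u j\<close> to this coefficient would come from a
    monomial in which one \<open>z_pp\<close> is gained and one \<open>z_jp\<close> is lost. The
    latter is off the diagonal, so the diagonal degree would exceed the maximum by one.\<close>
  have other: "Poly_Mapping.lookup (zmult j p (u j)) (\<mu> + unit_expo p p, \<nu>, A) = 0" if "j < N" "j \<noteq> p" for j
  proof (rule ccontr)
    assume "Poly_Mapping.lookup (zmult j p (u j)) (\<mu> + unit_expo p p, \<nu>, A) \<noteq> 0"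
    then have "(j, \<mu> + unit_expo p p - unit_expo j p, \<nu>, A) \<in> T"
      using that unfolding T_def
      by (intro UN_I[of j] imageI) (auto simp: lookup_zmult in_keys_iff split: if_splits)
    from max[OF this] have "(\<Sum>k<N. Poly_Mapping.lookup (\<mu> + unit_expo p p - unit_expo j p) (k, k)) \<le> (\<Sum>k<N. Poly_Mapping.lookup \<mu> (k, k))"
      by (simp add: d_def x)
    moreover have "(\<Sum>k<N. Poly_Mapping.lookup \<mu> (k, k)) < (\<Sum>k<N. Poly_Mapping.lookup (\<mu> + unit_expo p p - unit_expo j p) (k, k))"
      by (rule sum_strict_mono_ex1)
        (use p that in \<open>auto simp: lookup_add lookup_minus lookup_single when_def intro!: bexI[of _ p]\<close>)
    ultimately show False by simp
  qed
  have "0 = Poly_Mapping.lookup (\<Sum>j<N. zmult j p (u j)) (\<mu> + unit_expo p p, \<nu>, A)"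
    using ker[OF p] by simp
  also have "\<dots> = (\<Sum>j<N. if j = p then Poly_Mapping.lookup (zmult j p (u j)) (\<mu> + unit_expo p p, \<nu>, A) else 0)"
    unfolding lookup_sum by (rule sum.cong) (use other in auto)
  also have "\<dots> = Poly_Mapping.lookup (u p) (\<mu>, \<nu>, A)"
    using p by (simp add: lookup_zmult lookup_add)
  finally show False using nz by simp
qed

text \<open>Pairing the \<open>i\<close>-th equation with \<open>u i\<close> and summing gives the
  squared norms of all \<open>P a\<close> plus \<open>t\<close> times those of all
  \<open>u i\<close>. Nothing is negative, so every \<open>P a\<close> vanishes and the trivial
  kernel applies; \<open>N \<le> m\<close> guarantees that the diagonal variables occur among the
  columns \<open>a < m\<close>. The value \<open>t = 0\<close> yields uniqueness of solutions,
  \<open>t = 1\<close> the vanishing of the anticommutators.\<close>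

lemma Cz_positive_injective:
  fixes t :: real
  assumes "N \<le> m" "0 \<le> t"
    and eq: "\<And>i. i < N \<Longrightarrow> (\<Sum>j<N. Cz_entry m i j (u j)) + scale (of_real t) (u i) = 0"
    and "i < N"
  shows "u i = 0"
proof -
  define P where "P = (\<lambda>a. \<Sum>i<N. zmult i a (u i))"
  note fl = additive.sum[OF fischer_additive_left] and fr = additive.sum[OF fischer_additive_right]
  have "0 = fischer (u i) ((\<Sum>j<N. Cz_entry m i j (u j)) + scale (of_real t) (u i))" if "i < N" for i
    using eq[OF that] additive.zero[OF fischer_additive_right] by simp
  then have "0 = (\<Sum>i<N. fischer (u i) ((\<Sum>j<N. Cz_entry m i j (u j)) + scale (of_real t) (u i)))"
    by simp
  also have "\<dots> = (\<Sum>i<N. \<Sum>j<N. \<Sum>a<m. fischer (zmult i a (u i)) (zmult j a (u j))) + (\<Sum>i<N. of_real t * fischer (u i) (u i))"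
    by (simp add: Cz_entry_normal additiveD[OF fischer_additive_right] fr fischer_scale_right fischer_adjoint sum.distrib)
  also have "(\<Sum>i<N. \<Sum>j<N. \<Sum>a<m. fischer (zmult i a (u i)) (zmult j a (u j))) = (\<Sum>a<m. fischer (P a) (P a))"
    unfolding P_def fl fr by (simp only: sum.swap[of _ "{..<m}" "{..<N}"]) (rule sum.cong[OF refl], rule sum.swap)
  finally have "0 = Re ((\<Sum>a<m. fischer (P a) (P a)) + (\<Sum>i<N. of_real t * fischer (u i) (u i)))"
    by simp
  then have "0 = (\<Sum>a<m. Re (fischer (P a) (P a))) + (\<Sum>i<N. t * Re (fischer (u i) (u i)))"
    by simp
  moreover have "0 \<le> (\<Sum>a<m. Re (fischer (P a) (P a)))" "0 \<le> (\<Sum>i<N. t * Re (fischer (u i) (u i)))"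
    using \<open>0 \<le> t\<close> by (auto intro!: sum_nonneg mult_nonneg_nonneg fischer_nonneg)
  ultimately have "(\<Sum>a<m. Re (fischer (P a) (P a))) = 0" by linarith
  then have "P a = 0" if "a < m" for a
    using that by (subst (asm) sum_nonneg_eq_0_iff) (auto simp: fischer_nonneg intro: fischer_eq_0)
  then show ?thesis
    using \<open>N \<le> m\<close> \<open>i < N\<close> by (intro zmult_matrix_injective[of N u]) (auto simp: P_def)
qed

lemma Cz_unique:
  assumes "N \<le> m" "\<And>i. i < N \<Longrightarrow> (\<Sum>j<N. Cz_entry m i j (u j)) = (\<Sum>j<N. Cz_entry m i j (v j))" "i < N"
  shows "u i = v i"
proof -
  have "(\<Sum>j<N. Cz_entry m i j (u j - v j)) + scale (of_real 0) (u i - v i) = 0" if "i < N" for i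
    using assms(2)[OF that] by (simp add: capelli_diff sum_subtractf)
  from Cz_positive_injective[OF assms(1) order_refl this assms(3)] show ?thesis by simp
qed

section \<open>Surjectivity of the Capelli matrix from finite-dimensional invariant
  subspaces\<close>

lemma (in vector_space) injective_on_finite_dim_imp_surjective:
  assumes lin: "Vector_Spaces.linear scale scale T"
    and W: "subspace W" "finite K" "W \<subseteq> span K" and maps: "T ` W \<subseteq> W" and inj: "inj_on T W"
  shows "W \<subseteq> T ` W"
proof
  interpret T: Vector_Spaces.linear scale scale T by (rule lin)
  interpret p: vector_space_pair scale scale ..
  fix w assume "w \<in> W"
  obtain B where B: "B \<subseteq> W" "independent B" "W \<subseteq> span B"
    by (rule maximal_independent_subset)
  then have span_B: "span B = W"
    using span_minimal[OF B(1) W(1)] by blast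
  have fin: "finite B"
    using independent_span_bound[OF W(2) B(2)] B(1) W(3) by blast
  have ind: "independent (T ` B)"
    using p.linear_independent_injective_image[OF lin B(2)] inj by (simp add: span_B)
  have card: "card (T ` B) = card B"
    using inj B(1) by (intro card_image) (rule inj_on_subset)
  \<comment> \<open>Otherwise adding \<open>w\<close> to the image of the basis would give an
    independent subset of \<open>span B\<close> with one element more than \<open>B\<close>.\<close>
  have "w \<in> span (T ` B)"
  proof (rule ccontr)
    assume w: "w \<notin> span (T ` B)"
    with ind have "independent (insert w (T ` B))" by (rule independent_insertI[rotated])
    moreover have "insert w (T ` B) \<subseteq> span B"
      using \<open>w \<in> W\<close> B(1) maps by (auto simp: span_B)
    ultimately have "card (insert w (T ` B)) \<le> card B"
      using independent_span_bound[OF fin] by blast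
    moreover have "w \<notin> T ` B" using w span_superset by blast
    ultimately show False using card fin by simp
  qed
  then show "w \<in> T ` W"
    using T.span_image[of B] span_B by simp
qed

definition cscale :: "complex \<Rightarrow> (nat \<Rightarrow> pcl) \<Rightarrow> nat \<Rightarrow> pcl" where
  "cscale c u = (\<lambda>i. scale c (u i))"

interpretation col: vector_space cscale
  by standard (simp_all add: cscale_def fun_eq_iff scale_add scale_add_left scale_scale)

lemma sum_fun_apply: "(\<Sum>x\<in>X. f x) i = (\<Sum>x\<in>X. f x i :: 'b::comm_monoid_add)"
  by (induction X rule: infinite_finite_induct) simp_all

lemma Cz_linear: "Vector_Spaces.linear cscale cscale (Cz m N)"
proof -
  interpret vector_space_pair cscale cscale ..
  show ?thesis
    by unfold_locales
      (simp_all add: Cz_def cscale_def fun_eq_iff capelli_add sum.distrib Cz_entry_scale scale_sum)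
qed

definition edeg :: "nat \<Rightarrow> nat \<Rightarrow> expo \<Rightarrow> nat" where
  "edeg m N \<mu> = (\<Sum>v\<in>{..<N} \<times> {..<m}. Poly_Mapping.lookup \<mu> v)"

lemma finite_bounded_expo: "finite {\<mu>. Poly_Mapping.keys \<mu> \<subseteq> {..<N} \<times> {..<m} \<and> edeg m N \<mu> \<le> d}"
proof -
  let ?X = "{..<N} \<times> {..<m}"
  have "finite {f :: nat \<times> nat \<Rightarrow> nat. \<forall>x. (x \<in> ?X \<longrightarrow> f x \<in> {..d}) \<and> (x \<notin> ?X \<longrightarrow> f x = 0)}"
    by (rule finite_set_of_finite_funs) auto
  then have "finite (Poly_Mapping.lookup -` {f. \<forall>x. (x \<in> ?X \<longrightarrow> f x \<in> {..d}) \<and> (x \<notin> ?X \<longrightarrow> f x = 0)} :: expo set)"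
    by (rule finite_vimageI) (simp add: inj_on_def poly_mapping.lookup_inject)
  then show ?thesis
  proof (rule finite_subset[rotated], intro subsetI vimageI2 CollectI allI)
    fix \<mu> :: expo and x
    assume "\<mu> \<in> {\<mu>. Poly_Mapping.keys \<mu> \<subseteq> ?X \<and> edeg m N \<mu> \<le> d}"
    then have \<mu>: "Poly_Mapping.keys \<mu> \<subseteq> ?X" "edeg m N \<mu> \<le> d" by auto
    have "Poly_Mapping.lookup \<mu> x \<le> edeg m N \<mu>" if "x \<in> ?X"
      unfolding edeg_def using that by (intro member_le_sum) auto
    with \<mu> show "(x \<in> ?X \<longrightarrow> Poly_Mapping.lookup \<mu> x \<in> {..d}) \<and> (x \<notin> ?X \<longrightarrow> Poly_Mapping.lookup \<mu> x = 0)"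
      by (meson atMost_iff in_keys_iff order_trans subsetD)
  qed
qed

text \<open>The Capelli matrix preserves the holomorphic degree and does not touch the
  antiholomorphic exponent, which may therefore be confined to any finite set \<open>V\<close>.
  Bounding the degree instead of fixing it avoids a splitting into homogeneous parts.\<close>

definition bounded_basis :: "nat \<Rightarrow> nat \<Rightarrow> nat \<Rightarrow> expo set \<Rightarrow> pidx set" where
  "bounded_basis m N d V = {(\<mu>, \<nu>, A) \<in> PCl_basis m N. edeg m N \<mu> \<le> d \<and> \<nu> \<in> V}"

lemma finite_bounded_basis:
  assumes "finite V"
  shows "finite (bounded_basis m N d V)"
proof (rule finite_subset)
  show "bounded_basis m N d V \<subseteq> {\<mu>. Poly_Mapping.keys \<mu> \<subseteq> {..<N} \<times> {..<m} \<and> edeg m N \<mu> \<le> d} \<times> V \<times> Pow {..<2*m}"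
    by (auto simp: bounded_basis_def PCl_basis_def)
  show "finite ({\<mu>. Poly_Mapping.keys \<mu> \<subseteq> {..<N} \<times> {..<m} \<and> edeg m N \<mu> \<le> d} \<times> V \<times> Pow {..<2*m})"
    using assms finite_bounded_expo by simp
qed

lemma keys_additive_subset:
  assumes "additive f" "\<And>b c. b \<in> Poly_Mapping.keys F \<Longrightarrow> Poly_Mapping.keys (f (Poly_Mapping.single b c)) \<subseteq> K"
  shows "Poly_Mapping.keys (f F :: 'j \<Rightarrow>\<^sub>0 'r::ab_group_add) \<subseteq> K"
proof (induction F rule: single_add_induct)
  case zero
  show ?case using assms(1) by (simp add: additive.zero)
next
  case (add v w)
  then show ?case
    using keys_add[of "f v" "f w"] by (simp add: additiveD[OF assms(1)]) blast
qed (rule assms(2))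

lemma edeg_swap:
  assumes "i < N" "j < N" "a < m" "Poly_Mapping.lookup \<mu> (i, a) \<noteq> 0"
  shows "edeg m N (\<mu> - unit_expo i a + unit_expo j a) = edeg m N \<mu>"
proof -
  have unit: "edeg m N (unit_expo k a) = 1" if "k < N" for k
    using that assms(3) by (simp add: edeg_def lookup_single when_def)
  have add: "edeg m N (\<kappa> + \<kappa>') = edeg m N \<kappa> + edeg m N \<kappa>'" for \<kappa> \<kappa>'
    by (simp add: edeg_def lookup_add sum.distrib)
  have "\<mu> - unit_expo i a + unit_expo i a = \<mu>"
    using expo_diff_unit_eq_iff[OF assms(4)] by metis
  then have "edeg m N (\<mu> - unit_expo i a) + 1 = edeg m N \<mu>"
    using add[of "\<mu> - unit_expo i a" "unit_expo i a"] unit[OF assms(1)] by simp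
  then show ?thesis
    by (simp only: add unit assms)
qed

text \<open>\<open>Ez m j i\<close> trades a factor \<open>z_ia\<close> for a factor
  \<open>z_ja\<close>, which keeps the total holomorphic degree, the antiholomorphic exponent and
  the Clifford set.\<close>

lemma Cz_entry_bounded_basis:
  assumes "i < N" "j < N" "Poly_Mapping.keys F \<subseteq> bounded_basis m N d V"
  shows "Poly_Mapping.keys (Cz_entry m i j F) \<subseteq> bounded_basis m N d V"
proof (rule keys_additive_subset[OF additive_capelli(3)])
  fix b c
  assume b: "b \<in> Poly_Mapping.keys F"
  obtain \<mu> \<nu> A where bb: "b = (\<mu>, \<nu>, A)" by (cases b)
  have mem: "(\<mu>, \<nu>, A) \<in> bounded_basis m N d V" using b assms(3) bb by auto
  have E: "Poly_Mapping.keys (zmult j a (dz i a (Poly_Mapping.single b c))) \<subseteq> bounded_basis m N d V"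
    if "a < m" for a
  proof (cases "Poly_Mapping.lookup \<mu> (i, a) = 0")
    case False
    have "Poly_Mapping.keys (\<mu> - unit_expo i a + unit_expo j a) \<subseteq> {..<N} \<times> {..<m}"
      using keys_add[of "\<mu> - unit_expo i a" "unit_expo j a"] keys_minus_nat_subset[of \<mu> "unit_expo i a"]
        mem assms that by (auto simp: bounded_basis_def PCl_basis_def)
    with mem show ?thesis
      using edeg_swap[OF assms(1,2) that False]
      by (auto simp: bb dz_single zmult_single bounded_basis_def PCl_basis_def)
  qed (simp add: bb dz_single zmult_single)
  have S: "Poly_Mapping.keys (Poly_Mapping.single b k) \<subseteq> bounded_basis m N d V" for k :: complex
    using mem by (simp add: bb)
  have "Poly_Mapping.keys (Ez m j i (Poly_Mapping.single b c)) \<subseteq> bounded_basis m N d V"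
    unfolding Ez_def by (intro keys_sum_subset E) simp
  moreover have "Poly_Mapping.keys (if i = j then scale (of_nat m) (Poly_Mapping.single b c) else 0) \<subseteq> bounded_basis m N d V"
    using S[of "of_nat m * c"] by (cases "i = j") (simp_all only: scale_single if_True if_False refl keys_zero empty_subsetI)
  ultimately show "Poly_Mapping.keys (Cz_entry m i j (Poly_Mapping.single b c)) \<subseteq> bounded_basis m N d V"
    unfolding Cz_entry_def
    using keys_add[of "if i = j then scale (of_nat m) (Poly_Mapping.single b c) else 0" "Ez m j i (Poly_Mapping.single b c)"]
    by blast
qed

lemma Cz_inj_on_cols:
  assumes "N \<le> m"
  shows "inj_on (Cz m N) (cols m N)"
proof (rule inj_onI, rule ext)
  fix u v i
  assume uv: "u \<in> cols m N" "v \<in> cols m N" "Cz m N u = Cz m N v"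
  have "(\<Sum>j<N. Cz_entry m i j (u j)) = (\<Sum>j<N. Cz_entry m i j (v j))" if "i < N" for i
    using fun_cong[OF uv(3), of i] that by (simp add: Cz_def)
  from Cz_unique[OF assms this] uv(1,2) show "u i = v i"
    by (cases "i < N") (auto simp: cols_def)
qed

text \<open>A given column involves only finitely many monomials. The columns over a suitable
  \<open>bounded_basis\<close> form a finite-dimensional invariant space containing it, where
  injectivity implies surjectivity.\<close>

lemma Cz_surj_on_cols:
  assumes "N \<le> m" "v \<in> cols m N"
  shows "v \<in> Cz m N ` cols m N"
proof -
  define R where "R = (\<Union>i<N. Poly_Mapping.keys (v i))"
  \<comment> \<open>Inserting 0 keeps \<open>Max\<close> meaningful for the zero column, where
    \<open>R\<close> is empty.\<close>
  define d where "d = Max (insert 0 ((\<lambda>b. edeg m N (fst b)) ` R))"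
  define V where "V = (\<lambda>b. fst (snd b)) ` R"
  define B where "B = bounded_basis m N d V"
  define W where "W = {u :: nat \<Rightarrow> pcl. (\<forall>i<N. Poly_Mapping.keys (u i) \<subseteq> B) \<and> (\<forall>i\<ge>N. u i = 0)}"
  define K where "K = (\<lambda>(p, b) i. if i = p then Poly_Mapping.single b (1 :: complex) else 0) ` ({..<N} \<times> B)"
  have "finite R" by (simp add: R_def)
  have finB: "finite B"
    unfolding B_def by (rule finite_bounded_basis) (simp add: V_def \<open>finite R\<close>)
  have W_cols: "W \<subseteq> cols m N"
    by (auto simp: W_def cols_def PCl_def B_def bounded_basis_def)
  have "v \<in> W"
  proof -
    have "b \<in> B" if "b \<in> R" for b
    proof -
      have "b \<in> PCl_basis m N"
        using that assms(2) by (auto simp: R_def cols_def PCl_def)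
      moreover have "edeg m N (fst b) \<le> d"
        unfolding d_def using that \<open>finite R\<close> by (intro Max_ge) auto
      moreover have "fst (snd b) \<in> V" using that by (simp add: V_def)
      ultimately show ?thesis
        by (cases b) (simp add: B_def bounded_basis_def)
    qed
    then have "Poly_Mapping.keys (v i) \<subseteq> B" if "i < N" for i
      using that by (auto simp: R_def)
    then show ?thesis
      using assms(2) by (auto simp: W_def cols_def)
  qed
  moreover have "W \<subseteq> Cz m N ` W"
  proof (rule col.injective_on_finite_dim_imp_surjective[OF Cz_linear])
    show "col.subspace W"
      unfolding col.subspace_def W_def cscale_def
      using keys_add keys_scale_subset by (fastforce simp: subset_iff)
    show "finite K" using finB by (simp add: K_def)
    show "W \<subseteq> col.span K"
    proof
      fix u assume u: "u \<in> W"
      have "u = (\<Sum>p<N. \<Sum>b\<in>B. cscale (Poly_Mapping.lookup (u p) b) (\<lambda>i. if i = p then Poly_Mapping.single b 1 else 0))"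
      proof
        fix i
        have "(\<Sum>p<N. \<Sum>b\<in>B. cscale (Poly_Mapping.lookup (u p) b) (\<lambda>i. if i = p then Poly_Mapping.single b 1 else 0)) i
          = (\<Sum>p<N. if p = i then \<Sum>b\<in>B. Poly_Mapping.single b (Poly_Mapping.lookup (u i) b) else 0)"
          unfolding sum_fun_apply cscale_def by (intro sum.cong refl) (auto simp: scale_single)
        also have "\<dots> = u i"
        proof (cases "i < N")
          case True
          then have "Poly_Mapping.keys (u i) \<subseteq> B" using u by (simp add: W_def)
          then have "(\<Sum>b\<in>B. Poly_Mapping.single b (Poly_Mapping.lookup (u i) b)) = (\<Sum>b\<in>Poly_Mapping.keys (u i). Poly_Mapping.single b (Poly_Mapping.lookup (u i) b))"
            by (intro sum.mono_neutral_right finB) (auto simp: in_keys_iff)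
          with True show ?thesis using sum_singles[of "u i"] by simp
        qed (use u in \<open>simp add: W_def\<close>)
        finally show "u i = (\<Sum>p<N. \<Sum>b\<in>B. cscale (Poly_Mapping.lookup (u p) b) (\<lambda>i. if i = p then Poly_Mapping.single b 1 else 0)) i"
          by simp
      qed
      also have "\<dots> \<in> col.span K"
        by (intro col.span_sum col.span_scale col.span_base) (force simp: K_def)
      finally show "u \<in> col.span K" .
    qed
    show "Cz m N ` W \<subseteq> W"
    proof (rule image_subsetI)
      fix u assume u: "u \<in> W"
      have "Poly_Mapping.keys (\<Sum>j<N. Cz_entry m i j (u j)) \<subseteq> B" if "i < N" for i
        unfolding B_def
        by (intro keys_sum_subset Cz_entry_bounded_basis) (use u that in \<open>simp_all add: W_def B_def\<close>)
      then show "Cz m N u \<in> W" by (simp add: W_def Cz_def)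
    qed
    show "inj_on (Cz m N) W"
      using Cz_inj_on_cols[OF assms(1)] W_cols by (rule inj_on_subset)
  qed
  ultimately show ?thesis using W_cols by blast
qed

section \<open>The transported contractions\<close>

text \<open>Each summand of \<open>n_plus\<close> is an entry of the preimage of a column with a
  single nonzero component; by additivity these preimages add up to a solution of the full system.
  All later facts about \<open>n_plus\<close> rest on this system and on uniqueness of its
  solution.\<close>

lemma n_plus_solves:
  assumes "N \<le> m" "F \<in> PCl m N"
  shows "i < N \<Longrightarrow> n_plus m N i F \<in> PCl m N"
    and "i < N \<Longrightarrow> (\<Sum>j<N. Cz_entry m i j (n_plus m N j F)) = s_op m i F"
proof -
  define g where "g = (\<lambda>l. inv_into (cols m N) (Cz m N) (\<lambda>k. if k = l then s_op m l F else 0))"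
  have e: "(\<lambda>k. if k = l then s_op m l F else 0) \<in> Cz m N ` cols m N" if "l < N" for l
    using that assms by (intro Cz_surj_on_cols) (auto simp: cols_def PCl_closed capelli_in_PCl)
  have g_cols: "g l \<in> cols m N" if "l < N" for l
    using inv_into_into[OF e[OF that]] by (simp add: g_def)
  have Cg: "Cz m N (g l) = (\<lambda>k. if k = l then s_op m l F else 0)" if "l < N" for l
    using f_inv_into_f[OF e[OF that]] by (simp add: g_def)
  have n: "n_plus m N i F = (\<Sum>l<N. g l i)" for i
    by (simp add: n_plus_def Cz_inv_entry_def g_def)
  show "n_plus m N i F \<in> PCl m N" if "i < N"
    unfolding n using g_cols that by (intro PCl_closed) (auto simp: cols_def)
  show "(\<Sum>j<N. Cz_entry m i j (n_plus m N j F)) = s_op m i F" if "i < N"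
  proof -
    have "(\<Sum>j<N. Cz_entry m i j (n_plus m N j F)) = (\<Sum>l<N. \<Sum>j<N. Cz_entry m i j (g l j))"
      unfolding n capelli_sum by (rule sum.swap)
    also have "\<dots> = (\<Sum>l<N. Cz m N (g l) i)"
      using that by (simp add: Cz_def)
    also have "\<dots> = (\<Sum>l<N. if i = l then s_op m l F else 0)"
      by (rule sum.cong) (simp_all add: Cg)
    finally show ?thesis using that by simp
  qed
qed

lemma n_plus_unique:
  assumes "N \<le> m" "F \<in> PCl m N" "\<And>i. i < N \<Longrightarrow> (\<Sum>j<N. Cz_entry m i j (v j)) = s_op m i F" "j < N"
  shows "n_plus m N j F = v j"
  by (rule Cz_unique[OF assms(1) _ assms(4)]) (simp add: n_plus_solves assms)

text \<open>
  Operators commuting with \<open>\<C>\<^sub>z\<close> and commuting up to a factor with all \<open>\<s>\<^sub>i\<close> inherit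
  the same relation with all \<open>\<n>\<^sub>i\<^sup>+\<close>, as \<open>\<n>\<^sup>+\<close> is the unique solution of \<open>\<C>\<^sub>z \<n>\<^sup>+ = \<s>\<close>.
\<close>

lemma n_plus_intertwine:
  assumes "N \<le> m" "additive X" "F \<in> PCl m N" "X F \<in> PCl m N"
    and C: "\<And>i j G. i < N \<Longrightarrow> j < N \<Longrightarrow> G \<in> PCl m N \<Longrightarrow> X (Cz_entry m i j G) = Cz_entry m i j (X G)"
    and s: "\<And>i. i < N \<Longrightarrow> X (s_op m i F) = scale e (s_op m i (X F))"
    and "k < N"
  shows "X (n_plus m N k F) = scale e (n_plus m N k (X F))"
proof -
  have "(\<Sum>j<N. Cz_entry m i j (X (n_plus m N j F))) = (\<Sum>j<N. Cz_entry m i j (scale e (n_plus m N j (X F))))"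
    if "i < N" for i
  proof -
    have "(\<Sum>j<N. Cz_entry m i j (X (n_plus m N j F))) = X (\<Sum>j<N. Cz_entry m i j (n_plus m N j F))"
      unfolding additive.sum[OF assms(2)]
      by (rule sum.cong) (use that assms(1,3) in \<open>simp_all add: C n_plus_solves\<close>)
    also have "\<dots> = scale e (s_op m i (X F))"
      using that assms by (simp add: n_plus_solves)
    also have "\<dots> = (\<Sum>j<N. Cz_entry m i j (scale e (n_plus m N j (X F))))"
      using that assms(1,4) by (simp add: Cz_entry_scale n_plus_solves flip: scale_sum)
    finally show ?thesis .
  qed
  from Cz_unique[OF assms(1) this assms(7)] show ?thesis .
qed

lemma n_plus_add:
  assumes "N \<le> m" "F \<in> PCl m N" "G \<in> PCl m N" "j < N"
  shows "n_plus m N j (F + G) = n_plus m N j F + n_plus m N j G"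
  by (rule n_plus_unique)
    (use assms in \<open>simp_all add: PCl_closed capelli_add sum.distrib n_plus_solves\<close>)

lemma n_plus_scale:
  assumes "N \<le> m" "F \<in> PCl m N" "j < N"
  shows "n_plus m N j (scale c F) = scale c (n_plus m N j F)"
  by (rule n_plus_unique)
    (use assms in \<open>simp_all add: PCl_closed Cz_entry_scale s_op_scale n_plus_solves flip: scale_sum\<close>)

section \<open>Commutation relations of the contractions\<close>

lemma Cz_entry_Ez: "Cz_entry m i j F = Ez m j i F + (if i = j then scale (of_nat m) F else 0)"
  by (simp add: Cz_entry_def add.commute)

text \<open>The contractions transform under gl_N as a vector. The corrected column is checked to
  solve the system with right-hand side \<open>s_op\<close> of \<open>Ez m p q F\<close>, and
  uniqueness identifies it.\<close>

lemma Ez_n_plus: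
  assumes "N \<le> m" "F \<in> PCl m N" "p < N" "q < N" "j < N"
  shows "Ez m p q (n_plus m N j F) = n_plus m N j (Ez m p q F) - (if j = p then n_plus m N q F else 0)"
proof -
  let ?n = "\<lambda>j. n_plus m N j F"
  have "n_plus m N j (Ez m p q F) = Ez m p q (?n j) + (if j = p then ?n q else 0)"
  proof (rule n_plus_unique[OF assms(1) _ _ assms(5)])
    show "Ez m p q F \<in> PCl m N" using assms by (intro capelli_in_PCl)
    fix i assume i: "i < N"
    have sol: "(\<Sum>j<N. Cz_entry m k j (?n j)) = s_op m k F" if "k < N" for k
      using n_plus_solves(2)[OF assms(1,2) that] .
    have "(\<Sum>j<N. Cz_entry m i j (Ez m p q (?n j) + (if j = p then ?n q else 0)))
      = (\<Sum>j<N. Ez m p q (Cz_entry m i j (?n j)) - (if q = j then Ez m p i (?n j) else 0)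
          + (if i = p then Ez m j q (?n j) else 0) + (if j = p then Cz_entry m i j (?n q) else 0))"
      by (intro sum.cong refl) (simp add: capelli_add E_C)
    also have "\<dots> = Ez m p q (s_op m i F) - Ez m p i (?n q) + (if i = p then \<Sum>j<N. Ez m j q (?n j) else 0) + Cz_entry m i p (?n q)"
      using assms(3,4) sol[OF i]
      by (simp add: sum.distrib sum_subtractf flip: capelli_sum)
    \<comment> \<open>This is row \<open>q\<close> of the system, with the diagonal constant
      \<open>m\<close> moved to the other side.\<close>
    also have "(\<Sum>j<N. Ez m j q (?n j)) = s_op m q F - scale (of_nat m) (?n q)"
      using sol[OF assms(4)] assms(4) by (simp add: Cz_entry_Ez sum.distrib eq_diff_eq)
    also have "Ez m p q (s_op m i F) - Ez m p i (?n q)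
        + (if i = p then s_op m q F - scale (of_nat m) (?n q) else 0) + Cz_entry m i p (?n q) = s_op m i (Ez m p q F)"
      by (simp add: Cz_entry_Ez s_E)
    finally show "(\<Sum>j<N. Cz_entry m i j (Ez m p q (?n j) + (if j = p then ?n q else 0))) = s_op m i (Ez m p q F)" .
  qed
  then show ?thesis by simp
qed

text \<open>If \<open>s_op\<close> commuted with the Capelli matrix, it would simply anticommute
  with the contractions. The commutator with column \<open>l\<close> of the matrix adds
  \<open>s_op m i\<close> applied to the \<open>l\<close>-th contraction, and solving the system for
  this term yields the extra \<open>n_plus m N l F\<close>.\<close>

lemma s_n_plus:
  assumes "N \<le> m" "F \<in> PCl m N" "l < N" "j < N"
  shows "s_op m l (n_plus m N j F) = - n_plus m N j (s_op m l F + n_plus m N l F)"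
proof -
  have "n_plus m N j (s_op m l F + n_plus m N l F) = - s_op m l (n_plus m N j F)"
  proof (rule n_plus_unique[OF assms(1) _ _ assms(4)])
    show "s_op m l F + n_plus m N l F \<in> PCl m N"
      using assms by (intro PCl_closed capelli_in_PCl n_plus_solves)
    fix i assume i: "i < N"
    have "(\<Sum>j<N. Cz_entry m i j (- s_op m l (n_plus m N j F)))
      = (\<Sum>j<N. (if j = l then s_op m i (n_plus m N j F) else 0) - s_op m l (Cz_entry m i j (n_plus m N j F)))"
      by (intro sum.cong refl) (simp add: capelli_minus s_C)
    also have "\<dots> = s_op m i (n_plus m N l F) - s_op m l (s_op m i F)"
      using assms(3) n_plus_solves(2)[OF assms(1,2) i] by (simp add: sum_subtractf flip: capelli_sum)
    also have "\<dots> = s_op m i (s_op m l F + n_plus m N l F)"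
      using s_s[of m l i F] by (simp add: capelli_add)
    finally show "(\<Sum>j<N. Cz_entry m i j (- s_op m l (n_plus m N j F))) = s_op m i (s_op m l F + n_plus m N l F)" .
  qed
  then show ?thesis by simp
qed

text \<open>Fix \<open>l\<close> and apply row \<open>i\<close> of the matrix to both orders of the
  product. The order with \<open>n_k\<close> on the left gives minus \<open>n_l s_i\<close> minus
  \<open>n_l n_i\<close>, by \<open>s_n_plus\<close>. In the other order the matrix is first moved
  past \<open>n_l\<close>, giving \<open>n_l s_i\<close> minus \<open>n_i n_l\<close>. The terms
  with \<open>s_i\<close> cancel and minus \<open>A i\<close> remains, which is where the shift by 1
  comes from.\<close>

lemma n_plus_anticommute:
  assumes "N \<le> m" "F \<in> PCl m N" "k < N" "l < N"
  shows "n_plus m N k (n_plus m N l F) = - n_plus m N l (n_plus m N k F)"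
proof -
  let ?n = "n_plus m N"
  note closed = PCl_closed capelli_in_PCl n_plus_solves(1)
  define A where "A = (\<lambda>k. ?n k (?n l F) + ?n l (?n k F))"
  have "(\<Sum>k<N. Cz_entry m i k (A k)) + scale (of_real 1) (A i) = 0" if i: "i < N" for i
  proof -
    have lF: "?n l F \<in> PCl m N" using assms by (intro closed)
    have swap: "Cz_entry m i k (?n l G) = ?n l (Cz_entry m i k G) - (if l = k then ?n i G else 0)"
      if "k < N" "G \<in> PCl m N" for k G
    proof -
      have "?n l (Cz_entry m i k G) = ?n l (if i = k then scale (of_nat m) G else 0) + ?n l (Ez m k i G)"
        unfolding Cz_entry_def using that assms i by (intro n_plus_add) (auto intro: closed)
      also have "?n l (if i = k then scale (of_nat m) G else 0) = (if i = k then scale (of_nat m) (?n l G) else 0)"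
        using that assms n_plus_scale[OF assms(1) that(2) assms(4), of 0] n_plus_scale[OF assms(1) that(2) assms(4)]
        by auto
      finally show ?thesis
        using Ez_n_plus[OF assms(1) that(2,1) i assms(4)] by (simp add: Cz_entry_def)
    qed
    \<comment> \<open>Additivity of the contraction is known only on \<open>PCl m N\<close>, so
      finite sums are treated by induction with membership carried along.\<close>
    have sum_n: "?n l (\<Sum>k<M. g k) = (\<Sum>k<M. ?n l (g k))" if "\<And>k. k < M \<Longrightarrow> g k \<in> PCl m N" for g and M :: nat
      using that
    proof (induction M)
      case 0
      show ?case using n_plus_scale[OF assms(1) PCl_closed(5) assms(4), of 0] by simp
    next
      case (Suc M)
      then have "?n l ((\<Sum>k<M. g k) + g M) = ?n l (\<Sum>k<M. g k) + ?n l (g M)"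
        by (intro n_plus_add[OF assms(1) _ _ assms(4)] PCl_closed) simp_all
      then show ?case using Suc by simp
    qed
    have "(\<Sum>k<N. Cz_entry m i k (?n k (?n l F))) = s_op m i (?n l F)"
      using n_plus_solves(2)[OF assms(1) lF i] .
    also have "\<dots> = - (?n l (s_op m i F) + ?n l (?n i F))"
      using s_n_plus[OF assms(1,2) i assms(4)] n_plus_add[OF assms(1) _ _ assms(4)] assms i
      by (simp add: closed)
    finally have 1: "(\<Sum>k<N. Cz_entry m i k (?n k (?n l F))) = - (?n l (s_op m i F) + ?n l (?n i F))" .
    have "(\<Sum>k<N. Cz_entry m i k (?n l (?n k F))) = (\<Sum>k<N. ?n l (Cz_entry m i k (?n k F)) - (if l = k then ?n i (?n k F) else 0))"
      by (intro sum.cong refl swap) (use assms in \<open>auto intro: closed\<close>)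
    also have "\<dots> = ?n l (s_op m i F) - ?n i (?n l F)"
      using assms(4) sum_n[of N "\<lambda>k. Cz_entry m i k (?n k F)"] n_plus_solves(2)[OF assms(1,2) i] assms
      by (simp add: sum_subtractf closed)
    finally show ?thesis using 1 by (simp add: A_def capelli_add sum.distrib)
  qed
  from Cz_positive_injective[OF assms(1) _ this assms(3)] have "A k = 0" by simp
  then show ?thesis by (simp add: A_def add_eq_0_iff)
qed

text \<open>The intertwining principle is applied to the conjugated matrix entry, which commutes
  with both the matrix and all \<open>s_op\<close>. Conjugating the resulting relation exchanges the
  roles of the two operators.\<close>

lemma dagop_n_plus_C:
  assumes "N \<le> m" "F \<in> PCl m N" "k < N" "i < N" "j < N"
  shows "dagop (n_plus m N k) (Cz_entry m i j F) = Cz_entry m i j (dagop (n_plus m N k) F)"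
proof -
  have "dagop (Cz_entry m i j) (n_plus m N k (pdag F)) = scale 1 (n_plus m N k (dagop (Cz_entry m i j) (pdag F)))"
    by (rule n_plus_intertwine)
      (use assms in \<open>simp_all add: additive_dagop additive_capelli dagop_in_PCl capelli_in_PCl basic_in_PCl dagop_Cz_commute dagop_capelli_commute_basic\<close>)
  from arg_cong[OF this, of pdag] show ?thesis
    by (simp add: dagop_def pdag_pdag)
qed

lemma dagop_n_plus_s:
  assumes "N \<le> m" "F \<in> PCl m N" "k < N"
  shows "dagop (n_plus m N k) (s_op m i F) = - s_op m i (dagop (n_plus m N k) F)"
proof -
  have "dagop (s_op m i) (n_plus m N k (pdag F)) = scale (-1) (n_plus m N k (dagop (s_op m i) (pdag F)))"
    by (rule n_plus_intertwine)
      (use assms in \<open>simp_all add: additive_dagop additive_capelli dagop_in_PCl capelli_in_PCl basic_in_PCl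
        dagop_s_commute dagop_capelli_commute_basic scale_minus_left\<close>)
  from arg_cong[OF this, of pdag] show ?thesis
    by (simp add: dagop_def pdag_pdag scale_minus_left additive.minus[OF additive_basic(6)])
qed

text \<open>Replaces an operator that is known to be linear only on \<open>PCl m N\<close> by an
  everywhere additive one. It also recognizes the linear extension that arises when
  \<open>tensor_odd\<close> evaluates its bosonic operator on basis elements.\<close>

lemma lin_ext_eq_on_PCl:
  fixes f :: "pcl \<Rightarrow> pcl"
  assumes "\<And>F G. F \<in> PCl m N \<Longrightarrow> G \<in> PCl m N \<Longrightarrow> f (F + G) = f F + f G"
    and "\<And>F c. F \<in> PCl m N \<Longrightarrow> f (scale c F) = scale c (f F)"
    and "F \<in> PCl m N"
  shows "lin_ext (\<lambda>b. f (Poly_Mapping.single b 1)) F = f F"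
proof -
  have f0: "f 0 = 0" using assms(2)[OF PCl_closed(5), of 0] by simp
  have "lin_ext (\<lambda>b. f (Poly_Mapping.single b 1)) (\<Sum>b\<in>K. Poly_Mapping.single b (Poly_Mapping.lookup F b))
      = f (\<Sum>b\<in>K. Poly_Mapping.single b (Poly_Mapping.lookup F b))" if "finite K" "K \<subseteq> PCl_basis m N" for K
    using that
  proof (induction K rule: finite_induct)
    case (insert b K)
    have b: "Poly_Mapping.single b c \<in> PCl m N" for c using insert by (simp add: single_in_PCl)
    have "(\<Sum>b\<in>K. Poly_Mapping.single b (Poly_Mapping.lookup F b)) \<in> PCl m N"
      using insert by (intro PCl_closed single_in_PCl) auto
    then show ?case
      using insert assms(1)[OF b] assms(2)[OF b, of "Poly_Mapping.lookup F b" 1]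
      by (simp add: lin_ext_add lin_ext_single scale_single)
  qed (simp add: f0)
  from this[of "Poly_Mapping.keys F"] assms(3) show ?thesis
    by (simp add: PCl_def flip: sum_singles)
qed

section \<open>Contractions of both types: linearity, anticommutation, parity\<close>

lemma n_op_Minus: "n_op m N Minus i = dagop (n_plus m N i)"
  by (simp add: fun_eq_iff dagop_def)

lemma n_op_Plus: "n_op m N Plus i = n_plus m N i"
  by (simp add: fun_eq_iff)

lemma n_op_in_PCl:
  assumes "N \<le> m" "F \<in> PCl m N" "i < N"
  shows "n_op m N \<sigma> i F \<in> PCl m N"
  using assms by (cases \<sigma>) (auto simp: n_plus_solves basic_in_PCl)

lemma n_op_linear:
  assumes "N \<le> m" "F \<in> PCl m N" "i < N"
  shows "G \<in> PCl m N \<Longrightarrow> n_op m N \<sigma> i (F + G) = n_op m N \<sigma> i F + n_op m N \<sigma> i G"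
    and "n_op m N \<sigma> i (scale c F) = scale c (n_op m N \<sigma> i F)"
  using assms
  by (cases \<sigma>; simp add: n_plus_add n_plus_scale basic_in_PCl pdag_add pdag_scale)+

lemma n_op_anticommute:
  assumes "N \<le> m" "F \<in> PCl m N" "i < N" "j < N" "\<sigma> = \<tau> \<or> i \<noteq> j"
  shows "n_op m N \<sigma> i (n_op m N \<tau> j F) = - n_op m N \<tau> j (n_op m N \<sigma> i F)"
proof -
  have mixed: "dagop (n_plus m N k) (n_plus m N l G) = - n_plus m N l (dagop (n_plus m N k) G)"
    if G: "G \<in> PCl m N" and k: "k < N" and l: "l < N" for k l G
  proof -
    \<comment> \<open>\<open>n_plus_intertwine\<close> asks for an operator that is additive
      everywhere; \<open>X\<close> agrees with the conjugated contraction on \<open>PCl m N\<close>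
      and has this property.\<close>
    define X where "X = lin_ext (\<lambda>b. dagop (n_plus m N k) (Poly_Mapping.single b 1))"
    have X: "X F = dagop (n_plus m N k) F" if "F \<in> PCl m N" for F
      unfolding X_def using n_op_linear[OF assms(1) _ k, where \<sigma> = Minus] that
      by (intro lin_ext_eq_on_PCl) (simp_all add: n_op_Minus)
    have n: "dagop (n_plus m N k) F \<in> PCl m N" if "F \<in> PCl m N" for F
      using n_op_in_PCl[OF assms(1) that k, of Minus] by (simp add: n_op_Minus)
    have "X (n_plus m N l G) = scale (-1) (n_plus m N l (X G))"
      by (rule n_plus_intertwine)
        (use assms(1) G k l in \<open>simp_all add: X n capelli_in_PCl dagop_n_plus_C dagop_n_plus_s scale_minus_left
          X_def[symmetric] X_def[THEN arg_cong, of additive, THEN iffD2, OF additive_lin_ext]\<close>)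
    then show ?thesis using G l assms(1) by (simp add: X n_plus_solves scale_minus_left)
  qed
  show ?thesis
  proof (cases \<sigma>; cases \<tau>)
    assume "\<sigma> = Plus" "\<tau> = Plus"
    then show ?thesis using n_plus_anticommute[OF assms(1-4)] by simp
  next
    assume "\<sigma> = Minus" "\<tau> = Minus"
    then show ?thesis
      using n_plus_anticommute[OF assms(1) _ assms(3,4), of "pdag F"] assms(2)
      by (simp add: pdag_pdag basic_in_PCl additive.minus[OF additive_basic(6)])
  next
    assume "\<sigma> = Minus" "\<tau> = Plus"
    then show ?thesis using mixed[OF assms(2,3,4)] by (simp add: n_op_Minus n_op_Plus)
  next
    assume "\<sigma> = Plus" "\<tau> = Minus"
    then show ?thesis using mixed[OF assms(2,4,3)] by (simp add: n_op_Minus n_op_Plus)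
  qed
qed

lemma n_op_pgrade:
  assumes "N \<le> m" "F \<in> PCl m N" "i < N"
  shows "pgrade (n_op m N \<sigma> i F) = - n_op m N \<sigma> i (pgrade F)"
proof -
  have "pgrade (n_plus m N i G) = scale (-1) (n_plus m N i (pgrade G))" if "G \<in> PCl m N" for G
    by (rule n_plus_intertwine)
      (use assms that in \<open>simp_all add: additive_basic basic_in_PCl pgrade_C pgrade_s scale_minus_left\<close>)
  then show ?thesis
    using assms
    by (cases \<sigma>) (simp_all add: pgrade_pdag basic_in_PCl scale_minus_left additive.minus[OF additive_basic(6)])
qed

section \<open>Effect of the contractions on Euler degrees\<close>

definition euler_op :: "nat \<Rightarrow> pm \<Rightarrow> nat \<Rightarrow> pcl \<Rightarrow> pcl" where
  "euler_op m \<tau> j = (case \<tau> of Plus \<Rightarrow> dagop (Ez m j j) | Minus \<Rightarrow> Ez m j j)"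

lemma Ez_single: "Ez m j j (Poly_Mapping.single (\<mu>, \<nu>, A) c) =
    scale (of_nat (\<Sum>a<m. Poly_Mapping.lookup \<mu> (j, a))) (Poly_Mapping.single (\<mu>, \<nu>, A) c)"
proof -
  have "zmult j a (dz j a (Poly_Mapping.single (\<mu>, \<nu>, A) c)) =
      Poly_Mapping.single (\<mu>, \<nu>, A) (c * of_nat (Poly_Mapping.lookup \<mu> (j, a)))" for a
    using expo_diff_unit_eq_iff[of \<mu> j a "\<mu> - unit_expo j a"]
    by (cases "Poly_Mapping.lookup \<mu> (j, a) = 0") (auto simp: dz_single zmult_single)
  moreover have "(\<Sum>a<k. Poly_Mapping.single (\<mu>, \<nu>, A) (g a)) = Poly_Mapping.single (\<mu>, \<nu>, A) (\<Sum>a<k. g a)"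
    for g :: "nat \<Rightarrow> complex" and k
    by (induction k) (simp_all add: single_add)
  ultimately show ?thesis
    by (simp add: Ez_def scale_single sum_distrib_right mult.commute[of c])
qed

lemma euler_op_single: "euler_op m \<tau> j (Poly_Mapping.single b c) =
    scale (of_nat (euler_deg m \<tau> j b)) (Poly_Mapping.single b c)"
proof -
  obtain \<mu> \<nu> A where "b = (\<mu>, \<nu>, A)" by (cases b)
  then show ?thesis
    by (cases \<tau>) (simp_all add: euler_op_def dagop_def pdag_single Ez_single pdag_scale)
qed

lemma additive_euler_op: "additive (euler_op m \<tau> j)"
  by (cases \<tau>) (simp_all add: euler_op_def additive_dagop additive_capelli)

text \<open>The degree read by type \<open>Plus\<close> is antiholomorphic, while a contraction of
  type \<open>Plus\<close> acts holomorphically, so equal types never interfere. For opposite types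
  the gl_N relation shows that only the degree of the contraction's own label changes.\<close>

lemma n_op_euler_op:
  assumes "N \<le> m" "F \<in> PCl m N" "i < N" "j < N" "\<sigma> = \<tau> \<or> i \<noteq> j"
  shows "euler_op m \<tau> j (n_op m N \<sigma> i F) = n_op m N \<sigma> i (euler_op m \<tau> j F)"
proof -
  have same: "dagop (Ez m j j) (n_plus m N i G) = n_plus m N i (dagop (Ez m j j) G)" if "G \<in> PCl m N" for G
  proof -
    have "dagop (Ez m j j) (n_plus m N i G) = scale 1 (n_plus m N i (dagop (Ez m j j) G))"
      by (rule n_plus_intertwine)
        (use assms that in \<open>simp_all add: additive_dagop additive_capelli dagop_in_PCl capelli_in_PCl
           dagop_Ez_commute dagop_capelli_commute_basic\<close>)
    then show ?thesis by simp
  qed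
  have other: "Ez m j j (n_plus m N i G) = n_plus m N i (Ez m j j G)" if "G \<in> PCl m N" "i \<noteq> j" for G
    using Ez_n_plus[OF assms(1) that(1) assms(4,4,3)] that by simp
  have same': "Ez m j j (dagop (n_plus m N i) F) = dagop (n_plus m N i) (Ez m j j F)"
    using arg_cong[OF same[of "pdag F"], of pdag] assms(2)
    by (simp add: dagop_def pdag_pdag basic_in_PCl)
  show ?thesis
    using assms same[of F] other[of F] same' other[of "pdag F"]
    by (cases \<sigma>; cases \<tau>) (auto simp: euler_op_def basic_in_PCl dagop_def pdag_pdag)
qed

lemma lookup_lin_ext_diagonal:
  "Poly_Mapping.lookup (lin_ext (\<lambda>b. Poly_Mapping.single b (g b)) F) b = g b * Poly_Mapping.lookup F b"
proof (induction F rule: single_add_induct)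
  case (single i c)
  then show ?case by (auto simp: lin_ext_single scale_single lookup_single when_def mult.commute)
qed (simp_all add: lin_ext_add lookup_add distrib_left)

text \<open>A basis element in the support of the image inherits the eigenvalue of every diagonal
  operator that commutes or anticommutes with the contraction: compare the coefficients at
  \<open>b'\<close>. Thus degree and sign are constant on this support when a second transported
  operator is applied.\<close>

lemma n_op_degrees:
  assumes "N \<le> m" "b \<in> PCl_basis m N" "i < N"
    and b': "b' \<in> Poly_Mapping.keys (n_op m N \<sigma> i (Poly_Mapping.single b 1))"
  shows "j < N \<Longrightarrow> \<sigma> = \<tau> \<or> i \<noteq> j \<Longrightarrow> euler_deg m \<tau> j b' = euler_deg m \<tau> j b"
    and "(-1 :: complex) ^ card (snd (snd b')) = - ((-1) ^ card (snd (snd b)))"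
    and "b' \<in> PCl_basis m N"
proof -
  let ?F = "n_op m N \<sigma> i (Poly_Mapping.single b 1)"
  have b: "Poly_Mapping.single b c \<in> PCl m N" for c using assms(2) by (rule single_in_PCl)
  have nz: "Poly_Mapping.lookup ?F b' \<noteq> 0" using b' by (simp add: in_keys_iff)
  have eu: "euler_op m \<tau> j F = lin_ext (\<lambda>b. Poly_Mapping.single b (of_nat (euler_deg m \<tau> j b))) F" for F j \<tau>
    by (rule additive_eqI[OF additive_euler_op additive_lin_ext])
      (simp add: euler_op_single lin_ext_single scale_single mult.commute)
  show "euler_deg m \<tau> j b' = euler_deg m \<tau> j b" if "j < N" "\<sigma> = \<tau> \<or> i \<noteq> j"
  proof -
    have "lin_ext (\<lambda>b. Poly_Mapping.single b (of_nat (euler_deg m \<tau> j b))) ?F = scale (of_nat (euler_deg m \<tau> j b)) ?F"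
      using n_op_euler_op[OF assms(1) b assms(3) that] n_op_linear(2)[OF assms(1) b assms(3)]
      by (simp add: euler_op_single flip: eu)
    from arg_cong[OF this, of "\<lambda>F. Poly_Mapping.lookup F b'"] nz show ?thesis
      by (simp add: lookup_lin_ext_diagonal lookup_scale)
  qed
  have gr: "pgrade F = lin_ext (\<lambda>b. Poly_Mapping.single b ((-1) ^ card (snd (snd b)))) F" for F
    by (simp add: pgrade_def case_prod_unfold)
  have "pgrade ?F = scale (- ((-1) ^ card (snd (snd b)))) ?F"
    using n_op_pgrade[OF assms(1) b assms(3)] n_op_linear(2)[OF assms(1) b assms(3), of \<sigma> "(-1) ^ card (snd (snd b))" 1]
    by (cases b) (simp add: pgrade_single scale_single scale_minus_left)
  from arg_cong[OF this, of "\<lambda>F. Poly_Mapping.lookup F b'"] nz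
  show "(-1 :: complex) ^ card (snd (snd b')) = - ((-1) ^ card (snd (snd b)))"
    unfolding gr lookup_lin_ext_diagonal lookup_scale by (metis mult_right_cancel)
  show "b' \<in> PCl_basis m N"
    using n_op_in_PCl[OF assms(1) b assms(3)] b' by (auto simp: PCl_def)
qed

section \<open>The coefficient ring\<close>

definition poly_ring :: "(nat \<times> nat) set \<Rightarrow> kfld set" where
  "poly_ring V = {Fract p 1 | p. \<forall>\<mu>\<in>Poly_Mapping.keys p. Poly_Mapping.keys \<mu> \<subseteq> V}"

lemma poly_ring_closed:
  "kconst c \<in> poly_ring V"
  "v \<in> V \<Longrightarrow> kvar v \<in> poly_ring V"
  "x \<in> poly_ring V \<Longrightarrow> y \<in> poly_ring V \<Longrightarrow> x + y \<in> poly_ring V"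
  "x \<in> poly_ring V \<Longrightarrow> y \<in> poly_ring V \<Longrightarrow> x * y \<in> poly_ring V"
  "x \<in> poly_ring V \<Longrightarrow> kcnj x \<in> poly_ring V"
proof -
  show "kconst c \<in> poly_ring V"
    unfolding poly_ring_def kconst_def by (rule CollectI, rule exI, rule conjI, rule refl) simp
  show "v \<in> V \<Longrightarrow> kvar v \<in> poly_ring V"
    unfolding poly_ring_def kvar_def by (rule CollectI, rule exI, rule conjI, rule refl) simp
  assume "x \<in> poly_ring V"
  then obtain p where p: "x = Fract p 1" "\<forall>\<mu>\<in>Poly_Mapping.keys p. Poly_Mapping.keys \<mu> \<subseteq> V"
    by (auto simp: poly_ring_def)
  have "Poly_Mapping.keys (bcnj p) = Poly_Mapping.keys p"
    by (auto simp: in_keys_iff lookup_bcnj)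
  with p show "kcnj x \<in> poly_ring V"
    unfolding poly_ring_def by (intro CollectI exI[of _ "bcnj p"]) (simp add: kcnj_Fract bcnj_1)
  assume "y \<in> poly_ring V"
  then obtain q where q: "y = Fract q 1" "\<forall>\<mu>\<in>Poly_Mapping.keys q. Poly_Mapping.keys \<mu> \<subseteq> V"
    by (auto simp: poly_ring_def)
  have "\<forall>\<mu>\<in>Poly_Mapping.keys (p + q). Poly_Mapping.keys \<mu> \<subseteq> V"
    using keys_add[of p q] p(2) q(2) by blast
  then show "x + y \<in> poly_ring V"
    unfolding poly_ring_def by (intro CollectI exI[of _ "p + q"]) (simp add: p q)
  have "\<forall>\<mu>\<in>Poly_Mapping.keys (p * q). Poly_Mapping.keys \<mu> \<subseteq> V"
  proof
    fix \<mu> assume "\<mu> \<in> Poly_Mapping.keys (p * q)"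
    then obtain a b where "a \<in> Poly_Mapping.keys p" "b \<in> Poly_Mapping.keys q" "\<mu> = a + b"
      using keys_mult[of p q] by blast
    then show "Poly_Mapping.keys \<mu> \<subseteq> V"
      using keys_add[of a b] p(2) q(2) by blast
  qed
  then show "x * y \<in> poly_ring V"
    unfolding poly_ring_def by (intro CollectI exI[of _ "p * q"]) (simp add: p q)
qed

lemma affine_nonzero:
  assumes "a \<noteq> 0"
  shows "kconst a * kvar v + kconst b \<noteq> 0"
proof -
  have "kconst a * kvar v + kconst b = Fract (Poly_Mapping.single (Poly_Mapping.single v 1) a + Poly_Mapping.single 0 b) 1"
    by (simp add: kconst_def kvar_def mult_single)
  moreover have "(0 :: (nat \<times> nat) \<Rightarrow>\<^sub>0 nat) \<noteq> Poly_Mapping.single v 1"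
    by (metis lookup_single_eq lookup_zero zero_neq_one)
  then have "Poly_Mapping.lookup (Poly_Mapping.single (Poly_Mapping.single v (1::nat)) a + Poly_Mapping.single 0 b) (Poly_Mapping.single v 1) = a"
    by (simp add: lookup_add lookup_single when_def)
  ultimately show ?thesis
    using assms by (auto simp: Zero_fract_def eq_fract)
qed

section \<open>Generators of the denominators and closure of the localization\<close>

definition gen1 :: "nat \<times> nat \<Rightarrow> int \<Rightarrow> kfld" where
  "gen1 v k = (kvar v + kconst (2 * of_int k * \<i>)) - kconst \<i>"

definition gen2 :: "real \<Rightarrow> nat \<times> nat \<Rightarrow> int \<Rightarrow> kfld" where
  "gen2 s v k = kconst (of_real s) - kconst (2 * \<i>) * (kvar v + kconst (2 * of_int k * \<i>))"

definition gen3 :: "real \<Rightarrow> nat \<times> nat \<Rightarrow> int \<Rightarrow> kfld" where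
  "gen3 s v k = kconst (of_real s) + kconst (2 * \<i>) * (kvar v + kconst (2 * of_int k * \<i>))"

lemmas A_denoms_intros = A_denoms.intros[folded gen1_def gen2_def gen3_def]
lemmas A_denoms_induct = A_denoms.induct[folded gen1_def gen2_def gen3_def, consumes 1, case_names one gen1 gen2 gen3]

lemma gen_affine:
  "gen1 v k = kconst 1 * kvar v + kconst (2 * of_int k * \<i> - \<i>)"
  "gen2 s v k = kconst (- (2 * \<i>)) * kvar v + kconst (of_real s + 4 * of_int k)"
  "gen3 s v k = kconst (2 * \<i>) * kvar v + kconst (of_real s - 4 * of_int k)"
proof -
  have e: "kconst (2 * \<i>) * kconst (2 * of_int k * \<i>) = kconst (- 4 * of_int k)"
    unfolding kconst_mult[symmetric] by (rule arg_cong[of _ _ kconst]) (simp add: complex_eq_iff)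
  show "gen1 v k = kconst 1 * kvar v + kconst (2 * of_int k * \<i> - \<i>)"
    unfolding gen1_def by (simp add: kconst_diff algebra_simps)
  show "gen2 s v k = kconst (- (2 * \<i>)) * kvar v + kconst (of_real s + 4 * of_int k)"
    unfolding gen2_def distrib_left e by (simp add: kconst_add kconst_minus)
  show "gen3 s v k = kconst (2 * \<i>) * kvar v + kconst (of_real s - 4 * of_int k)"
    unfolding gen3_def distrib_left e by (simp add: kconst_diff kconst_minus)
qed

text \<open>Conjugation fixes \<open>B\<close> and conjugates the constants. It reflects the shift
  in each family and exchanges the second family with the third, so the set of denominators is
  stable.\<close>

lemma kcnj_gen:
  "kcnj (gen1 v k) = gen1 v (1 - k)" "kcnj (gen2 s v k) = gen3 s v (- k)" "kcnj (gen3 s v k) = gen2 s v (- k)"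
  by (simp_all add: gen_affine kcnj_add kcnj_mult kcnj_kconst kcnj_kvar algebra_simps)

lemma A_denoms_props:
  assumes "d \<in> A_denoms s V"
  shows "d \<noteq> 0" "d \<in> poly_ring V" "kcnj d \<in> A_denoms s V" "e \<in> A_denoms s V \<Longrightarrow> d * e \<in> A_denoms s V"
proof -
  have nz: "gen1 v k \<noteq> 0" "gen2 s v k \<noteq> 0" "gen3 s v k \<noteq> 0" for v k
    unfolding gen_affine by (rule affine_nonzero, simp)+
  have P: "gen1 v k \<in> poly_ring V" "gen2 s v k \<in> poly_ring V" "gen3 s v k \<in> poly_ring V" if "v \<in> V" for v k
    unfolding gen_affine using that by (intro poly_ring_closed; assumption)+
  show "d \<noteq> 0" using assms by (induction rule: A_denoms_induct) (simp_all add: nz)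
  show "d \<in> poly_ring V"
    using assms by (induction rule: A_denoms_induct) (use poly_ring_closed(1)[of 1] in \<open>auto intro: poly_ring_closed P\<close>)
  show "kcnj d \<in> A_denoms s V"
    using assms
    by (induction rule: A_denoms_induct)
      (use kcnj_kconst[of 1] in \<open>auto simp: kcnj_mult kcnj_gen intro: A_denoms_intros\<close>)
  assume e: "e \<in> A_denoms s V"
  show "d * e \<in> A_denoms s V"
    using assms
  proof (induction rule: A_denoms_induct)
    case (gen1 k v d)
    then show ?case using A_denoms_intros(2)[where v = v and V = V and d = "d * e" and s = s and k = k] by (simp add: mult_ac)
  next
    case (gen2 k v d)
    then show ?case using A_denoms_intros(3)[where v = v and V = V and d = "d * e" and s = s and k = k] by (simp add: mult_ac)
  next
    case (gen3 k v d)
    then show ?case using A_denoms_intros(4)[where v = v and V = V and d = "d * e" and s = s and k = k] by (simp add: mult_ac)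
  qed (use e in simp)
qed

lemma A_min_alt: "A_min s V = {x / d | x d. x \<in> poly_ring V \<and> d \<in> A_denoms s V}"
  unfolding A_min_def poly_ring_def by blast

lemma A_min_closed:
  "x \<in> poly_ring V \<Longrightarrow> x \<in> A_min s V"
  "d \<in> A_denoms s V \<Longrightarrow> inverse d \<in> A_min s V"
  "x \<in> A_min s V \<Longrightarrow> kcnj x \<in> A_min s V"
  "x \<in> A_min s V \<Longrightarrow> y \<in> A_min s V \<Longrightarrow> x + y \<in> A_min s V"
  "x \<in> A_min s V \<Longrightarrow> y \<in> A_min s V \<Longrightarrow> x * y \<in> A_min s V"
proof -
  show "x \<in> A_min s V" if "x \<in> poly_ring V"
    unfolding A_min_alt using that A_denoms.one by (intro CollectI exI[of _ x] exI[of _ 1]) simp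
  show "inverse d \<in> A_min s V" if "d \<in> A_denoms s V"
    unfolding A_min_alt using that poly_ring_closed(1)[of 1 V]
    by (intro CollectI exI[of _ 1] exI[of _ d]) (simp add: divide_inverse)
  assume "x \<in> A_min s V"
  then obtain a d where x: "x = a / d" "a \<in> poly_ring V" "d \<in> A_denoms s V" by (auto simp: A_min_alt)
  have "kcnj x = kcnj a / kcnj d" by (simp add: x divide_inverse kcnj_mult kcnj_inverse)
  then show "kcnj x \<in> A_min s V"
    unfolding A_min_alt using poly_ring_closed(5)[OF x(2)] A_denoms_props(3)[OF x(3)] by blast
  assume "y \<in> A_min s V"
  then obtain b e where y: "y = b / e" "b \<in> poly_ring V" "e \<in> A_denoms s V" by (auto simp: A_min_alt)
  note de = A_denoms_props(4)[OF x(3) y(3)]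
  have "x + y = (a * e + b * d) / (d * e)"
    using A_denoms_props(1)[OF x(3)] A_denoms_props(1)[OF y(3)] by (simp add: x y add_frac_eq)
  moreover have "a * e + b * d \<in> poly_ring V"
    using x y A_denoms_props(2) by (intro poly_ring_closed) auto
  ultimately show "x + y \<in> A_min s V"
    unfolding A_min_alt using de by blast
  have "x * y = (a * b) / (d * e)" by (simp add: x y)
  moreover have "a * b \<in> poly_ring V"
    using x y by (intro poly_ring_closed) auto
  ultimately show "x * y \<in> A_min s V"
    unfolding A_min_alt using de by blast
qed

locale coeff_ring =
  fixes A :: "'r::comm_ring_1 set"
  assumes zero: "0 \<in> A" and one: "1 \<in> A" and minus_one: "-1 \<in> A"
    and add: "x \<in> A \<Longrightarrow> y \<in> A \<Longrightarrow> x + y \<in> A"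
    and mult: "x \<in> A \<Longrightarrow> y \<in> A \<Longrightarrow> x * y \<in> A"
begin

lemma uminus: "x \<in> A \<Longrightarrow> - x \<in> A"
  using mult[OF minus_one, of x] by simp

lemma diff: "x \<in> A \<Longrightarrow> y \<in> A \<Longrightarrow> x - y \<in> A"
  using add[OF _ uminus, of x y] by simp

lemma sum: "(\<And>i. i \<in> I \<Longrightarrow> f i \<in> A) \<Longrightarrow> (\<Sum>i\<in>I. f i) \<in> A"
  by (induction I rule: infinite_finite_induct) (auto intro: zero add)

lemma prod: "(\<And>i. i \<in> I \<Longrightarrow> f i \<in> A) \<Longrightarrow> (\<Prod>i\<in>I. f i) \<in> A"
  by (induction I rule: infinite_finite_induct) (auto intro: one mult)

lemma of_nat: "of_nat k \<in> A"
  by (induction k) (auto intro: zero one add)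

lemma sign: "(-1) ^ k \<in> A"
  by (induction k) (use one in \<open>auto intro: uminus\<close>)

end

lemma A_min_ring: "coeff_ring (A_min s V)"
proof
  have k: "kconst c \<in> A_min s V" for c
    by (intro A_min_closed poly_ring_closed)
  show "0 \<in> A_min s V" "1 \<in> A_min s V" "-1 \<in> A_min s V"
    using k[of 0] k[of 1] k[of "-1"] by (simp_all add: kconst_minus)
qed (rule A_min_closed; assumption)+

interpretation A_min: coeff_ring "A_min s V" for s V
  by (rule A_min_ring)

lemma kconst_A_min: "kconst c \<in> A_min s V"
  by (intro A_min_closed poly_ring_closed)

lemma gens_A_min:
  assumes "v \<in> V"
  shows "gen1 v k \<in> A_min s V" "inverse (gen1 v k) \<in> A_min s V" "inverse (gen2 s v k) \<in> A_min s V" "gen2 s v k \<in> A_min s V"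
  using A_denoms_intros(2,3)[OF assms A_denoms.one, where s = s and k = k]
  by (simp_all add: A_min_closed A_denoms_props)

lemma alpha_kvar: "alpha j (kvar v) = (if j \<ge> 0 then 1 else gen1 v (j + 1))"
proof -
  have "kconst (of_int (2 * j + 1) * \<i>) = kconst (2 * of_int (j + 1) * \<i> - \<i>)"
    by (rule arg_cong[of _ _ kconst]) (simp add: algebra_simps)
  then show ?thesis by (simp add: alpha_def gen_affine)
qed

lemma beta_kvar: "beta j (kvar v) = (if j \<ge> 1 then gen1 v j else 1)"
proof -
  have "kconst (of_int (2 * j - 1) * \<i>) = kconst (2 * of_int j * \<i> - \<i>)"
    by (rule arg_cong[of _ _ kconst]) (simp add: algebra_simps)
  then show ?thesis by (simp add: beta_def gen_affine)
qed

text \<open>A shifted \<open>Phi\<close> is a quotient of two generators of the denominators. The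
  constant 4 in its numerator equals one shift of \<open>gen2\<close>, which explains the index
  \<open>j - 1\<close>.\<close>

lemma Phi_kvar: "Phi s (kvar v + kconst (2 * \<i> * of_int j)) = - gen2 s v (j - 1) / gen1 v j"
proof -
  have "kvar v + kconst (2 * \<i> * of_int j) - kconst \<i> = gen1 v j"
    unfolding gen1_def by (simp add: mult_ac)
  moreover have "kconst (4 - of_real s) + kconst (2*\<i>) * (kvar v + kconst (2 * \<i> * of_int j)) = - gen2 s v (j - 1)"
  proof -
    have "kconst (4 - of_real s) + kconst (2*\<i>) * kconst (2 * \<i> * of_int j) = - kconst (of_real s + 4 * of_int (j - 1))"
      unfolding kconst_mult[symmetric] kconst_add[symmetric] kconst_minus[symmetric]
      by (rule arg_cong[of _ _ kconst]) (simp add: complex_eq_iff)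
    moreover have "kconst (4 - of_real s) + kconst (2*\<i>) * (kvar v + kconst (2 * \<i> * of_int j))
        = kconst (2*\<i>) * kvar v + (kconst (4 - of_real s) + kconst (2*\<i>) * kconst (2 * \<i> * of_int j))"
      by (simp only: distrib_left add.left_commute)
    ultimately show ?thesis
      by (simp only: gen_affine kconst_minus minus_add_distrib mult_minus_left minus_minus)
  qed
  ultimately show ?thesis by (simp add: Phi_def)
qed

text \<open>By \<open>Phi_kvar\<close> with \<open>j = c + 1\<close>, \<open>pi_plus s c\<close> is
  a scalar times \<open>beta (c + 1)\<close> and \<open>gen2 s v c\<close>, divided by
  \<open>gen1 v (c + 1)\<close>. All of these are invertible in the localization, so the
  coefficients of the homotopy stay inside it.\<close>

lemma pair_coefficients_A_min:
  assumes "v \<in> V"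
  shows "inverse (pi_plus s c (kvar v)) \<in> A_min s V" "inverse (beta c (kvar v)) \<in> A_min s V"
    "kappa_plus s c (kvar v) \<in> A_min s V" "Kc c (kvar v) \<in> A_min s V"
proof -
  note gens = gens_A_min[OF assms]
  have alpha: "alpha c (kvar v) \<in> A_min s V" for c
    by (simp add: alpha_kvar A_min.one gens)
  have beta: "beta c (kvar v) \<in> A_min s V" "inverse (beta c (kvar v)) \<in> A_min s V" for c
    by (simp_all add: beta_kvar A_min.one gens)
  show "inverse (beta c (kvar v)) \<in> A_min s V" by (rule beta)
  have "inverse (pi_plus s c (kvar v)) = - (inverse (kconst (-1/4)) * inverse (beta (c + 1) (kvar v)) * gen1 v (c + 1) * inverse (gen2 s v c))"
    unfolding pi_plus_def sigma_plus_def Phi_kvar divide_inverse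
    by (simp only: inverse_mult_distrib inverse_inverse_eq inverse_minus_eq add_diff_cancel_right'
        mult_minus_left mult_minus_right mult.assoc mult.commute mult.left_commute)
  moreover have "inverse (kconst (-1/4)) = kconst (-4)"
    by (rule inverse_unique) (simp flip: kconst_mult)
  ultimately show "inverse (pi_plus s c (kvar v)) \<in> A_min s V"
    by (simp only:) (intro A_min.uminus A_min.mult kconst_A_min beta gens)
  show "kappa_plus s c (kvar v) \<in> A_min s V"
    unfolding kappa_plus_def sigma_plus_def Phi_kvar divide_inverse
    by (intro A_min.uminus A_min.mult kconst_A_min beta alpha gens)
  show "Kc c (kvar v) \<in> A_min s V"
    unfolding Kc_def by (intro A_min.mult kconst_A_min beta alpha)
qed

section \<open>Free modules over a coefficient ring\<close>

definition free_module :: "'x set \<Rightarrow> 'r set \<Rightarrow> ('x \<Rightarrow>\<^sub>0 'r::zero) set" where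
  "free_module K A = {u. Poly_Mapping.keys u \<subseteq> K \<and> (\<forall>x. Poly_Mapping.lookup u x \<in> A)}"

context coeff_ring
begin

lemma free_module_closed:
  "0 \<in> free_module K A"
  "u \<in> free_module K A \<Longrightarrow> v \<in> free_module K A \<Longrightarrow> u + v \<in> free_module K A"
  "u \<in> free_module K A \<Longrightarrow> - u \<in> free_module K A"
  "c \<in> A \<Longrightarrow> u \<in> free_module K A \<Longrightarrow> scale c u \<in> free_module K A"
  "x \<in> K \<Longrightarrow> c \<in> A \<Longrightarrow> Poly_Mapping.single x c \<in> free_module K A"
  "(\<And>i. i \<in> I \<Longrightarrow> f i \<in> free_module K A) \<Longrightarrow> (\<Sum>i\<in>I. f i) \<in> free_module K A"
proof -
  show z: "0 \<in> free_module K A" by (simp add: free_module_def zero)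
  show a: "u + v \<in> free_module K A" if "u \<in> free_module K A" "v \<in> free_module K A" for u v
    using that keys_add[of u v] by (auto simp: free_module_def lookup_add add)
  show "u \<in> free_module K A \<Longrightarrow> - u \<in> free_module K A"
    by (auto simp: free_module_def uminus)
  show "c \<in> A \<Longrightarrow> u \<in> free_module K A \<Longrightarrow> scale c u \<in> free_module K A"
    using keys_scale_subset[of c u] by (auto simp: free_module_def lookup_scale mult)
  show "x \<in> K \<Longrightarrow> c \<in> A \<Longrightarrow> Poly_Mapping.single x c \<in> free_module K A"
    by (auto simp: free_module_def lookup_single when_def zero)
  show "(\<And>i. i \<in> I \<Longrightarrow> f i \<in> free_module K A) \<Longrightarrow> (\<Sum>i\<in>I. f i) \<in> free_module K A"
    by (induction I rule: infinite_finite_induct) (auto intro: z a)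
qed

lemma lin_ext_free_module:
  "u \<in> free_module K A \<Longrightarrow> (\<And>x. x \<in> K \<Longrightarrow> f x \<in> free_module L A) \<Longrightarrow> lin_ext f u \<in> free_module L A"
  unfolding lin_ext_def by (intro free_module_closed) (auto simp: free_module_def)

end

section \<open>Operators on tensor factors\<close>

text \<open>Embeds factor \<open>j\<close> into the tensor product with all other factors frozen at
  \<open>w\<close>; the entry of \<open>w\<close> at \<open>j\<close> is overwritten.\<close>

definition insert_at :: "'x list \<Rightarrow> nat \<Rightarrow> ('x \<Rightarrow>\<^sub>0 kfld) \<Rightarrow> ('x list \<Rightarrow>\<^sub>0 kfld)" where
  "insert_at w j = lin_ext (\<lambda>x. Poly_Mapping.single (w[j := x]) 1)"

definition hat_sign :: "('x \<Rightarrow> nat) \<Rightarrow> nat \<Rightarrow> 'x list \<Rightarrow> kfld" where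
  "hat_sign par j w = (-1) ^ (\<Sum>i<j. par (w ! i))"

lemma hat_sign_square: "hat_sign par j w * hat_sign par j w = 1"
  unfolding hat_sign_def by (simp flip: power_add mult_2)

lemma hat_additive: "additive (hat par j Y)"
  unfolding hat_def by (rule additive_lin_ext)

lemma hat_scale: "hat par j Y (scale c u) = scale c (hat par j Y u)"
  unfolding hat_def by (rule lin_ext_scale)

lemma hat_single_sum: "hat par j Y (Poly_Mapping.single w c) =
    (\<Sum>x\<in>Poly_Mapping.keys (Y (Poly_Mapping.single (w ! j) 1)). Poly_Mapping.single (w[j := x])
       (c * hat_sign par j w * Poly_Mapping.lookup (Y (Poly_Mapping.single (w ! j) 1)) x))"
  by (simp add: hat_def lin_ext_single hat_sign_def Let_def scale_sum scale_single mult.assoc)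

lemma hat_single: "hat par j Y (Poly_Mapping.single w c) =
    scale (c * hat_sign par j w) (insert_at w j (Y (Poly_Mapping.single (w ! j) 1)))"
  by (simp add: hat_single_sum insert_at_def lin_ext_def scale_sum scale_single mult.assoc)

lemma hat_insert_at:
  assumes "j < length w" "additive Y" "\<And>c u. Y (scale c u) = scale c (Y u)"
  shows "hat par j Y (insert_at w j u) = scale (hat_sign par j w) (insert_at w j (Y u))"
proof (rule additive_eqI[where u = u])
  show "additive (\<lambda>u. hat par j Y (insert_at w j u))"
    unfolding insert_at_def by (intro additive_comp[OF hat_additive] additive_lin_ext)
  show "additive (\<lambda>u. scale (hat_sign par j w) (insert_at w j (Y u)))"
    unfolding insert_at_def by (intro additive_comp[OF additive_scale] additive_comp[OF additive_lin_ext] assms(2))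
  fix x c
  have "hat_sign par j (w[j := x]) = hat_sign par j w"
    unfolding hat_sign_def by (rule arg_cong[of _ _ "power (-1)"], rule sum.cong) auto
  moreover have "insert_at (w[j := x]) j = insert_at w j"
    by (simp add: insert_at_def)
  moreover have "Y (Poly_Mapping.single x c) = scale c (Y (Poly_Mapping.single x 1))"
    using assms(3)[of c "Poly_Mapping.single x 1"] by (simp add: scale_single)
  ultimately show "hat par j Y (insert_at w j (Poly_Mapping.single x c)) =
      scale (hat_sign par j w) (insert_at w j (Y (Poly_Mapping.single x c)))"
    using assms(1)
    by (simp add: insert_at_def lin_ext_single lin_ext_scale scale_single scale_scale hat_single mult.commute)
qed

text \<open>The sign at \<open>j\<close> depends only on the factors before \<open>j\<close>, which
  the inner operator leaves alone. It therefore occurs twice and cancels.\<close>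

lemma hat_hat_same:
  assumes "j < length w" "additive Y" "\<And>c u. Y (scale c u) = scale c (Y u)"
  shows "hat par j Y (hat par j Z (Poly_Mapping.single w c)) =
    scale c (insert_at w j (Y (Z (Poly_Mapping.single (w ! j) 1))))"
  unfolding hat_single[of par j Z] hat_scale hat_insert_at[OF assms]
  by (simp add: scale_scale mult.assoc hat_sign_square)

text \<open>Parity is recorded through signs, the only form in which it enters, and at a single
  basis vector, because for the copies it is established only on words of length
  \<open>n\<close>.\<close>

definition odd_at :: "('x \<Rightarrow> nat) \<Rightarrow> (('x \<Rightarrow>\<^sub>0 kfld) \<Rightarrow> ('x \<Rightarrow>\<^sub>0 kfld)) \<Rightarrow> 'x \<Rightarrow> bool" where
  "odd_at par Y x \<longleftrightarrow> (\<forall>y\<in>Poly_Mapping.keys (Y (Poly_Mapping.single x 1)).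
     (-1 :: kfld) ^ par y = - ((-1) ^ par x))"

lemma hat_sign_update:
  assumes "j < length w" "(-1 :: kfld) ^ par x = - ((-1) ^ par (w ! j))"
  shows "hat_sign par k (w[j := x]) = (if j < k then - hat_sign par k w else hat_sign par k w)"
proof (cases "j < k")
  case True
  have "(\<Prod>i\<in>{..<k} - {j}. (-1 :: kfld) ^ par (w[j := x] ! i)) = (\<Prod>i\<in>{..<k} - {j}. (-1) ^ par (w ! i))"
    by (rule prod.cong) auto
  then show ?thesis
    using True assms by (simp add: hat_sign_def power_sum prod.remove[of "{..<k}" j])
next
  case False
  then show ?thesis
    unfolding hat_sign_def by (auto intro!: arg_cong[of _ _ "power (-1)"] sum.cong)
qed

text \<open>For \<open>i < j\<close> an odd operator at \<open>i\<close> reverses the sign that the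
  operator at \<open>j\<close> collects, while an operator at \<open>j\<close> has no influence on
  the sign at \<open>i\<close>. Hence the two orders differ by one sign.\<close>

lemma hat_anticommute_single:
  assumes "i < length w" "j < length w" "i \<noteq> j" "odd_at par Y (w ! i)" "odd_at par Z (w ! j)"
  shows "hat par i Y (hat par j Z (Poly_Mapping.single w c)) = - hat par j Z (hat par i Y (Poly_Mapping.single w c))"
proof -
  have key: "hat par i Y (hat par j Z (Poly_Mapping.single w c)) = - hat par j Z (hat par i Y (Poly_Mapping.single w c))"
    if ij: "i < j" "j < length w" and odd: "odd_at par Y (w ! i)" "odd_at par Z (w ! j)" for i j Y Z
  proof -
    let ?y = "Y (Poly_Mapping.single (w ! i) 1)" and ?z = "Z (Poly_Mapping.single (w ! j) 1)"
    let ?t = "\<lambda>x y. Poly_Mapping.single (w[i := y, j := x])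
      (c * hat_sign par i w * hat_sign par j w * Poly_Mapping.lookup ?y y * Poly_Mapping.lookup ?z x)"
    have "hat par i Y (hat par j Z (Poly_Mapping.single w c)) = (\<Sum>x\<in>Poly_Mapping.keys ?z. \<Sum>y\<in>Poly_Mapping.keys ?y. ?t x y)"
      unfolding hat_single_sum[of par j Z] additive.sum[OF hat_additive]
    proof (rule sum.cong[OF refl])
      fix x assume "x \<in> Poly_Mapping.keys ?z"
      then have "(-1 :: kfld) ^ par x = - ((-1) ^ par (w ! j))"
        using odd(2) by (simp add: odd_at_def)
      then have "hat_sign par i (w[j := x]) = hat_sign par i w"
        using hat_sign_update[OF ij(2)] ij(1) by simp
      then show "hat par i Y (Poly_Mapping.single (w[j := x]) (c * hat_sign par j w * Poly_Mapping.lookup ?z x))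
          = (\<Sum>y\<in>Poly_Mapping.keys ?y. ?t x y)"
        unfolding hat_single_sum using ij by (simp add: list_update_swap mult_ac)
    qed
    also have "\<dots> = (\<Sum>y\<in>Poly_Mapping.keys ?y. \<Sum>x\<in>Poly_Mapping.keys ?z. ?t x y)"
      by (rule sum.swap)
    also have "- \<dots> = hat par j Z (hat par i Y (Poly_Mapping.single w c))"
      unfolding hat_single_sum[of par i Y] additive.sum[OF hat_additive] sum_negf[symmetric]
    proof (rule sum.cong[OF refl])
      fix y assume "y \<in> Poly_Mapping.keys ?y"
      then have "(-1 :: kfld) ^ par y = - ((-1) ^ par (w ! i))"
        using odd(1) by (simp add: odd_at_def)
      then have s: "hat_sign par j (w[i := y]) = - hat_sign par j w"
        using hat_sign_update[of i w par y j] ij by simp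
      show "(\<Sum>x\<in>Poly_Mapping.keys ?z. - ?t x y) =
          hat par j Z (Poly_Mapping.single (w[i := y]) (c * hat_sign par i w * Poly_Mapping.lookup ?y y))"
        unfolding hat_single_sum s using ij by (simp add: mult_ac flip: single_uminus)
    qed
    finally show ?thesis by (metis minus_minus)
  qed
  show ?thesis
  proof (cases "i < j")
    case True
    then show ?thesis using key[of i j Y Z] assms by simp
  next
    case False
    then show ?thesis using key[of j i Z Y] assms by simp
  qed
qed

definition words :: "nat \<Rightarrow> 'x set \<Rightarrow> 'x list set" where
  "words n K = {w. length w = n \<and> set w \<subseteq> K}"

lemma hat_anticommute:
  assumes "Poly_Mapping.keys u \<subseteq> words n K" "i < n" "j < n" "i \<noteq> j"
    and "\<And>x. x \<in> K \<Longrightarrow> odd_at par Y x" "\<And>x. x \<in> K \<Longrightarrow> odd_at par Z x"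
  shows "hat par i Y (hat par j Z u) = - hat par j Z (hat par i Y u)"
proof (rule additive_eqI[where u = u])
  fix w c
  assume "w \<in> Poly_Mapping.keys u"
  then have "w \<in> words n K" using assms(1) by auto
  then show "hat par i Y (hat par j Z (Poly_Mapping.single w c)) = - hat par j Z (hat par i Y (Poly_Mapping.single w c))"
    using assms(2-4) subsetD[OF _ nth_mem, of w K]
    by (intro hat_anticommute_single assms(5,6)) (auto simp: words_def)
qed (intro additive_uminus additive_comp[OF hat_additive] hat_additive)+

lemma hat_square:
  assumes "Poly_Mapping.keys u \<subseteq> words n K" "j < n"
    and Y: "additive Y" "\<And>c u. Y (scale c u) = scale c (Y u)"
    and "\<And>x. x \<in> K \<Longrightarrow> Y (Y (Poly_Mapping.single x 1)) = 0"
  shows "hat par j Y (hat par j Y u) = 0"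
proof (rule additive_eqI[where u = u and g = "\<lambda>_. 0"])
  fix w c
  assume "w \<in> Poly_Mapping.keys u"
  then have "w \<in> words n K" using assms(1) by auto
  then have "w ! j \<in> K" "j < length w" using assms(2) by (auto simp: words_def)
  then show "hat par j Y (hat par j Y (Poly_Mapping.single w c)) = 0"
    using hat_hat_same[OF _ Y] assms(5) by (simp add: insert_at_def)
qed (intro additive_zero additive_comp[OF hat_additive] hat_additive)+

lemma hat_free_module:
  assumes A: "coeff_ring A" and "j < n" "u \<in> free_module (words n K) A"
    and Y: "\<And>x. x \<in> K \<Longrightarrow> Y (Poly_Mapping.single x 1) \<in> free_module K A"
  shows "hat par j Y u \<in> free_module (words n K) A"
proof -
  interpret coeff_ring A by (rule A)
  show ?thesis
    unfolding hat_def Let_def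
  proof (rule lin_ext_free_module[OF assms(3)])
    fix w :: "'a list"
    assume w: "w \<in> words n K"
    then have "w ! j \<in> K" using \<open>j < n\<close> by (auto simp: words_def)
    then have y: "Y (Poly_Mapping.single (w ! j) 1) \<in> free_module K A" by (rule Y)
    have "w[j := x] \<in> words n K" if "x \<in> K" for x
      using w that set_update_subset_insert[of w j x] by (auto simp: words_def)
    then show "(\<Sum>x\<in>Poly_Mapping.keys (Y (Poly_Mapping.single (w ! j) 1)). Poly_Mapping.single (w[j := x])
       ((- 1) ^ (\<Sum>i<j. par (w ! i)) * Poly_Mapping.lookup (Y (Poly_Mapping.single (w ! j) 1)) x)) \<in> free_module (words n K) A"
      using y by (intro free_module_closed mult sign) (auto simp: free_module_def)
  qed
qed

lemma keys_hat_single: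
  "w' \<in> Poly_Mapping.keys (hat par j Y (Poly_Mapping.single w c)) \<Longrightarrow>
    \<exists>x\<in>Poly_Mapping.keys (Y (Poly_Mapping.single (w ! j) 1)). w' = w[j := x]"
  unfolding hat_single_sum by (drule subsetD[OF keys_sum]) (auto split: if_splits)

section \<open>The operators on one copy\<close>

lemma h1_single: "h1 s B Plus (Poly_Mapping.single (c, l) k) =
    (case l of E0 \<Rightarrow> Poly_Mapping.single (c, Eth) (k * inverse (pi_plus s c B))
       | Ethb \<Rightarrow> Poly_Mapping.single (c, E2) (k * (kconst (2*\<i>) * inverse (beta c B)))
       | _ \<Rightarrow> 0)"
  by (cases l) (simp_all add: h1_def lin_ext_single scale_single)

lemma h1_linear: "additive (h1 s B \<sigma>)" "h1 s B \<sigma> (scale c u) = scale c (h1 s B \<sigma> u)"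
  by (simp_all add: h1_def additive_lin_ext lin_ext_scale)

lemma h1_square: "h1 s B Plus (h1 s B Plus (Poly_Mapping.single x 1)) = 0"
  by (cases x; cases "snd x") (auto simp: h1_single additive.zero[OF h1_linear(1)])

lemma keys_h1:
  assumes "y \<in> Poly_Mapping.keys (h1 s B Plus (Poly_Mapping.single x 1))"
  shows "fst y = fst x" "snd y \<in> {Ethb, E2} \<longleftrightarrow> snd x \<in> {Ethb, E2}"
    "(-1 :: kfld) ^ pair_par y = - ((-1) ^ pair_par x)"
  using assms by (cases x; cases "snd x"; auto simp: h1_single pair_par_def split: if_splits)+

lemma h_plus_linear: "additive (h_plus q m n k)" "h_plus q m n k (scale c u) = scale c (h_plus q m n k u)"
  unfolding h_plus_def
  by (intro additive_comp[OF additive_scale] additive_sum_fun hat_additive)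
    (simp add: hat_scale scale_scale mult.commute flip: scale_sum)

lemma add_self_eq_0: "u + u = 0 \<Longrightarrow> u = (0 :: 'x \<Rightarrow>\<^sub>0 kfld)"
proof -
  assume "u + u = 0"
  have k: "kconst (1/2) + kconst (1/2) = 1" by (simp flip: kconst_add)
  have "u = scale (kconst (1/2) + kconst (1/2)) u" unfolding k by simp
  also have "\<dots> = scale (kconst (1/2)) (u + u)" by (simp only: scale_add_left scale_add)
  finally show "u = 0" using \<open>u + u = 0\<close> by simp
qed

lemma words_UNIV: "words n UNIV = {w. length w = n}"
  by (simp add: words_def)

text \<open>The double sum is antisymmetric under exchange of its two indices: distinct pairs
  anticommute by parity, and equal pairs give 0. So it equals its own negative, and the coefficients
  allow division by 2.\<close>

lemma h_plus_square:
  assumes "Poly_Mapping.keys u \<subseteq> words n UNIV"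
  shows "h_plus q m n k (h_plus q m n k u) = 0"
proof -
  let ?h = "\<lambda>j. hat pair_par j (h1 (s_par q m n) (kvar (k, j)) Plus)"
  let ?S = "\<Sum>i<n. \<Sum>j<n. ?h i (?h j u)"
  have odd: "odd_at pair_par (h1 s B Plus) x" for s B x
    by (simp add: odd_at_def keys_h1)
  have anti: "?h i (?h j u) = - ?h j (?h i u)" if "i < n" "j < n" for i j
  proof (cases "i = j")
    case True
    then show ?thesis
      using hat_square[OF assms that(2) h1_linear(1) h1_linear(2)] h1_square by simp
  qed (use hat_anticommute[OF assms that] odd in blast)
  have "?S = (\<Sum>i<n. \<Sum>j<n. - ?h j (?h i u))"
    by (intro sum.cong refl anti) auto
  also have "\<dots> = - ?S"
    unfolding sum_negf by (subst sum.swap) (rule refl)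
  finally have "?S + ?S = 0" by (rule eq_neg_iff_add_eq_0[THEN iffD1])
  then have "?S = 0" by (rule add_self_eq_0)
  moreover have "h_plus q m n k (h_plus q m n k u) = scale (kconst (1 / of_nat n)) (scale (kconst (1 / of_nat n)) ?S)"
    by (simp only: h_plus_def hat_scale additive.sum[OF hat_additive] scale_sum)
  ultimately show ?thesis by (simp only: scale_0)
qed

lemma keys_h_plus_single:
  assumes "w' \<in> Poly_Mapping.keys (h_plus q m n k (Poly_Mapping.single w c))"
  obtains j x where "j < n" "x \<in> Poly_Mapping.keys (h1 (s_par q m n) (kvar (k, j)) Plus (Poly_Mapping.single (w ! j) 1))" "w' = w[j := x]"
proof -
  have "w' \<in> Poly_Mapping.keys (\<Sum>j<n. hat pair_par j (h1 (s_par q m n) (kvar (k, j)) Plus) (Poly_Mapping.single w c))"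
    using assms unfolding h_plus_def by (rule subsetD[OF keys_scale_subset])
  from subsetD[OF keys_sum this] obtain j where "j < n" "w' \<in> Poly_Mapping.keys (hat pair_par j (h1 (s_par q m n) (kvar (k, j)) Plus) (Poly_Mapping.single w c))"
    by auto
  from keys_hat_single[OF this(2)] show thesis using that \<open>j < n\<close> by blast
qed

lemma fk_par_update:
  assumes "j < length w" "(-1 :: kfld) ^ pair_par x = - ((-1) ^ pair_par (w ! j))"
  shows "(-1 :: kfld) ^ fk_par (w[j := x]) = - ((-1) ^ fk_par w)"
  using assms
proof (induction w arbitrary: j)
  case (Cons a w)
  then show ?case by (cases j) (auto simp: fk_par_def power_add)
qed simp

section \<open>The fermionic operator of type \<open>Plus\<close>\<close>

definition M_eigenvalue :: "real \<Rightarrow> nat \<Rightarrow> nat \<Rightarrow> nat \<Rightarrow> nat \<Rightarrow> fk_idx \<Rightarrow> kfld" where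
  "M_eigenvalue q m n k r w = kconst (of_real (delta_m q m)) +
     (\<Sum>S\<in>Pow {..<n} - {{}}. PS_plus n S w *
        ((\<Sum>j\<in>S. kappa_plus (s_par q m n) (fst (w ! j)) (kvar (k, j)))
         - of_nat (card S)
         - kconst (of_real (Bq q (card S) r)) * (\<Sum>j\<in>S. Kc (fst (w ! j)) (kvar (k, j)))))"

lemma M_plus_alt: "M_plus q m n k r = diag (M_eigenvalue q m n k r)"
  unfolding M_plus_def M_eigenvalue_def ..

lemma diag_linear: "additive (diag g)" "diag g (scale c u) = scale c (diag g u)"
  by (simp_all add: diag_def additive_lin_ext lin_ext_scale)

lemma diag_single: "diag g (Poly_Mapping.single w c) = Poly_Mapping.single w (c * g w)"
  by (simp add: diag_def lin_ext_single scale_single)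

lemma diag_constant:
  assumes "\<And>w. w \<in> Poly_Mapping.keys u \<Longrightarrow> g w = c"
  shows "diag g u = scale c u"
proof (rule additive_eqI[where u = u, OF diag_linear(1) additive_scale])
  fix w d assume "w \<in> Poly_Mapping.keys u"
  then show "diag g (Poly_Mapping.single w d) = scale c (Poly_Mapping.single w d)"
    by (simp add: diag_single scale_single assms mult.commute)
qed

lemma M_eigenvalue_cong:
  assumes "\<And>j. j < n \<Longrightarrow> fst (w' ! j) = fst (w ! j)"
    and "\<And>j. j < n \<Longrightarrow> snd (w' ! j) \<in> {Ethb, E2} \<longleftrightarrow> snd (w ! j) \<in> {Ethb, E2}"
  shows "M_eigenvalue q m n k r w' = M_eigenvalue q m n k r w"
proof -
  have P: "P_plus j w' = P_plus j w" if "j < n" for j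
    using assms(2)[OF that] by (simp only: P_plus_def)
  have PS: "PS_plus n S w' = PS_plus n S w" if "S \<subseteq> {..<n}" for S
    unfolding PS_plus_def using that
    by (intro arg_cong2[of _ _ _ _ "(*)"] prod.cong refl) (auto simp: P)
  have "(\<Sum>j\<in>S. f (fst (w' ! j)) j) = (\<Sum>j\<in>S. f (fst (w ! j)) j)" if "S \<subseteq> {..<n}" for S and f :: "int \<Rightarrow> nat \<Rightarrow> kfld"
    using that by (intro sum.cong refl) (auto simp: assms(1))
  from this[of _ "\<lambda>c j. kappa_plus (s_par q m n) c (kvar (k, j))"] this[of _ "\<lambda>c j. Kc c (kvar (k, j))"]
  have "(\<Sum>j\<in>S. kappa_plus (s_par q m n) (fst (w' ! j)) (kvar (k, j))) = (\<Sum>j\<in>S. kappa_plus (s_par q m n) (fst (w ! j)) (kvar (k, j)))"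
    "(\<Sum>j\<in>S. Kc (fst (w' ! j)) (kvar (k, j))) = (\<Sum>j\<in>S. Kc (fst (w ! j)) (kvar (k, j)))" if "S \<subseteq> {..<n}" for S
    using that by auto
  then show ?thesis
    unfolding M_eigenvalue_def
    by (intro arg_cong2[of _ _ _ _ "(+)"] sum.cong refl) (simp add: PS)
qed

lemma N_plus_linear: "additive (N_plus q m n k r)" "N_plus q m n k r (scale c u) = scale c (N_plus q m n k r u)"
  unfolding N_plus_def[abs_def] M_plus_alt
  by (intro additive_uminus additive_comp[OF h_plus_linear(1)] diag_linear)
    (simp add: diag_linear h_plus_linear scale_minus)

lemma N_plus_single:
  "N_plus q m n k r (Poly_Mapping.single w c) = - h_plus q m n k (Poly_Mapping.single w (c * M_eigenvalue q m n k r w))"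
  by (simp add: N_plus_def M_plus_alt diag_single)

lemma h_plus_keeps_M_eigenvalue:
  assumes "length w = n" "w' \<in> Poly_Mapping.keys (h_plus q m n k (Poly_Mapping.single w c))"
  shows "M_eigenvalue q m n k r w' = M_eigenvalue q m n k r w"
proof -
  obtain j x where jx: "j < n" "x \<in> Poly_Mapping.keys (h1 (s_par q m n) (kvar (k, j)) Plus (Poly_Mapping.single (w ! j) 1))" "w' = w[j := x]"
    using assms(2) by (rule keys_h_plus_single)
  have "fst (w' ! i) = fst (w ! i)" "snd (w' ! i) \<in> {Ethb, E2} \<longleftrightarrow> snd (w ! i) \<in> {Ethb, E2}" for i
    using keys_h1(1,2)[OF jx(2)] jx(1,3) assms(1) by (cases "i = j"; simp)+
  then show ?thesis by (rule M_eigenvalue_cong)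
qed

text \<open>The same degree \<open>r\<close> stands in both factors. This is the case met in a
  square of the transported operator, since the contraction does not alter the degree read by its
  own type.\<close>

lemma N_plus_square:
  assumes "Poly_Mapping.keys u \<subseteq> words n UNIV"
  shows "N_plus q m n k r (N_plus q m n k r u) = 0"
proof (rule additive_eqI[where u = u and g = "\<lambda>_. 0"])
  fix w c
  assume "w \<in> Poly_Mapping.keys u"
  then have w: "length w = n" using assms by (auto simp: words_def)
  define \<gamma> where "\<gamma> = M_eigenvalue q m n k r w"
  let ?u = "Poly_Mapping.single w (c * \<gamma>)"
  have u: "Poly_Mapping.keys ?u \<subseteq> words n UNIV" using w by (simp add: words_def)
  \<comment> \<open>All basis vectors occurring in the image have the eigenvalue of
    \<open>w\<close>, so the diagonal operator acts there as a scalar and can be pulled out.\<close>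
  have d: "diag (M_eigenvalue q m n k r) (h_plus q m n k ?u) = scale \<gamma> (h_plus q m n k ?u)"
    by (rule diag_constant) (use h_plus_keeps_M_eigenvalue[OF w] in \<open>auto simp: \<gamma>_def\<close>)
  have "N_plus q m n k r (N_plus q m n k r (Poly_Mapping.single w c)) = - N_plus q m n k r (h_plus q m n k ?u)"
    by (simp add: N_plus_single \<gamma>_def additive.minus[OF N_plus_linear(1)])
  also have "\<dots> = h_plus q m n k (scale \<gamma> (h_plus q m n k ?u))"
    by (simp add: N_plus_def M_plus_alt d)
  also have "\<dots> = 0"
    by (simp only: h_plus_linear h_plus_square[OF u] scale_0)
  finally show "N_plus q m n k r (N_plus q m n k r (Poly_Mapping.single w c)) = 0" .
qed (intro additive_zero additive_comp[OF N_plus_linear(1)] N_plus_linear(1))+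

lemma N_plus_keys:
  assumes "length w = n" "w' \<in> Poly_Mapping.keys (N_plus q m n k r (Poly_Mapping.single w c))"
  shows "length w' = n" "(-1 :: kfld) ^ fk_par w' = - ((-1) ^ fk_par w)"
proof -
  have "w' \<in> Poly_Mapping.keys (h_plus q m n k (Poly_Mapping.single w (c * M_eigenvalue q m n k r w)))"
    using assms(2) by (simp add: N_plus_single)
  then obtain j x where jx: "j < n" "x \<in> Poly_Mapping.keys (h1 (s_par q m n) (kvar (k, j)) Plus (Poly_Mapping.single (w ! j) 1))" "w' = w[j := x]"
    by (rule keys_h_plus_single)
  then show "length w' = n" "(-1 :: kfld) ^ fk_par w' = - ((-1) ^ fk_par w)"
    using fk_par_update[of j w x] keys_h1(3)[OF jx(2)] assms(1) by auto
qed

lemma N_plus_free_module: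
  assumes "length w = n" "\<And>j. j < n \<Longrightarrow> (k, j) \<in> V"
  shows "N_plus q m n k r (Poly_Mapping.single w 1) \<in> free_module (words n UNIV) (A_min (s_par q m n) V)"
proof -
  have "P_plus j w \<in> A_min s V" for j s
    by (simp add: P_plus_def A_min.zero A_min.one)
  then have "PS_plus n S w \<in> A_min s V" for S s
    unfolding PS_plus_def by (intro A_min.mult A_min.prod A_min.diff A_min.one) auto
  then have M: "M_eigenvalue q m n k r w \<in> A_min (s_par q m n) V"
    unfolding M_eigenvalue_def
    by (intro A_min.add A_min.sum A_min.mult A_min.diff A_min.of_nat kconst_A_min pair_coefficients_A_min)
      (auto intro: assms(2))
  have h1: "h1 (s_par q m n) (kvar (k, j)) Plus (Poly_Mapping.single x 1) \<in> free_module UNIV (A_min (s_par q m n) V)"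
    if "j < n" for j x
    by (cases x; cases "snd x")
      (use pair_coefficients_A_min[OF assms(2)[OF that]] in
        \<open>auto simp: h1_single intro!: A_min.free_module_closed A_min.mult kconst_A_min\<close>)
  show ?thesis
    unfolding N_plus_single h_plus_def
    by (intro A_min.free_module_closed kconst_A_min hat_free_module[OF A_min_ring] h1)
      (use M assms(1) in \<open>auto simp: words_def\<close>)
qed

section \<open>Conjugation on one copy\<close>

lemma kcnj_basic [simp]: "kcnj 0 = 0" "kcnj 1 = 1" "kcnj (- x) = - kcnj x"
proof -
  show 0: "kcnj 0 = 0" using kcnj_kconst[of 0] by simp
  show "kcnj 1 = 1" using kcnj_kconst[of 1] by simp
  have "kcnj (- x) + kcnj x = 0" unfolding kcnj_add[symmetric] by (simp add: 0)
  then show "kcnj (- x) = - kcnj x" by (simp add: add_eq_0_iff2)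
qed

lemma conj_ext_additive: "additive (conj_ext d \<epsilon>)"
proof
  fix u v :: "'a \<Rightarrow>\<^sub>0 kfld"
  have sup: "conj_ext d \<epsilon> u = (\<Sum>x\<in>K. Poly_Mapping.single (d x) (\<epsilon> x * kcnj (Poly_Mapping.lookup u x)))"
    if "finite K" "Poly_Mapping.keys u \<subseteq> K" for u :: "'a \<Rightarrow>\<^sub>0 kfld" and K
    unfolding conj_ext_def by (rule sum.mono_neutral_left) (use that in \<open>auto simp: in_keys_iff\<close>)
  let ?K = "Poly_Mapping.keys u \<union> Poly_Mapping.keys v"
  show "conj_ext d \<epsilon> (u + v) = conj_ext d \<epsilon> u + conj_ext d \<epsilon> v"
    using keys_add[of u v]
    by (simp add: sup[of ?K] lookup_add kcnj_add distrib_left single_add sum.distrib)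
qed

lemma conj_ext_scale: "conj_ext d \<epsilon> (scale c u) = scale (kcnj c) (conj_ext d \<epsilon> u)"
  by (rule additive_eqI[where u = u])
    (intro additive_comp[OF conj_ext_additive] additive_comp[OF additive_scale] conj_ext_additive additive_scale
      | simp add: conj_ext_single scale_single kcnj_mult mult_ac)+

abbreviation fk_dag_sign :: "fk_idx \<Rightarrow> kfld" where
  "fk_dag_sign w \<equiv> prod_list (map pair_dag_sign w)"

lemma pair_dag_simps:
  "pair_dag (pair_dag x) = x" "pair_dag_sign (pair_dag x) = pair_dag_sign x" "pair_dag_sign x * pair_dag_sign x = 1"
  "kcnj (pair_dag_sign x) = pair_dag_sign x" "pair_par (pair_dag x) = pair_par x"
  by (cases x; cases "snd x"; simp add: pair_dag_def pair_dag_sign_def pair_par_def)+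

lemma kcnj_kcnj: "kcnj (kcnj x) = x"
proof -
  have "bcnj (bcnj p) = p" for p
    by (rule poly_mapping_eqI) (simp add: lookup_bcnj)
  then show ?thesis by (cases x) (simp add: kcnj_Fract)
qed

lemma fk_dag_sign_simps:
  "fk_dag_sign (map pair_dag w) = fk_dag_sign w" "fk_dag_sign w * fk_dag_sign w = 1"
  "kcnj (fk_dag_sign w) = fk_dag_sign w"
  "map pair_dag (map pair_dag w) = w" "fk_par (map pair_dag w) = fk_par w"
  "fk_dag_sign w = 1 \<or> fk_dag_sign w = -1"
proof -
  show sq: "fk_dag_sign w * fk_dag_sign w = 1"
  proof (induction w)
    case (Cons a w)
    have "fk_dag_sign (a # w) * fk_dag_sign (a # w) = (pair_dag_sign a * pair_dag_sign a) * (fk_dag_sign w * fk_dag_sign w)"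
      by (simp add: mult_ac)
    then show ?case by (simp only: Cons pair_dag_simps mult_1)
  qed simp
  show "fk_dag_sign w = 1 \<or> fk_dag_sign w = -1"
    using sq by (simp add: square_eq_1_iff)
qed (induction w; simp add: pair_dag_simps kcnj_mult fk_par_def)+

lemma fk_dag_single: "fk_dag (Poly_Mapping.single w c) = Poly_Mapping.single (map pair_dag w) (fk_dag_sign w * kcnj c)"
  by (simp add: fk_dag_def conj_ext_single)

lemma fk_dag_additive: "additive fk_dag"
  unfolding fk_dag_def by (rule conj_ext_additive)

lemma fk_dag_scale: "fk_dag (scale c u) = scale (kcnj c) (fk_dag u)"
  unfolding fk_dag_def by (rule conj_ext_scale)

lemma fk_dag_fk_dag: "fk_dag (fk_dag u) = u"
proof (rule additive_eqI[where u = u])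
  fix w c
  have "fk_dag_sign w * (fk_dag_sign w * c) = c"
    by (simp only: mult.assoc[symmetric] fk_dag_sign_simps mult_1)
  then show "fk_dag (fk_dag (Poly_Mapping.single w c)) = Poly_Mapping.single w c"
    by (simp only: fk_dag_single fk_dag_sign_simps kcnj_mult kcnj_kcnj)
qed (intro additive_comp[OF fk_dag_additive] fk_dag_additive additive_id)+

lemma keys_fk_dag: "Poly_Mapping.keys (fk_dag u) \<subseteq> map pair_dag ` Poly_Mapping.keys u"
  by (rule keys_additive_subset[OF fk_dag_additive]) (auto simp: fk_dag_single)

lemma fk_dag_free_module:
  assumes "u \<in> free_module (words n UNIV) (A_min s V)"
  shows "fk_dag u \<in> free_module (words n UNIV) (A_min s V)"
  unfolding fk_dag_def conj_ext_def
proof (intro A_min.free_module_closed(5,6) A_min.mult A_min_closed(3))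
  fix w assume "w \<in> Poly_Mapping.keys u"
  with assms show "map pair_dag w \<in> words n UNIV" "Poly_Mapping.lookup u w \<in> A_min s V"
    by (auto simp: free_module_def words_def)
  show "fk_dag_sign w \<in> A_min s V"
    using fk_dag_sign_simps(6)[of w] A_min.one A_min.minus_one by auto
qed

lemma N_op_Minus: "N_op q m n k Minus r = (\<lambda>u. fk_dag (N_plus q m n k r (fk_dag u)))"
  by (simp add: fun_eq_iff)

lemma N_op_Plus: "N_op q m n k Plus r = N_plus q m n k r"
  by (simp add: fun_eq_iff)

lemma N_op_linear: "additive (N_op q m n k \<sigma> r)" "N_op q m n k \<sigma> r (scale c u) = scale c (N_op q m n k \<sigma> r u)"
proof -
  show "additive (N_op q m n k \<sigma> r)"
    by (cases \<sigma>) (simp_all add: N_op_Minus N_op_Plus N_plus_linear additive_comp[OF fk_dag_additive]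
      additive_comp[OF N_plus_linear(1) fk_dag_additive])
  show "N_op q m n k \<sigma> r (scale c u) = scale c (N_op q m n k \<sigma> r u)"
    by (cases \<sigma>) (simp_all add: N_plus_linear fk_dag_scale kcnj_kcnj)
qed

lemma N_op_square:
  assumes "length w = n"
  shows "N_op q m n k \<sigma> r (N_op q m n k \<sigma> r (Poly_Mapping.single w 1)) = 0"
proof (cases \<sigma>)
  case Plus
  then show ?thesis using assms by (simp add: N_plus_square words_def)
next
  case Minus
  have "N_plus q m n k r (N_plus q m n k r (fk_dag (Poly_Mapping.single w 1))) = 0"
    using keys_fk_dag[of "Poly_Mapping.single w 1"] assms
    by (intro N_plus_square) (auto simp: words_def)
  then show ?thesis
    by (simp add: Minus fk_dag_fk_dag additive.zero[OF fk_dag_additive])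
qed

lemma N_op_odd:
  assumes "length w = n"
  shows "odd_at fk_par (N_op q m n k \<sigma> r) w"
  unfolding odd_at_def
proof
  fix w' assume w': "w' \<in> Poly_Mapping.keys (N_op q m n k \<sigma> r (Poly_Mapping.single w 1))"
  show "(-1 :: kfld) ^ fk_par w' = - ((-1) ^ fk_par w)"
  proof (cases \<sigma>)
    case Plus
    then show ?thesis using N_plus_keys(2)[OF assms] w' by simp
  next
    case Minus
    then obtain v where v: "w' = map pair_dag v" "v \<in> Poly_Mapping.keys (N_plus q m n k r (fk_dag (Poly_Mapping.single w 1)))"
      using w' keys_fk_dag by fastforce
    have "length (map pair_dag w) = n" using assms by simp
    from N_plus_keys(2)[OF this] v(2) show ?thesis
      unfolding v(1) fk_dag_single fk_dag_sign_simps(5) by simp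
  qed
qed

text \<open>Type \<open>Minus\<close> follows from type \<open>Plus\<close>, as conjugation
  preserves the localization. The set \<open>V\<close> may contain more variables than those of copy
  \<open>k\<close>, so that all copies share one coefficient ring.\<close>

lemma N_op_free_module:
  assumes "length w = n" "\<And>j. j < n \<Longrightarrow> (k, j) \<in> V"
  shows "N_op q m n k \<sigma> r (Poly_Mapping.single w 1) \<in> free_module (words n UNIV) (A_min (s_par q m n) V)"
proof (cases \<sigma>)
  case Plus
  then show ?thesis using N_plus_free_module[OF assms] by simp
next
  case Minus
  have "fk_dag (Poly_Mapping.single w 1) = scale (fk_dag_sign w) (Poly_Mapping.single (map pair_dag w) 1)"
    by (simp add: fk_dag_single scale_single)
  moreover have "fk_dag_sign w \<in> A_min (s_par q m n) V"
    using fk_dag_sign_simps(6)[of w] A_min.one A_min.minus_one by auto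
  ultimately show ?thesis
    using N_plus_free_module[of "map pair_dag w" n k V q m r] assms
    by (simp add: Minus N_plus_linear fk_dag_free_module A_min.free_module_closed)
qed

section \<open>The transported operators\<close>

text \<open>In contrast to \<open>additive_eqI\<close> the test vectors keep the coefficients of
  \<open>u\<close>. For \<open>u\<close> in \<open>MM\<close> these lie in \<open>F_tot\<close>,
  which an arbitrary coefficient need not do.\<close>

lemma additive_eqI_lookup:
  fixes f g :: "('i \<Rightarrow>\<^sub>0 'r::ab_group_add) \<Rightarrow> 'b::ab_group_add"
  assumes "additive f" "additive g"
    and "\<And>i. i \<in> Poly_Mapping.keys u \<Longrightarrow> f (Poly_Mapping.single i (Poly_Mapping.lookup u i)) = g (Poly_Mapping.single i (Poly_Mapping.lookup u i))"
  shows "f u = g u"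
proof -
  let ?s = "\<Sum>i\<in>Poly_Mapping.keys u. Poly_Mapping.single i (Poly_Mapping.lookup u i)"
  have "f ?s = g ?s"
    unfolding additive.sum[OF assms(1)] additive.sum[OF assms(2)] by (rule sum.cong[OF refl assms(3)])
  then show ?thesis by (simp only: sum_singles[symmetric])
qed

lemma lookup_mscale: "Poly_Mapping.lookup (mscale c u) b = scale (kconst c) (Poly_Mapping.lookup u b)"
  by (simp add: mscale_def map.rep_eq when_def)

lemma lookup_tensor: "Poly_Mapping.lookup (tensor F e) b = scale (kconst (Poly_Mapping.lookup F b)) e"
proof -
  have "Poly_Mapping.lookup (tensor F e) b =
      (\<Sum>b'\<in>Poly_Mapping.keys F. if b' = b then scale (kconst (Poly_Mapping.lookup F b)) e else 0)"
    unfolding tensor_def lookup_sum by (rule sum.cong) (auto simp: lookup_single when_def)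
  then show ?thesis by (simp add: in_keys_iff)
qed

lemma mscale_simps:
  "mscale c 0 = 0" "mscale 1 u = u" "mscale 0 u = 0" "mscale c (mscale d u) = mscale (c * d) u" "mscale c (- u) = - mscale c u"
  "mscale (- c) u = - mscale c u" "mscale c (u + v) = mscale c u + mscale c v" "mscale (c + d) u = mscale c u + mscale d u"
  by (rule poly_mapping_eqI, simp add: lookup_mscale lookup_add scale_scale scale_add scale_add_left scale_minus
      scale_minus_left kconst_mult kconst_add kconst_minus)+

lemma additive_mscale: "additive (mscale c)"
  by (simp add: additive_def mscale_simps)

lemma tensor_simps:
  "tensor (F + G) e = tensor F e + tensor G e" "tensor (- F) e = - tensor F e" "tensor F (- e) = - tensor F e"
  "tensor F (e + e') = tensor F e + tensor F e'" "tensor F (scale (kconst c) e) = mscale c (tensor F e)"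
  "tensor (scale c F) e = mscale c (tensor F e)" "tensor F 0 = 0" "tensor 0 e = 0"
  by (rule poly_mapping_eqI, simp add: lookup_mscale lookup_tensor lookup_add lookup_scale scale_scale scale_add scale_add_left
      scale_minus scale_minus_left kconst_mult kconst_add kconst_minus mult.commute)+

text \<open>\<open>X\<close> is evaluated only at basis elements, so additivity in \<open>u\<close>
  comes from \<open>Y\<close> alone.\<close>

lemma tensor_odd_additive:
  assumes Y: "\<And>b. additive (Y b)"
  shows "additive (tensor_odd X Y)"
proof
  fix u v :: mspace
  define t where "t = (\<lambda>b e. case b of (\<mu>, \<nu>, A) \<Rightarrow> mscale ((-1) ^ card A) (tensor (X (Poly_Mapping.single b 1)) (Y b e)))"
  have t: "t b (e + e') = t b e + t b e'" "t b 0 = 0" for b e e'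
    by (cases b; simp add: t_def additiveD[OF Y] additive.zero[OF Y] tensor_simps mscale_simps)+
  have sup: "tensor_odd X Y u = (\<Sum>b\<in>K. t b (Poly_Mapping.lookup u b))"
    if "finite K" "Poly_Mapping.keys u \<subseteq> K" for u K
    unfolding tensor_odd_def t_def[symmetric]
    by (rule sum.mono_neutral_cong_left) (use that t in \<open>auto simp: in_keys_iff t_def\<close>)
  let ?K = "Poly_Mapping.keys u \<union> Poly_Mapping.keys v"
  show "tensor_odd X Y (u + v) = tensor_odd X Y u + tensor_odd X Y v"
    using keys_add[of u v] by (simp add: sup[of ?K] lookup_add t sum.distrib)
qed

lemma tensor_odd_single:
  assumes Y: "\<And>b. additive (Y b)"
  shows "tensor_odd X Y (Poly_Mapping.single b e) =
    mscale ((-1) ^ card (snd (snd b))) (tensor (X (Poly_Mapping.single b 1)) (Y b e))"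
  by (cases b) (simp add: tensor_odd_def additive.zero[OF Y] tensor_simps mscale_simps)

text \<open>Both the fermionic operator and the sign depend on the monomial. Where they are constant
  on the support of \<open>F\<close>, they factor out, and the rule for a product of tensor
  operators is recovered.\<close>

lemma tensor_odd_tensor:
  assumes Y: "\<And>b. additive (Y b)" "\<And>b c e. Y b (scale c e) = scale c (Y b e)"
    and const: "\<And>b. b \<in> Poly_Mapping.keys F \<Longrightarrow> Y b e = e'" "\<And>b. b \<in> Poly_Mapping.keys F \<Longrightarrow> (-1) ^ card (snd (snd b)) = p"
  shows "tensor_odd X Y (tensor F e) = mscale p (tensor (lin_ext (\<lambda>b. X (Poly_Mapping.single b 1)) F) e')"
proof -
  have add_left: "additive (\<lambda>F. tensor F e')"
    by (simp add: additive_def tensor_simps)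
  have "tensor_odd X Y (tensor F e) =
      (\<Sum>b\<in>Poly_Mapping.keys F. tensor_odd X Y (Poly_Mapping.single b (scale (kconst (Poly_Mapping.lookup F b)) e)))"
    unfolding tensor_def additive.sum[OF tensor_odd_additive[OF Y(1)]] ..
  also have "\<dots> = (\<Sum>b\<in>Poly_Mapping.keys F. mscale p (tensor (scale (Poly_Mapping.lookup F b) (X (Poly_Mapping.single b 1))) e'))"
    by (rule sum.cong) (simp_all add: tensor_odd_single Y const tensor_simps)
  also have "\<dots> = mscale p (tensor (lin_ext (\<lambda>b. X (Poly_Mapping.single b 1)) F) e')"
    unfolding lin_ext_def additive.sum[OF add_left] additive.sum[OF additive_mscale] ..
  finally show ?thesis .
qed

abbreviation Y_op :: "real \<Rightarrow> nat \<Rightarrow> nat \<Rightarrow> pm \<Rightarrow> nat \<Rightarrow> pidx \<Rightarrow> ftot \<Rightarrow> ftot" where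
  "Y_op q m n \<sigma> i b \<equiv> hat fk_par i (N_op q m n i \<sigma> (euler_deg m \<sigma> i b))"

lemma HH_additive: "additive (HH q m n N \<sigma> i)"
  unfolding HH_def by (rule tensor_odd_additive[OF hat_additive])

lemma HH_single: "HH q m n N \<sigma> i (Poly_Mapping.single b e) =
    mscale ((-1) ^ card (snd (snd b))) (tensor (n_op m N \<sigma> i (Poly_Mapping.single b 1)) (Y_op q m n \<sigma> i b e))"
  unfolding HH_def by (rule tensor_odd_single[OF hat_additive])

lemma mscale_single: "mscale c (Poly_Mapping.single b e) = Poly_Mapping.single b (scale (kconst c) e)"
  by (rule poly_mapping_eqI) (simp add: lookup_mscale lookup_single when_def)

lemma HH_mscale: "HH q m n N \<sigma> i (mscale c u) = mscale c (HH q m n N \<sigma> i u)"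
  by (rule additive_eqI[where u = u])
    (intro additive_comp[OF HH_additive] additive_comp[OF additive_mscale] additive_mscale HH_additive
      | simp add: mscale_single HH_single hat_scale tensor_simps mscale_simps mult.commute)+

lemma F_tot_alt: "F_tot q m n N = free_module (words N {x. length x = n}) (A_min (s_par q m n) ({..<N} \<times> {..<n}))"
  by (auto simp: F_tot_def free_module_def words_def F_basis_def)

lemma MM_D: "u \<in> MM q m n N \<Longrightarrow> b \<in> Poly_Mapping.keys u \<Longrightarrow> b \<in> PCl_basis m N"
  "u \<in> MM q m n N \<Longrightarrow> Poly_Mapping.lookup u b \<in> F_tot q m n N"
  unfolding MM_def by blast+

lemma MM_closed:
  "0 \<in> MM q m n N"
  "u \<in> MM q m n N \<Longrightarrow> v \<in> MM q m n N \<Longrightarrow> u + v \<in> MM q m n N"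
  "u \<in> MM q m n N \<Longrightarrow> v \<in> MM q m n N \<Longrightarrow> u - v \<in> MM q m n N"
  "u \<in> MM q m n N \<Longrightarrow> mscale c u \<in> MM q m n N"
  "F \<in> PCl m N \<Longrightarrow> e \<in> F_tot q m n N \<Longrightarrow> tensor F e \<in> MM q m n N"
proof -
  note F = A_min.free_module_closed[where K = "words N {x :: fk_idx. length x = n}", where s = "s_par q m n" and V = "{..<N} \<times> {..<n}", folded F_tot_alt]
  show "0 \<in> MM q m n N" by (simp add: MM_def F)
  show "u \<in> MM q m n N \<Longrightarrow> v \<in> MM q m n N \<Longrightarrow> u + v \<in> MM q m n N"
    using keys_add[of u v] by (auto simp: MM_def lookup_add F)
  show "u \<in> MM q m n N \<Longrightarrow> v \<in> MM q m n N \<Longrightarrow> u - v \<in> MM q m n N"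
    using keys_diff[of u v] F(2)[OF _ F(3)] by (auto simp: MM_def lookup_minus)
  show "u \<in> MM q m n N \<Longrightarrow> mscale c u \<in> MM q m n N"
    by (auto simp: MM_def in_keys_iff subset_iff lookup_mscale F kconst_A_min) (metis scale_0)
  show "F \<in> PCl m N \<Longrightarrow> e \<in> F_tot q m n N \<Longrightarrow> tensor F e \<in> MM q m n N"
  proof -
    assume "F \<in> PCl m N" "e \<in> F_tot q m n N"
    moreover have "Poly_Mapping.keys (tensor F e) \<subseteq> Poly_Mapping.keys F"
      unfolding tensor_def by (rule keys_sum_subset) simp
    ultimately show ?thesis by (auto simp: MM_def PCl_def lookup_tensor F kconst_A_min)
  qed
qed

lemma MM_sum: "(\<And>i. i \<in> I \<Longrightarrow> f i \<in> MM q m n N) \<Longrightarrow> (\<Sum>i\<in>I. f i) \<in> MM q m n N"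
  by (induction I rule: infinite_finite_induct) (auto intro: MM_closed)

section \<open>Invariance, squares and commutation of the transported operators\<close>

context
  fixes q :: real and m n N :: nat
  assumes Nm: "N \<le> m"
begin

lemma HH_in_MM:
  assumes "i < N" "u \<in> MM q m n N"
  shows "HH q m n N \<sigma> i u \<in> MM q m n N"
proof -
  have "HH q m n N \<sigma> i (Poly_Mapping.single b e) \<in> MM q m n N" if "b \<in> PCl_basis m N" "e \<in> F_tot q m n N" for b e
    unfolding HH_single
  proof (intro MM_closed n_op_in_PCl Nm assms(1) single_in_PCl that(1))
    show "Y_op q m n \<sigma> i b e \<in> F_tot q m n N"
      unfolding F_tot_alt
    proof (rule hat_free_module[OF A_min_ring assms(1)])
      show "e \<in> free_module (words N {x. length x = n}) (A_min (s_par q m n) ({..<N} \<times> {..<n}))"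
        using that(2) by (simp add: F_tot_alt)
      fix x :: fk_idx assume "x \<in> {x. length x = n}"
      then show "N_op q m n i \<sigma> (euler_deg m \<sigma> i b) (Poly_Mapping.single x 1)
          \<in> free_module {x. length x = n} (A_min (s_par q m n) ({..<N} \<times> {..<n}))"
        using N_op_free_module[of x n i "{..<N} \<times> {..<n}"] assms(1) by (simp add: words_UNIV)
    qed
  qed
  then have "(\<Sum>b\<in>Poly_Mapping.keys u. HH q m n N \<sigma> i (Poly_Mapping.single b (Poly_Mapping.lookup u b))) \<in> MM q m n N"
    using MM_D[OF assms(2)] by (intro MM_sum) simp
  then show ?thesis
    unfolding additive.sum[OF HH_additive, symmetric] by (simp only: sum_singles[symmetric])
qed

text \<open>The inner contraction reverses the Clifford parity, so the two signs multiply to -1. It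
  preserves the degree read by the outer operator, so both fermionic operators can be taken at the
  original index \<open>b\<close>.\<close>

lemma HH_HH_single:
  assumes "i < N" "j < N" "\<sigma> = \<tau> \<or> i \<noteq> j" "b \<in> PCl_basis m N"
  shows "HH q m n N \<sigma> i (HH q m n N \<tau> j (Poly_Mapping.single b e)) =
    - tensor (n_op m N \<sigma> i (n_op m N \<tau> j (Poly_Mapping.single b 1))) (Y_op q m n \<sigma> i b (Y_op q m n \<tau> j b e))"
proof -
  let ?F = "n_op m N \<tau> j (Poly_Mapping.single b 1)" and ?e = "Y_op q m n \<tau> j b e" and ?p = "(-1 :: complex) ^ card (snd (snd b))"
  have b: "Poly_Mapping.single b 1 \<in> PCl m N" using assms(4) by (rule single_in_PCl)
  have F: "?F \<in> PCl m N" using n_op_in_PCl[OF Nm b assms(2)] .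
  have "HH q m n N \<sigma> i (tensor ?F ?e) = mscale (- ?p) (tensor (lin_ext (\<lambda>b. n_op m N \<sigma> i (Poly_Mapping.single b 1)) ?F) (Y_op q m n \<sigma> i b ?e))"
    unfolding HH_def
  proof (rule tensor_odd_tensor[OF hat_additive hat_scale])
    fix b' assume b': "b' \<in> Poly_Mapping.keys ?F"
    have "euler_deg m \<sigma> i b' = euler_deg m \<sigma> i b"
      using n_op_degrees(1)[OF Nm assms(4,2) b' assms(1)] assms(3) by blast
    then show "Y_op q m n \<sigma> i b' ?e = Y_op q m n \<sigma> i b ?e" by simp
    show "(-1) ^ card (snd (snd b')) = - ?p"
      by (rule n_op_degrees(2)[OF Nm assms(4,2) b'])
  qed
  also have "lin_ext (\<lambda>b. n_op m N \<sigma> i (Poly_Mapping.single b 1)) ?F = n_op m N \<sigma> i ?F"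
    by (rule lin_ext_eq_on_PCl[OF _ _ F]) (simp_all add: n_op_linear Nm assms(1))
  finally have *: "HH q m n N \<sigma> i (tensor ?F ?e) = mscale (- ?p) (tensor (n_op m N \<sigma> i ?F) (Y_op q m n \<sigma> i b ?e))" .
  have "?p * - ?p = -1" by (simp flip: power_add mult_2)
  then show ?thesis
    unfolding HH_single[of q m n N \<tau> j b e] HH_mscale * mscale_simps(4) by (simp add: mscale_simps)
qed

lemma Y_op_anticommute:
  assumes "i < N" "j < N" "i \<noteq> j" "e \<in> F_tot q m n N"
  shows "Y_op q m n \<sigma> i b (Y_op q m n \<tau> j b e) = - Y_op q m n \<tau> j b (Y_op q m n \<sigma> i b e)"
  by (rule hat_anticommute[of e N "{x. length x = n}"])
    (use assms in \<open>auto simp: F_tot_alt free_module_def intro: N_op_odd\<close>)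

lemma Y_op_square:
  assumes "i < N" "e \<in> F_tot q m n N"
  shows "Y_op q m n \<sigma> i b (Y_op q m n \<sigma> i b e) = 0"
  by (rule hat_square[of e N "{x. length x = n}"])
    (use assms N_op_square in \<open>auto simp: F_tot_alt free_module_def N_op_linear\<close>)

lemma HH_square:
  assumes "i < N" "u \<in> MM q m n N"
  shows "HH q m n N \<sigma> i (HH q m n N \<sigma> i u) = 0"
proof (rule additive_eqI_lookup[where u = u and g = "\<lambda>_. 0"])
  fix b assume "b \<in> Poly_Mapping.keys u"
  then have "b \<in> PCl_basis m N" "Poly_Mapping.lookup u b \<in> F_tot q m n N"
    using MM_D assms(2) by blast+
  then show "HH q m n N \<sigma> i (HH q m n N \<sigma> i (Poly_Mapping.single b (Poly_Mapping.lookup u b))) = 0"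
    by (simp add: HH_HH_single assms(1) Y_op_square tensor_simps)
qed (intro additive_zero additive_comp[OF HH_additive] HH_additive)+

lemma HH_commute:
  assumes "i < N" "j < N" "i \<noteq> j" "u \<in> MM q m n N"
  shows "HH q m n N \<sigma> i (HH q m n N \<tau> j u) = HH q m n N \<tau> j (HH q m n N \<sigma> i u)"
proof (rule additive_eqI_lookup[where u = u])
  fix b assume "b \<in> Poly_Mapping.keys u"
  then have b: "b \<in> PCl_basis m N" "Poly_Mapping.lookup u b \<in> F_tot q m n N"
    using MM_D assms(4) by blast+
  have "n_op m N \<sigma> i (n_op m N \<tau> j (Poly_Mapping.single b 1)) = - n_op m N \<tau> j (n_op m N \<sigma> i (Poly_Mapping.single b 1))"
    using assms(3) by (intro n_op_anticommute Nm single_in_PCl b assms(1,2)) simp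
  moreover have "Y_op q m n \<sigma> i b (Y_op q m n \<tau> j b (Poly_Mapping.lookup u b)) = - Y_op q m n \<tau> j b (Y_op q m n \<sigma> i b (Poly_Mapping.lookup u b))"
    by (rule Y_op_anticommute[OF assms(1-3) b(2)])
  ultimately show "HH q m n N \<sigma> i (HH q m n N \<tau> j (Poly_Mapping.single b (Poly_Mapping.lookup u b)))
      = HH q m n N \<tau> j (HH q m n N \<sigma> i (Poly_Mapping.single b (Poly_Mapping.lookup u b)))"
    using assms(3) by (simp add: HH_HH_single assms(1,2) b(1) tensor_simps)
qed (intro additive_comp[OF HH_additive] HH_additive)+

end

section \<open>Products and exponentials of commuting square-zero operators\<close>

text \<open>The operators are functions on a whole type, but the commutation relations are
  established only on the carrier.\<close>

definition commute_on :: "'a set \<Rightarrow> ('a \<Rightarrow> 'a) \<Rightarrow> ('a \<Rightarrow> 'a) \<Rightarrow> bool" where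
  "commute_on M X Y \<longleftrightarrow> (\<forall>u\<in>M. X (Y u) = Y (X u))"

lemma op_prod_0: "op_prod 0 X = id"
  by (simp add: op_prod_def)

lemma op_prod_Suc: "op_prod (Suc k) X = op_prod k X \<circ> X k"
proof -
  have "foldr (\<circ>) xs (f \<circ> id) = foldr (\<circ>) xs id \<circ> f" for xs and f :: "mspace \<Rightarrow> mspace"
    by (induction xs) (simp_all add: comp_assoc)
  from this[of "map X [0..<k]" "X k"] show ?thesis by (simp add: op_prod_def)
qed

lemma op_prod_in: "(\<And>i. i < k \<Longrightarrow> X i \<in> M \<rightarrow> M) \<Longrightarrow> u \<in> M \<Longrightarrow> op_prod k X u \<in> M"
proof (induction k arbitrary: u)
  case (Suc k)
  have "X k u \<in> M" using Suc.prems by (intro funcset_mem[OF Suc.prems(1)]) auto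
  with Suc show ?case by (simp add: op_prod_Suc)
qed (simp add: op_prod_0)

lemma op_prod_commute:
  assumes "X \<in> M \<rightarrow> M" "\<And>i. i < k \<Longrightarrow> Y i \<in> M \<rightarrow> M" "\<And>i. i < k \<Longrightarrow> commute_on M X (Y i)"
  shows "commute_on M X (op_prod k Y)"
  using assms(2,3)
proof (induction k)
  case (Suc k)
  show ?case
    unfolding commute_on_def
  proof
    fix u assume u: "u \<in> M"
    have "Y k u \<in> M" using Suc.prems(1)[of k] u by auto
    then have "X (op_prod k Y (Y k u)) = op_prod k Y (X (Y k u))"
      using Suc by (simp add: commute_on_def)
    also have "X (Y k u) = Y k (X u)"
      using Suc.prems(2)[of k] u by (simp add: commute_on_def)
    finally show "X (op_prod (Suc k) Y u) = op_prod (Suc k) Y (X u)" by (simp add: op_prod_Suc)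
  qed
qed (simp add: op_prod_0 commute_on_def)

text \<open>The last factor of the first product moves past the earlier factors of the second one.
  Factors with equal index are never exchanged, so commutation is required only for distinct
  indices.\<close>

lemma op_prod_comp:
  assumes "\<And>i. i < k \<Longrightarrow> X i \<in> M \<rightarrow> M" "\<And>i. i < k \<Longrightarrow> Y i \<in> M \<rightarrow> M"
    and "\<And>i j. i < k \<Longrightarrow> j < k \<Longrightarrow> i \<noteq> j \<Longrightarrow> commute_on M (X i) (Y j)" and "u \<in> M"
  shows "op_prod k X (op_prod k Y u) = op_prod k (\<lambda>i. X i \<circ> Y i) u"
  using assms
proof (induction k arbitrary: u)
  case (Suc k)
  have Yk: "Y k u \<in> M" using Suc.prems(2)[of k] \<open>u \<in> M\<close> by auto
  then have XY: "X k (Y k u) \<in> M" using Suc.prems(1)[of k] by auto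
  have "commute_on M (X k) (op_prod k Y)"
    using Suc.prems by (intro op_prod_commute) auto
  then have "X k (op_prod k Y (Y k u)) = op_prod k Y (X k (Y k u))"
    using Yk by (simp add: commute_on_def)
  then show ?case
    using Suc.IH[OF _ _ _ XY] Suc.prems by (simp add: op_prod_Suc)
qed (simp add: op_prod_0)

lemma op_prod_identity:
  assumes "\<And>i u. i < k \<Longrightarrow> u \<in> M \<Longrightarrow> X i u = u" "u \<in> M"
  shows "op_prod k X u = u"
  using assms by (induction k arbitrary: u) (simp_all add: op_prod_0 op_prod_Suc)

lemma commute_on_I:
  assumes "additive H" "additive K" "commute_on M H K"
  shows "commute_on M (I_plus H) (I_plus K)" "commute_on M (I_plus H) (I_minus K)"
    "commute_on M (I_minus H) (I_plus K)" "commute_on M (I_minus H) (I_minus K)"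
  using assms(3)
  by (simp_all add: commute_on_def I_plus_def I_minus_def additiveD[OF assms(1)] additiveD[OF assms(2)]
      additive.diff[OF assms(1)] additive.diff[OF assms(2)] algebra_simps)

lemma commute_on_comp:
  assumes "commute_on M X Z" "commute_on M Y Z" "Y \<in> M \<rightarrow> M"
  shows "commute_on M (X \<circ> Y) Z"
  using assms by (auto simp: commute_on_def Pi_iff)

lemma commute_on_sym: "commute_on M X Y \<Longrightarrow> commute_on M Y X"
  by (auto simp: commute_on_def)

lemma I_inverse:
  assumes "additive H" "H (H u) = 0"
  shows "I_plus H (I_minus H u) = u" "I_minus H (I_plus H u) = u"
  using assms(2) by (simp_all add: I_plus_def I_minus_def additiveD[OF assms(1)] additive.diff[OF assms(1)])

text \<open>Additivity and compatibility with scalars hold on the whole type, whereas vanishing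
  squares and commutation are demanded only on the invariant set \<open>M\<close>. Each of the two
  types of transported operators forms such a family.\<close>

locale square_zero_family =
  fixes M :: "mspace set" and N :: nat and H :: "nat \<Rightarrow> mspace \<Rightarrow> mspace"
  assumes M_closed: "0 \<in> M" "u \<in> M \<Longrightarrow> v \<in> M \<Longrightarrow> u + v \<in> M" "u \<in> M \<Longrightarrow> v \<in> M \<Longrightarrow> u - v \<in> M"
    and H_additive: "additive (H i)" and H_mscale: "H i (mscale c u) = mscale c (H i u)"
    and H_in: "i < N \<Longrightarrow> u \<in> M \<Longrightarrow> H i u \<in> M"
    and H_square: "i < N \<Longrightarrow> u \<in> M \<Longrightarrow> H i (H i u) = 0"
    and H_commute: "i < N \<Longrightarrow> j < N \<Longrightarrow> i \<noteq> j \<Longrightarrow> commute_on M (H i) (H j)"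
begin

lemma I_in: "i < N \<Longrightarrow> I_plus (H i) \<in> M \<rightarrow> M" "i < N \<Longrightarrow> I_minus (H i) \<in> M \<rightarrow> M"
  by (simp_all add: I_plus_def I_minus_def M_closed H_in)

lemma op_prod_inverse:
  assumes "u \<in> M"
  shows "op_prod N (\<lambda>i. I_plus (H i)) (op_prod N (\<lambda>i. I_minus (H i)) u) = u"
    "op_prod N (\<lambda>i. I_minus (H i)) (op_prod N (\<lambda>i. I_plus (H i)) u) = u"
proof -
  have "op_prod N (\<lambda>i. I_plus (H i)) (op_prod N (\<lambda>i. I_minus (H i)) u) = op_prod N (\<lambda>i. I_plus (H i) \<circ> I_minus (H i)) u"
    using assms by (intro op_prod_comp[where M = M] I_in commute_on_I H_additive H_commute)
  also have "\<dots> = u"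
    using assms by (intro op_prod_identity[where M = M]) (simp_all add: I_inverse H_additive H_square)
  finally show "op_prod N (\<lambda>i. I_plus (H i)) (op_prod N (\<lambda>i. I_minus (H i)) u) = u" .
  have "op_prod N (\<lambda>i. I_minus (H i)) (op_prod N (\<lambda>i. I_plus (H i)) u) = op_prod N (\<lambda>i. I_minus (H i) \<circ> I_plus (H i)) u"
    using assms by (intro op_prod_comp[where M = M] I_in commute_on_I H_additive H_commute)
  also have "\<dots> = u"
    using assms by (intro op_prod_identity[where M = M]) (simp_all add: I_inverse H_additive H_square)
  finally show "op_prod N (\<lambda>i. I_minus (H i)) (op_prod N (\<lambda>i. I_plus (H i)) u) = u" .
qed

section \<open>Powers and exponential of a sum of commuting square-zero operators\<close>

definition partial :: "nat \<Rightarrow> mspace \<Rightarrow> mspace" where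
  "partial k u = (\<Sum>i<k. H i u)"

lemma partial_linear: "additive (partial k)" "partial k (mscale c u) = mscale c (partial k u)"
proof -
  show "additive (partial k)"
    unfolding partial_def by (intro additive_sum_fun H_additive)
  show "partial k (mscale c u) = mscale c (partial k u)"
    by (simp add: partial_def H_mscale additive.sum[OF additive_mscale])
qed

lemma partial_Suc: "partial (Suc k) u = partial k u + H k u"
  by (simp add: partial_def)

lemma partial_in: "k \<le> N \<Longrightarrow> u \<in> M \<Longrightarrow> partial k u \<in> M"
  by (induction k) (simp_all add: partial_Suc M_closed H_in, simp add: partial_def M_closed)

lemma funpow_partial_in: "k \<le> N \<Longrightarrow> u \<in> M \<Longrightarrow> (partial k ^^ p) u \<in> M"
  by (induction p) (auto intro: partial_in)

lemma funpow_partial_additive: "additive (partial k ^^ p)"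
  by (induction p) (simp_all add: additive_id[unfolded id_def[symmetric]] additive_def additiveD[OF partial_linear(1)])

lemma H_partial: "k < N \<Longrightarrow> u \<in> M \<Longrightarrow> H k ((partial k ^^ p) u) = (partial k ^^ p) (H k u)"
proof (induction p)
  case (Suc p)
  let ?v = "(partial k ^^ p) u"
  have v: "?v \<in> M" using Suc.prems by (intro funpow_partial_in) auto
  have "H k (partial k v) = partial k (H k v)" if "v \<in> M" for v
    unfolding partial_def additive.sum[OF H_additive]
    by (rule sum.cong) (use H_commute[of k] Suc.prems that in \<open>auto simp: commute_on_def\<close>)
  from this[OF v] have "H k (partial k ?v) = partial k (H k ?v)" .
  then show ?case using Suc by simp
qed simp

text \<open>The binomial expansion breaks off after two terms because \<open>H k\<close> squares to
  0. For \<open>p = 0\<close> the coefficient \<open>of_nat p\<close> makes the truncated exponent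
  \<open>p - 1\<close> harmless.\<close>

lemma funpow_partial_Suc:
  assumes "k < N" "u \<in> M"
  shows "(partial (Suc k) ^^ p) u = (partial k ^^ p) u + mscale (of_nat p) ((partial k ^^ (p - 1)) (H k u))"
proof (induction p)
  case (Suc p)
  let ?S = "\<lambda>p. partial k ^^ p"
  have "H k (?S (p - 1) (H k u)) = 0"
    by (simp add: H_partial[OF assms(1) H_in[OF assms]] H_square[OF assms] additive.zero[OF funpow_partial_additive])
  then have "(partial (Suc k) ^^ Suc p) u = ?S (Suc p) u + mscale (of_nat p) (partial k (?S (p - 1) (H k u))) + ?S p (H k u)"
    by (simp add: Suc partial_Suc additiveD[OF partial_linear(1)] additiveD[OF H_additive] partial_linear H_mscale
        mscale_simps H_partial[OF assms] add_ac)
  moreover have "mscale (of_nat p) (partial k (?S (p - 1) (H k u))) = mscale (of_nat p) (?S p (H k u))"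
    by (cases p) (simp_all add: mscale_simps)
  ultimately show ?case
    by (simp add: mscale_simps add_ac)
qed (simp add: mscale_simps)

text \<open>A product of more than \<open>k\<close> factors taken from \<open>k\<close> commuting
  operators repeats one of them. The two-term expansion turns this into an induction on
  \<open>k\<close>.\<close>

lemma funpow_partial_zero: "k \<le> N \<Longrightarrow> u \<in> M \<Longrightarrow> k < p \<Longrightarrow> (partial k ^^ p) u = 0"
proof (induction k arbitrary: u p)
  case 0
  then obtain p' where "p = Suc p'" by (cases p) auto
  then show ?case by (simp add: partial_def)
next
  case (Suc k)
  then show ?case
    using funpow_partial_Suc[of k u p] H_in[of k u] by (simp add: mscale_simps)
qed

text \<open>The cutoff \<open>N\<close> does not depend on \<open>k\<close>, so that the induction
  compares sums over one range. Powers beyond \<open>k \<le> N\<close> vanish on \<open>M\<close>,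
  hence the sum is the full exponential there.\<close>

definition exp_sum :: "nat \<Rightarrow> mspace \<Rightarrow> mspace" where
  "exp_sum k u = (\<Sum>p\<le>N. mscale (1 / fact p) ((partial k ^^ p) u))"

text \<open>Adding \<open>H k\<close> to the exponent multiplies the exponential by the factor
  \<open>I_plus (H k)\<close>: in the second term of the expansion, \<open>p\<close> over
  \<open>fact p\<close> is the reciprocal of \<open>fact (p - 1)\<close>, and a shift of the index
  gives the old series at \<open>H k u\<close>.\<close>

lemma exp_sum_product: "k \<le> N \<Longrightarrow> u \<in> M \<Longrightarrow> exp_sum k u = op_prod k (\<lambda>i. I_plus (H i)) u"
proof (induction k arbitrary: u)
  case 0
  have "exp_sum 0 u = (\<Sum>p\<le>N. if p = 0 then u else 0)"
    unfolding exp_sum_def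
    by (rule sum.cong) (use funpow_partial_zero[OF _ 0(2), of 0] in \<open>auto simp: mscale_simps\<close>)
  then show ?case by (simp add: op_prod_0)
next
  case (Suc k)
  then have k: "k < N" and Hu: "H k u \<in> M" by (auto intro: H_in)
  have "(\<Sum>p\<le>N. mscale (of_nat p / fact p) ((partial k ^^ (p - 1)) (H k u)))
      = (\<Sum>p\<in>{1..N}. mscale (of_nat p / fact p) ((partial k ^^ (p - 1)) (H k u)))"
    by (rule sum.mono_neutral_right) (auto simp: mscale_simps not_less_eq_eq)
  also have "\<dots> = (\<Sum>p<N. mscale (1 / fact p) ((partial k ^^ p) (H k u)))"
    by (rule sum.reindex_bij_witness[of _ Suc "\<lambda>p. p - 1"]) (auto simp: fact_reduce)
  \<comment> \<open>The shift has lost the term with \<open>p = N\<close>, which is 0 because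
    \<open>k < N\<close>.\<close>
  also have "\<dots> = exp_sum k (H k u)"
    unfolding exp_sum_def
    by (rule sum.mono_neutral_left) (use funpow_partial_zero[OF _ Hu, of k] k in \<open>auto simp: mscale_simps not_less\<close>)
  finally have "exp_sum (Suc k) u = exp_sum k u + exp_sum k (H k u)"
    unfolding exp_sum_def funpow_partial_Suc[OF k Suc.prems(2)]
    by (simp add: mscale_simps sum.distrib)
  also have "\<dots> = exp_sum k (I_plus (H k) u)"
    by (simp add: exp_sum_def I_plus_def additiveD[OF funpow_partial_additive] mscale_simps sum.distrib)
  also have "\<dots> = op_prod k (\<lambda>i. I_plus (H i)) (I_plus (H k) u)"
    using Suc Hu by (intro Suc.IH) (auto simp: I_plus_def intro: M_closed)
  finally show ?case by (simp add: op_prod_Suc)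
qed

text \<open>Nilpotency confines the nonzero powers to \<open>{..N}\<close>. The index set of
  \<open>op_exp\<close> is therefore finite, and filling it up to \<open>{..N}\<close> adds only
  zero terms.\<close>

lemma op_exp_product:
  assumes "u \<in> M"
  shows "op_exp (\<lambda>u. \<Sum>i<N. H i u) u = op_prod N (\<lambda>i. I_plus (H i)) u"
proof -
  have "op_exp (partial N) u = exp_sum N u"
    unfolding op_exp_def exp_sum_def
  proof (rule sum.mono_neutral_left)
    show "{p. (partial N ^^ p) u \<noteq> 0} \<subseteq> {..N}"
      using funpow_partial_zero[OF order_refl assms] by (auto simp: not_less[symmetric])
  qed (simp_all add: mscale_simps)
  moreover have "(\<lambda>u. \<Sum>i<N. H i u) = partial N"
    by (simp add: fun_eq_iff partial_def)
  ultimately show ?thesis using exp_sum_product[OF order_refl assms] by simp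
qed

end

text \<open>Inverses are expressed by \<open>inv_into\<close>, which is an inverse on the carrier
  only for a bijection of it. Invariance and bijectivity are therefore part of the
  conclusion.\<close>

theorem proposition6p7:
  fixes q :: real and m n N :: nat
  assumes "0 < q" "q < 1" "1 \<le> N" "1 \<le> n" "2 * N \<le> m"
  shows
    "(\<forall>\<sigma>. \<forall>i<N. HH q m n N \<sigma> i \<in> MM q m n N \<rightarrow> MM q m n N) \<and>
     (\<forall>\<sigma>. \<forall>i<N. \<forall>u\<in>MM q m n N. HH q m n N \<sigma> i (HH q m n N \<sigma> i u) = 0) \<and>
     (\<forall>\<sigma> \<tau>. \<forall>i<N. \<forall>j<N. i \<noteq> j \<longrightarrow>
        (\<forall>u\<in>MM q m n N. commutator (HH q m n N \<sigma> i) (HH q m n N \<tau> j) u = 0)) \<and>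
     (\<forall>\<sigma>. \<forall>u\<in>MM q m n N. UU q m n N \<sigma> u = op_prod N (\<lambda>i. I_plus (HH q m n N \<sigma> i)) u) \<and>
     bij_betw (UU q m n N Minus) (MM q m n N) (MM q m n N) \<and>
     (\<forall>u\<in>MM q m n N. RR q m n N u = op_prod N (RRi q m n N) u) \<and>
     (\<forall>i<N. \<forall>j<N. \<forall>u\<in>MM q m n N. commutator (RRi q m n N i) (RRi q m n N j) u = 0) \<and>
     (\<forall>i<N. bij_betw (RRi q m n N i) (MM q m n N) (MM q m n N) \<and>
        (\<forall>u\<in>MM q m n N. inv_into (MM q m n N) (RRi q m n N i) u =
           I_plus (HH q m n N Minus i) (I_minus (HH q m n N Plus i) u)))"
proof -
  let ?M = "MM q m n N" and ?H = "HH q m n N" and ?R = "RRi q m n N"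
  have Nm: "N \<le> m" using assms(5) by simp
  have com: "commute_on ?M (?H \<sigma> i) (?H \<tau> j)" if "i < N" "j < N" "i \<noteq> j" for \<sigma> \<tau> i j
    using HH_commute[OF Nm that] by (simp add: commute_on_def)
  have fam: "square_zero_family ?M N (?H \<sigma>)" for \<sigma>
    by (rule square_zero_family.intro)
      (simp_all add: MM_closed HH_additive HH_mscale HH_in_MM[OF Nm] HH_square[OF Nm] com)
  note I_in = square_zero_family.I_in[OF fam]
  note I_com = commute_on_I[OF HH_additive HH_additive com]
  note inv = I_inverse[OF HH_additive HH_square[OF Nm]]
  have U: "UU q m n N \<sigma> u = op_prod N (\<lambda>i. I_plus (?H \<sigma> i)) u" if "u \<in> ?M" for \<sigma> u
    unfolding UU_def using square_zero_family.op_exp_product[OF fam that] .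
  \<comment> \<open>The inverse of a factor \<open>I + H\<close> is \<open>I - H\<close>, and since
    factors with distinct labels commute, the order of the product need not be reversed.\<close>
  let ?Q = "op_prod N (\<lambda>i. I_minus (?H Minus i))"
  have Q_in: "?Q u \<in> ?M" if "u \<in> ?M" for u
    using that by (intro op_prod_in I_in)
  have U_in: "UU q m n N \<sigma> u \<in> ?M" if "u \<in> ?M" for \<sigma> u
    unfolding U[OF that] using that by (intro op_prod_in I_in)
  have QU: "?Q (UU q m n N Minus u) = u" "UU q m n N Minus (?Q u) = u" if "u \<in> ?M" for u
    using square_zero_family.op_prod_inverse[OF fam that] by (simp_all add: U that Q_in)
  have bij_U: "bij_betw (UU q m n N Minus) ?M ?M"
    by (rule bij_betw_byWitness[where f' = ?Q]) (use QU U_in Q_in in auto)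
  have inv_U: "inv_into ?M (UU q m n N Minus) u = ?Q u" if "u \<in> ?M" for u
    using bij_betw_imp_inj_on[OF bij_U] that by (intro inv_into_f_eq) (simp_all add: Q_in QU)
  have RR: "RR q m n N u = op_prod N ?R u" if "u \<in> ?M" for u
  proof -
    have "RR q m n N u = op_prod N (\<lambda>i. I_plus (?H Plus i)) (?Q u)"
      using that by (simp add: RR_def inv_U U Q_in)
    also have "\<dots> = op_prod N (\<lambda>i. I_plus (?H Plus i) \<circ> I_minus (?H Minus i)) u"
      using that by (intro op_prod_comp[where M = ?M] I_in I_com)
    finally show ?thesis by (simp add: RRi_def[abs_def])
  qed
  have R_in: "?R i \<in> ?M \<rightarrow> ?M" if "i < N" for i
    using I_in(1)[OF that, of Plus] I_in(2)[OF that, of Minus] by (auto simp: RRi_def Pi_iff)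
  have R_com: "commute_on ?M (?R i) (?R j)" if "i < N" "j < N" for i j
  proof (cases "i = j")
    case False
    have "commute_on ?M (?R i) (I_plus (?H Plus j))" "commute_on ?M (?R i) (I_minus (?H Minus j))"
      unfolding RRi_def using that False by (auto intro!: commute_on_comp I_com I_in)
    then have "commute_on ?M (?R j) (?R i)"
      \<comment> \<open>\<open>commute_on_comp\<close> splits only its left operator. So
        \<open>?R i\<close> is first shown to commute with each factor of \<open>?R j\<close>, and
        symmetry then lets \<open>?R j\<close> be split as well.\<close>
      unfolding RRi_def[of q m n N j] using that by (intro commute_on_comp I_in) (auto intro: commute_on_sym)
    then show ?thesis by (rule commute_on_sym)
  qed (simp add: commute_on_def)
  have R_inv: "bij_betw (?R i) ?M ?M \<and>
      (\<forall>u\<in>?M. inv_into ?M (?R i) u = I_plus (?H Minus i) (I_minus (?H Plus i) u))" if i: "i < N" for i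
  proof -
    \<comment> \<open>The two factors of \<open>?R i\<close> need not commute, so here their
      inverses appear in reverse order.\<close>
    let ?S = "\<lambda>u. I_plus (?H Minus i) (I_minus (?H Plus i) u)"
    have I: "I_plus (?H \<sigma> i) u \<in> ?M" "I_minus (?H \<sigma> i) u \<in> ?M" if "u \<in> ?M" for u \<sigma>
      using I_in[OF i, of \<sigma>] that by auto
    have S: "?S u \<in> ?M" "?S (?R i u) = u" "?R i (?S u) = u" if "u \<in> ?M" for u
      using that by (simp_all add: RRi_def I inv[OF i])
    have bij: "bij_betw (?R i) ?M ?M"
      by (rule bij_betw_byWitness[where f' = ?S]) (use S R_in[OF i] in auto)
    then show ?thesis
      using S by (auto intro!: inv_into_f_eq dest: bij_betw_imp_inj_on)
  qed
  show ?thesis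
    using HH_in_MM[OF Nm] HH_square[OF Nm] com U bij_U RR R_com R_inv
    by (auto simp: commutator_def commute_on_def)
qed

end
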